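(* Let $m\ge0$ and let $V=(V_{ij})_{i,j=1}^2$ be a $2\times 2$ matrix-valued function on $\mathbb{R}$ (not assumed Hermitian) with $V_{ij}\in L^1(\mathbb{R})+L^\infty_0(\mathbb{R})$ for $i,j=1,2$. Let $H$ be the Dirac operator with potential $V$ (described in the context). Let $z\in\rho(H_0)=\mathbb{C}\setminus\big((-\infty,-m]\cup[m,\infty)\big)$ and set $$\eta(|\Phi(z)|):=\frac1{\sqrt2}\sqrt{1+\frac{|z|^2+m^2}{|z^2-m^2|}} .$$ For $\varepsilon>0$ let $$C_\varepsilon:=\inf\left\{\int_{\mathbb{R}}\|W(x)\|\,dx \;:\; V=W+X,\ W_{ij}\in L^1(\mathbb{R}),\ \|X\|\le\varepsilon\right\}\in[0,\infty).$$ If for some $\varepsilon>0$ $$C_\varepsilon<\eta(|\Phi(z)|)^{-1}$$ and $$\frac1{\operatorname{dist}(z,\sigma(H_0))}+\frac{\eta(|\Phi(z)|)^2}{\operatorname{Im}\sqrt{z^2-m^2}}\;\frac{C_\varepsilon}{1-\eta(|\Phi(z)|)\,C_\varepsilon}<\frac1\varepsilon,$$ then $z\notin\sigma(H)$.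
   Context: Units are chosen so that $\hbar=c=1$. The Hilbert space is $\mathcal{H}=L^2(\mathbb{R})\otimes\mathbb{C}^2=L^2(\mathbb{R};\mathbb{C}^2)$. The free Dirac operator is the selfadjoint operator $H_0=-i\frac{d}{dx}\sigma_1+m\sigma_3$ with domain $H^1(\mathbb{R};\mathbb{C}^2)$, where $\sigma_1=\begin{pmatrix}0&1\\1&0\end{pmatrix}$, $\sigma_3=\begin{pmatrix}1&0\\0&-1\end{pmatrix}$; $\sigma(H_0)=(-\infty,-m]\cup[m,\infty)$ and $R_0(z)=(H_0-z)^{-1}$. $L^\infty_0(\mathbb{R})$ is the space of bounded functions that vanish at infinity. $\|W(x)\|$ is the operator norm of the matrix $W(x)$ on $\mathbb{C}^2$ with Euclidean norm; matrix functions are identified with the closed maximal multiplication operators in $\mathcal{H}$, and $\|X\|$ is the operator norm of $X$ on $\mathcal{H}$ (the essential supremum of $\|X(x)\|$). Definition of $H$: let $V=U|V|$ be the polar decomposition and $A:=|V|^{1/2}$, $B:=U|V|^{1/2}$, so $V=BA$. For $z\in\rho(H_0)$, $AR_0(z)$ is bounded and $R_0(z)B$, $AR_0(z)B$ have bounded closures; put $Q(z):=\overline{AR_0(z)B}$. Then $H$ is the closed densely defined extension of $H_0+V$ with $\rho(H)\cap\rho(H_0)=\{z\in\rho(H_0): -1\in\rho(Q(z))\}\neq\emptyset$ and, for $z$ in this set, $(H-z)^{-1}=R_0(z)-\overline{R_0(z)B}\,(I+Q(z))^{-1}AR_0(z)$. If $V$ is bounded, $H=H_0+V$ on the domain of $H_0$.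 The branch of $\sqrt{z^2-m^2}$, $z\in\rho(H_0)$, is chosen such that $\operatorname{Im}\sqrt{z^2-m^2}>0$. The symbol $\eta(|\Phi(z)|)$ equals $\eta(s)=\sqrt{\frac12+\frac14(s+s^{-1})}$ evaluated at $s=|\Phi(z)|$, $\Phi(z)=\frac{z+m}{z-m}$. *)

theory Defs
  imports "HOL-Analysis.Analysis" "HOL-Probability.Essential_Supremum"
begin

section \<open>The Hilbert space of square-integrable spinors\<close>

definition L2_fun :: "(real \<Rightarrow> complex^2) set" where
  "L2_fun = {f \<in> borel_measurable lebesgue. integrable lebesgue (\<lambda>x. (norm (f x))\<^sup>2)}"

lemma L2_fun_0: "(\<lambda>x. 0) \<in> L2_fun"
  by (simp add: L2_fun_def)

lemma vec_norm_smult: "norm (c *s v) = norm c * norm v" for c :: complex and v :: "complex^'n"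
  by (simp add: norm_vec_def L2_set_def norm_mult power_mult_distrib real_sqrt_mult
      flip: sum_distrib_left)

lemma continuous_on_smult: "continuous_on UNIV (\<lambda>v :: complex^'n. c *s v)"
  unfolding vector_scalar_mult_def by (intro continuous_intros)

lemma L2_fun_add:
  assumes "f \<in> L2_fun" "g \<in> L2_fun"
  shows "(\<lambda>x. f x + g x) \<in> L2_fun"
proof -
  have [measurable]: "f \<in> borel_measurable lebesgue" "g \<in> borel_measurable lebesgue"
    and i: "integrable lebesgue (\<lambda>x. (norm (f x))\<^sup>2)" "integrable lebesgue (\<lambda>x. (norm (g x))\<^sup>2)"
    using assms by (auto simp: L2_fun_def)
  have "integrable lebesgue (\<lambda>x. 2 * (norm (f x))\<^sup>2 + 2 * (norm (g x))\<^sup>2)"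
    using i by simp
  then have "integrable lebesgue (\<lambda>x. (norm (f x + g x))\<^sup>2)"
  proof (rule Bochner_Integration.integrable_bound)
    show "AE x in lebesgue. norm ((norm (f x + g x))\<^sup>2)
            \<le> norm (2 * (norm (f x))\<^sup>2 + 2 * (norm (g x))\<^sup>2)"
    proof (rule AE_I2)
      fix x
      have "(norm (f x + g x))\<^sup>2 \<le> (norm (f x) + norm (g x))\<^sup>2"
        by (intro power_mono norm_triangle_ineq) auto
      also have "\<dots> \<le> 2 * (norm (f x))\<^sup>2 + 2 * (norm (g x))\<^sup>2"
        using sum_squares_bound[of "norm (f x)" "norm (g x)"] by (simp add: power2_sum)
      finally show "norm ((norm (f x + g x))\<^sup>2) \<le> norm (2 * (norm (f x))\<^sup>2 + 2 * (norm (g x))\<^sup>2)"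
        by simp
    qed
  qed measurable
  then show ?thesis by (simp add: L2_fun_def)
qed

lemma L2_fun_smult:
  assumes "f \<in> L2_fun" shows "(\<lambda>x. c *s f x) \<in> L2_fun"
proof -
  have "f \<in> borel_measurable lebesgue" using assms by (simp add: L2_fun_def)
  then have "(\<lambda>x. c *s f x) \<in> borel_measurable lebesgue"
    using borel_measurable_continuous_onI[OF continuous_on_smult[of c]]
    by (rule measurable_compose)
  then show ?thesis
    using assms by (simp add: L2_fun_def vec_norm_smult power_mult_distrib)
qed

lemma L2_fun_scaleR: "f \<in> L2_fun \<Longrightarrow> (\<lambda>x. r *\<^sub>R f x) \<in> L2_fun"
  by (auto simp: L2_fun_def power_mult_distrib)

lemma L2_fun_inner_integrable:
  assumes "f \<in> L2_fun" "g \<in> L2_fun"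
  shows "integrable lebesgue (\<lambda>x. f x \<bullet> g x)"
proof -
  have [measurable]: "f \<in> borel_measurable lebesgue" "g \<in> borel_measurable lebesgue"
    and i: "integrable lebesgue (\<lambda>x. (norm (f x))\<^sup>2)" "integrable lebesgue (\<lambda>x. (norm (g x))\<^sup>2)"
    using assms by (auto simp: L2_fun_def)
  have "integrable lebesgue (\<lambda>x. (norm (f x))\<^sup>2 + (norm (g x))\<^sup>2)"
    using i by simp
  then show ?thesis
  proof (rule Bochner_Integration.integrable_bound)
    show "AE x in lebesgue. norm (f x \<bullet> g x) \<le> norm ((norm (f x))\<^sup>2 + (norm (g x))\<^sup>2)"
    proof (rule AE_I2)
      fix x
      have "\<bar>f x \<bullet> g x\<bar> \<le> norm (f x) * norm (g x)"
        by (rule Cauchy_Schwarz_ineq2)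
      moreover have "2 * (norm (f x) * norm (g x)) \<le> (norm (f x))\<^sup>2 + (norm (g x))\<^sup>2"
        using sum_squares_bound[of "norm (f x)" "norm (g x)"] by simp
      moreover have "0 \<le> norm (f x) * norm (g x)" by simp
      ultimately show "norm (f x \<bullet> g x) \<le> norm ((norm (f x))\<^sup>2 + (norm (g x))\<^sup>2)"
        by simp
    qed
  qed measurable
qed

quotient_type spinor = "real \<Rightarrow> complex^2" / partial:
  "\<lambda>f g. f \<in> L2_fun \<and> g \<in> L2_fun \<and> (AE x in lebesgue. f x = g x)"
proof (rule part_equivpI)
  show "\<exists>f. f \<in> L2_fun \<and> f \<in> L2_fun \<and> (AE x in lebesgue. f x = f x)"
    using L2_fun_0 by auto
  show "symp (\<lambda>f g. f \<in> L2_fun \<and> g \<in> L2_fun \<and> (AE x in lebesgue. f x = g x))"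
    by (rule sympI) (auto elim: eventually_mono)
  show "transp (\<lambda>f g. f \<in> L2_fun \<and> g \<in> L2_fun \<and> (AE x in lebesgue. f x = g x))"
    by (rule transpI) (auto elim: eventually_elim2)
qed

text \<open>\<open>rep_spinor f\<close> is a representative of the class \<open>f\<close>; all notions below depend only on
  its values almost everywhere.\<close>

lemma rep_spinor_L2: "rep_spinor f \<in> L2_fun"
  using Quotient3_rep_reflp[OF Quotient3_spinor, of f] by simp

lemma abs_rep_spinor: "abs_spinor (rep_spinor f) = f"
  by (rule Quotient3_abs_rep[OF Quotient3_spinor])

lemma rep_abs_spinor:
  assumes "f \<in> L2_fun" shows "AE x in lebesgue. rep_spinor (abs_spinor f) x = f x"
proof -
  have "f \<in> L2_fun \<and> f \<in> L2_fun \<and> (AE x in lebesgue. f x = f x)" using assms by simp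
  from Quotient3_rep_abs[OF Quotient3_spinor, OF this] show ?thesis by simp
qed

lemma spinor_eq_iff: "f = g \<longleftrightarrow> (AE x in lebesgue. rep_spinor f x = rep_spinor g x)"
  using Quotient3_rel_rep[OF Quotient3_spinor, of f g] rep_spinor_L2 by auto

lift_definition cscale :: "complex \<Rightarrow> spinor \<Rightarrow> spinor" is "\<lambda>c f x. c *s f x"
  by (auto simp: L2_fun_smult elim: eventually_mono)

text \<open>The inner product is the real part of the Hermitian one, which induces the same norm.\<close>

instantiation spinor :: real_inner
begin

lift_definition zero_spinor :: spinor is "\<lambda>x. 0"
  by (simp add: L2_fun_0)

lift_definition plus_spinor :: "spinor \<Rightarrow> spinor \<Rightarrow> spinor" is "\<lambda>f g x. f x + g x"
  by (auto simp: L2_fun_add elim: eventually_elim2)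

lift_definition scaleR_spinor :: "real \<Rightarrow> spinor \<Rightarrow> spinor" is "\<lambda>r f x. r *\<^sub>R f x"
  by (auto simp: L2_fun_scaleR elim: eventually_mono)

definition uminus_spinor :: "spinor \<Rightarrow> spinor" where
  "- f = (- 1) *\<^sub>R f" for f :: spinor

definition minus_spinor :: "spinor \<Rightarrow> spinor \<Rightarrow> spinor" where
  "f - g = f + - g" for f g :: spinor

definition inner_spinor :: "spinor \<Rightarrow> spinor \<Rightarrow> real" where
  "f \<bullet> g = (LINT x|lebesgue. rep_spinor f x \<bullet> rep_spinor g x)"

definition norm_spinor :: "spinor \<Rightarrow> real" where
  "norm f = sqrt (f \<bullet> f)" for f :: spinor

definition dist_spinor :: "spinor \<Rightarrow> spinor \<Rightarrow> real" where
  "dist f g = norm (f - g)" for f g :: spinor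

definition sgn_spinor :: "spinor \<Rightarrow> spinor" where
  "sgn f = inverse (norm f) *\<^sub>R f" for f :: spinor

definition uniformity_spinor :: "(spinor \<times> spinor) filter" where
  "uniformity_spinor = (INF e\<in>{0<..}. principal {(f, g). dist f g < e})"

definition open_spinor :: "spinor set \<Rightarrow> bool" where
  "open_spinor U = (\<forall>f\<in>U. eventually (\<lambda>(f', g). f' = f \<longrightarrow> g \<in> U) uniformity)"

lemma rep_spinor_zero: "AE x in lebesgue. rep_spinor 0 x = 0"
  unfolding zero_spinor.abs_eq by (rule rep_abs_spinor[OF L2_fun_0])

lemma rep_spinor_plus:
  "AE x in lebesgue. rep_spinor (f + g) x = rep_spinor f x + rep_spinor g x"
  using rep_abs_spinor[OF L2_fun_add[OF rep_spinor_L2 rep_spinor_L2], of f g]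
  by (simp add: plus_spinor_def)

lemma rep_spinor_scaleR: "AE x in lebesgue. rep_spinor (r *\<^sub>R f) x = r *\<^sub>R rep_spinor f x"
  using rep_abs_spinor[OF L2_fun_scaleR[OF rep_spinor_L2], of r f]
  by (simp add: scaleR_spinor_def)

lemma rep_spinor_cscale: "AE x in lebesgue. rep_spinor (cscale c f) x = c *s rep_spinor f x"
  using rep_abs_spinor[OF L2_fun_smult[OF rep_spinor_L2], of c f]
  by (simp add: cscale_def)

instance
proof
  fix a b :: real and f g h :: spinor
  show "f + g + h = f + (g + h)"
    unfolding spinor_eq_iff
    using rep_spinor_plus[of "f + g" h] rep_spinor_plus[of f g]
      rep_spinor_plus[of f "g + h"] rep_spinor_plus[of g h]
    by eventually_elim simp
  show "f + g = g + f"
    unfolding spinor_eq_iff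
    using rep_spinor_plus[of f g] rep_spinor_plus[of g f] by eventually_elim simp
  show "0 + f = f"
    unfolding spinor_eq_iff
    using rep_spinor_plus[of 0 f] rep_spinor_zero by eventually_elim simp
  show "- f + f = 0"
    unfolding spinor_eq_iff uminus_spinor_def
    using rep_spinor_plus[of "(- 1) *\<^sub>R f" f] rep_spinor_scaleR[of "- 1" f] rep_spinor_zero
    by eventually_elim simp
  show "f - g = f + - g" by (rule minus_spinor_def)
  show "a *\<^sub>R (f + g) = a *\<^sub>R f + a *\<^sub>R g"
    unfolding spinor_eq_iff
    using rep_spinor_scaleR[of a "f + g"] rep_spinor_plus[of f g]
      rep_spinor_plus[of "a *\<^sub>R f" "a *\<^sub>R g"] rep_spinor_scaleR[of a f] rep_spinor_scaleR[of a g]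
    by eventually_elim (simp add: scaleR_right_distrib)
  show "(a + b) *\<^sub>R f = a *\<^sub>R f + b *\<^sub>R f"
    unfolding spinor_eq_iff
    using rep_spinor_scaleR[of "a + b" f]
      rep_spinor_plus[of "a *\<^sub>R f" "b *\<^sub>R f"] rep_spinor_scaleR[of a f] rep_spinor_scaleR[of b f]
    by eventually_elim (simp add: scaleR_left_distrib)
  show "a *\<^sub>R b *\<^sub>R f = (a * b) *\<^sub>R f"
    unfolding spinor_eq_iff
    using rep_spinor_scaleR[of a "b *\<^sub>R f"] rep_spinor_scaleR[of b f] rep_spinor_scaleR[of "a * b" f]
    by eventually_elim simp
  show "1 *\<^sub>R f = f"
    unfolding spinor_eq_iff using rep_spinor_scaleR[of 1 f] by eventually_elim simp
  show "dist f g = norm (f - g)" by (rule dist_spinor_def)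
  show "sgn f = inverse (norm f) *\<^sub>R f" by (rule sgn_spinor_def)
  show "uniformity = (INF e\<in>{0<..}. principal {(f, g). dist (f :: spinor) g < e})"
    by (rule uniformity_spinor_def)
  show "open U \<longleftrightarrow> (\<forall>f\<in>U. \<forall>\<^sub>F (f', g) in uniformity. f' = f \<longrightarrow> g \<in> U)" for U :: "spinor set"
    by (rule open_spinor_def)
  have int: "integrable lebesgue (\<lambda>x. rep_spinor f x \<bullet> rep_spinor g x)" for f g
    by (rule L2_fun_inner_integrable[OF rep_spinor_L2 rep_spinor_L2])
  have ms [measurable]: "rep_spinor f \<in> borel_measurable lebesgue" for f
    using rep_spinor_L2[of f] by (simp add: L2_fun_def)
  show "f \<bullet> g = g \<bullet> f"
    by (simp add: inner_spinor_def inner_commute)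
  have "(f + g) \<bullet> h
      = (LINT x|lebesgue. rep_spinor f x \<bullet> rep_spinor h x + rep_spinor g x \<bullet> rep_spinor h x)"
    unfolding inner_spinor_def
  proof (rule integral_cong_AE)
    show "AE x in lebesgue. rep_spinor (f + g) x \<bullet> rep_spinor h x
        = rep_spinor f x \<bullet> rep_spinor h x + rep_spinor g x \<bullet> rep_spinor h x"
      using rep_spinor_plus[of f g] by eventually_elim (simp add: inner_left_distrib)
  qed measurable
  then show "(f + g) \<bullet> h = f \<bullet> h + g \<bullet> h"
    by (simp add: inner_spinor_def int)
  have "(a *\<^sub>R f) \<bullet> g = (LINT x|lebesgue. a * (rep_spinor f x \<bullet> rep_spinor g x))"
    unfolding inner_spinor_def
  proof (rule integral_cong_AE)
    show "AE x in lebesgue. rep_spinor (a *\<^sub>R f) x \<bullet> rep_spinor g x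
        = a * (rep_spinor f x \<bullet> rep_spinor g x)"
      using rep_spinor_scaleR[of a f] by eventually_elim simp
  qed measurable
  then show "(a *\<^sub>R f) \<bullet> g = a * (f \<bullet> g)"
    by (simp add: inner_spinor_def)
  show "0 \<le> f \<bullet> f"
    by (simp add: inner_spinor_def)
  have "f \<bullet> f = 0 \<longleftrightarrow> (AE x in lebesgue. rep_spinor f x \<bullet> rep_spinor f x = 0)"
    unfolding inner_spinor_def by (rule integral_nonneg_eq_0_iff_AE[OF int]) simp
  also have "\<dots> \<longleftrightarrow> (AE x in lebesgue. rep_spinor f x = 0)"
    by simp
  also have "\<dots> \<longleftrightarrow> f = 0"
  proof
    assume "AE x in lebesgue. rep_spinor f x = 0"
    then show "f = 0"
      unfolding spinor_eq_iff using rep_spinor_zero by eventually_elim simp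
  next
    assume "f = 0"
    then show "AE x in lebesgue. rep_spinor f x = 0" using rep_spinor_zero by simp
  qed
  finally show "f \<bullet> f = 0 \<longleftrightarrow> f = 0" .
  show "norm f = sqrt (f \<bullet> f)" by (rule norm_spinor_def)
qed

end


section \<open>Unbounded operators\<close>

text \<open>An operator is identified with its graph, so that \<open>T \<subseteq> S\<close> says that \<open>S\<close> extends \<open>T\<close>,
  \<open>Domain T\<close> is the domain, \<open>closure T\<close> is the closure and \<open>T\<inverse>\<close> the inverse of \<open>T\<close>.\<close>

type_synonym opr = "(spinor \<times> spinor) set"

definition linear_opr :: "opr \<Rightarrow> bool" where
  "linear_opr T \<longleftrightarrow> single_valued T \<and> (0, 0) \<in> T \<and>
     (\<forall>f g f' g'. (f, g) \<in> T \<longrightarrow> (f', g') \<in> T \<longrightarrow> (f + f', g + g') \<in> T) \<and>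
     (\<forall>c f g. (f, g) \<in> T \<longrightarrow> (cscale c f, cscale c g) \<in> T)"

definition opr_add :: "opr \<Rightarrow> opr \<Rightarrow> opr" where
  "opr_add S T = {(f, g + h) | f g h. (f, g) \<in> S \<and> (f, h) \<in> T}"

definition opr_diff :: "opr \<Rightarrow> opr \<Rightarrow> opr" where
  "opr_diff S T = {(f, g - h) | f g h. (f, g) \<in> S \<and> (f, h) \<in> T}"

text \<open>The product \<open>S T\<close> applies \<open>T\<close> first, whereas \<open>O\<close> composes from left to right.\<close>

definition opr_mult :: "opr \<Rightarrow> opr \<Rightarrow> opr" where
  "opr_mult S T = T O S"

definition opr_scalar :: "complex \<Rightarrow> opr" where
  "opr_scalar z = {(f, cscale z f) | f. True}"

definition resolvent :: "opr \<Rightarrow> complex \<Rightarrow> opr" where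
  "resolvent T z = (opr_diff T (opr_scalar z))\<inverse>"

definition resolvent_set :: "opr \<Rightarrow> complex set" where
  "resolvent_set T = {z. \<exists>R. bounded_linear R \<and> resolvent T z = {(g, R g) | g. True}}"

definition op_spectrum :: "opr \<Rightarrow> complex set" where
  "op_spectrum T = - resolvent_set T"

text \<open>The domain is maximal, since \<open>g\<close> ranges over \<open>L\<^sup>2\<close>.\<close>

definition mult_opr :: "(real \<Rightarrow> complex^2^2) \<Rightarrow> opr" where
  "mult_opr M = {(f, g). AE x in lebesgue. rep_spinor g x = M x *v rep_spinor f x}"


section \<open>The free Dirac operator\<close>

text \<open>Weak derivative, with test functions in \<open>C\<^sub>c\<^sup>1\<close>. The Sobolev space \<open>H\<^sup>1\<close> consists of the
  spinors that have a weak derivative in \<open>L\<^sup>2\<close>.\<close>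

definition has_weak_deriv :: "spinor \<Rightarrow> spinor \<Rightarrow> bool" where
  "has_weak_deriv f g \<longleftrightarrow>
     (\<forall>\<phi> \<phi>' :: real \<Rightarrow> real.
        (\<forall>x. (\<phi> has_real_derivative \<phi>' x) (at x)) \<longrightarrow> continuous_on UNIV \<phi>' \<longrightarrow>
        (\<exists>R. \<forall>x. \<bar>x\<bar> > R \<longrightarrow> \<phi> x = 0) \<longrightarrow>
        (LINT x|lebesgue. \<phi>' x *\<^sub>R rep_spinor f x) = - (LINT x|lebesgue. \<phi> x *\<^sub>R rep_spinor g x))"

definition sigma1 :: "complex^2^2" where
  "sigma1 = vector [vector [0, 1], vector [1, 0]]"

definition sigma3 :: "complex^2^2" where
  "sigma3 = vector [vector [1, 0], vector [0, - 1]]"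

definition free_dirac :: "real \<Rightarrow> opr" where
  "free_dirac m = {(f, h). \<exists>f'. has_weak_deriv f f' \<and>
     (AE x in lebesgue. rep_spinor h x
        = - \<i> *s (sigma1 *v rep_spinor f' x) + complex_of_real m *s (sigma3 *v rep_spinor f x))}"


section \<open>Polar decomposition of matrices\<close>

definition adjoint_mat :: "complex^2^2 \<Rightarrow> complex^2^2" where
  "adjoint_mat M = (\<chi> i j. cnj (M $ j $ i))"

definition psd :: "complex^2^2 \<Rightarrow> bool" where
  "psd M \<longleftrightarrow> adjoint_mat M = M \<and> (\<forall>v. 0 \<le> Re (\<Sum>i\<in>UNIV. cnj (v $ i) * (M *v v) $ i))"

definition mat_sqrt :: "complex^2^2 \<Rightarrow> complex^2^2" where
  "mat_sqrt P = (THE S. psd S \<and> S ** S = P)"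

definition mat_abs :: "complex^2^2 \<Rightarrow> complex^2^2" where
  "mat_abs M = mat_sqrt (adjoint_mat M ** M)"

text \<open>The partial isometry \<open>U\<close> of the polar decomposition \<open>M = U |M|\<close>: it is determined on the
  range of \<open>|M|\<close> and vanishes on the orthogonal complement, which is the kernel of \<open>M\<close>.\<close>

definition polar_part :: "complex^2^2 \<Rightarrow> complex^2^2" where
  "polar_part M = (THE U. U ** adjoint_mat U ** U = U \<and> M = U ** mat_abs M \<and>
                          (\<forall>v. U *v v = 0 \<longleftrightarrow> M *v v = 0))"


section \<open>The perturbed Dirac operator\<close>

definition factor_A :: "(real \<Rightarrow> complex^2^2) \<Rightarrow> opr" where
  "factor_A V = mult_opr (\<lambda>x. mat_sqrt (mat_abs (V x)))"

definition factor_B :: "(real \<Rightarrow> complex^2^2) \<Rightarrow> opr" where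
  "factor_B V = mult_opr (\<lambda>x. polar_part (V x) ** mat_sqrt (mat_abs (V x)))"

definition bs_opr :: "real \<Rightarrow> (real \<Rightarrow> complex^2^2) \<Rightarrow> complex \<Rightarrow> opr" where
  "bs_opr m V z
     = closure (opr_mult (factor_A V) (opr_mult (resolvent (free_dirac m) z) (factor_B V)))"

definition bs_set :: "real \<Rightarrow> (real \<Rightarrow> complex^2^2) \<Rightarrow> complex set" where
  "bs_set m V = {z \<in> resolvent_set (free_dirac m). - 1 \<in> resolvent_set (bs_opr m V z)}"

text \<open>\<open>H\<close> is the Dirac operator with potential \<open>V\<close>. It is unique, being determined by its
  resolvent at any point of \<open>bs_set m V\<close>.\<close>

definition is_dirac_opr :: "real \<Rightarrow> (real \<Rightarrow> complex^2^2) \<Rightarrow> opr \<Rightarrow> bool" where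
  "is_dirac_opr m V H \<longleftrightarrow>
     linear_opr H \<and> closed H \<and> closure (Domain H) = UNIV \<and>
     opr_add (free_dirac m) (mult_opr V) \<subseteq> H \<and>
     resolvent_set H \<inter> resolvent_set (free_dirac m) = bs_set m V \<and>
     bs_set m V \<noteq> {} \<and>
     (\<forall>z \<in> bs_set m V.
        resolvent H z =
          opr_diff (resolvent (free_dirac m) z)
            (opr_mult (closure (opr_mult (resolvent (free_dirac m) z) (factor_B V)))
              (opr_mult ((opr_add (opr_scalar 1) (bs_opr m V z))\<inverse>)
                (opr_mult (factor_A V) (resolvent (free_dirac m) z)))))"


section \<open>The quantities in the spectral estimate\<close>

definition L_infinity_0 :: "(real \<Rightarrow> complex) set" where
  "L_infinity_0 = {f \<in> borel_measurable lebesgue.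
     (\<exists>C. AE x in lebesgue. norm (f x) \<le> C) \<and>
     (\<forall>e>0. \<exists>R. AE x in lebesgue. \<bar>x\<bar> > R \<longrightarrow> norm (f x) \<le> e)}"

definition mat_norm :: "complex^2^2 \<Rightarrow> real" where
  "mat_norm M = onorm (\<lambda>v. M *v v)"

definition C_eps :: "(real \<Rightarrow> complex^2^2) \<Rightarrow> real \<Rightarrow> real" where
  "C_eps V \<epsilon> = Inf {LINT x|lebesgue. mat_norm (W x) | W X.
     (AE x in lebesgue. V x = W x + X x) \<and>
     (\<forall>i j. integrable lebesgue (\<lambda>x. W x $ i $ j)) \<and>
     esssup lebesgue (\<lambda>x. ereal (mat_norm (X x))) \<le> ereal \<epsilon>}"

definition Phi :: "real \<Rightarrow> complex \<Rightarrow> complex" where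
  "Phi m z = (z + of_real m) / (z - of_real m)"

definition eta :: "real \<Rightarrow> real" where
  "eta s = sqrt (1 / 2 + 1 / 4 * (s + inverse s))"

lemma eta_Phi:
  assumes "z\<^sup>2 \<noteq> (complex_of_real m)\<^sup>2"
  shows "eta (norm (Phi m z))
       = 1 / sqrt 2 * sqrt (1 + ((norm z)\<^sup>2 + m\<^sup>2) / norm (z\<^sup>2 - (of_real m)\<^sup>2))"
proof -
  let ?a = "norm (z + of_real m)" and ?b = "norm (z - of_real m)"
  have fac: "z\<^sup>2 - (of_real m)\<^sup>2 = (z + of_real m) * (z - of_real m)"
    by (simp add: power2_eq_square algebra_simps)
  have nz: "?a \<noteq> 0" "?b \<noteq> 0" using assms fac by auto
  have par: "?a\<^sup>2 + ?b\<^sup>2 = 2 * ((norm z)\<^sup>2 + m\<^sup>2)"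
    unfolding cmod_power2 by (simp add: power2_eq_square algebra_simps)
  have "1 / 2 + 1 / 4 * (?a / ?b + ?b / ?a) = 1 / 2 + 1 / 4 * ((?a\<^sup>2 + ?b\<^sup>2) / (?a * ?b))"
    using nz by (simp add: field_simps power2_eq_square)
  also have "\<dots> = 1 / 2 * (1 + ((norm z)\<^sup>2 + m\<^sup>2) / (?a * ?b))"
    unfolding par using nz by (simp add: divide_simps)
  finally have "sqrt (1 / 2 + 1 / 4 * (?a / ?b + ?b / ?a))
      = sqrt (1 / 2) * sqrt (1 + ((norm z)\<^sup>2 + m\<^sup>2) / (?a * ?b))"
    by (simp only: real_sqrt_mult)
  then show ?thesis
    unfolding eta_def Phi_def norm_divide fac norm_mult by (simp add: real_sqrt_divide)
qed

definition momentum :: "real \<Rightarrow> complex \<Rightarrow> complex" where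
  "momentum m z = (THE k. k\<^sup>2 = z\<^sup>2 - (of_real m)\<^sup>2 \<and> Im k > 0)"

end

theory Submission
  imports Defs
begin

text \<open>
  Write \<open>G = R\<^sub>0(z)\<close>, \<open>k = sqrt (z\<^sup>2 - m\<^sup>2)\<close>, \<open>V = W + X\<close> with \<open>\<parallel>X\<parallel> \<le> \<epsilon>\<close> and \<open>c\<close> the integral of \<open>\<parallel>W\<parallel>\<close>.
  The kernel of \<open>G\<close> is bounded by \<open>\<eta> exp (- Im k \<bar>x - y\<bar>)\<close>, so that \<open>G\<close> has norm at most \<open>\<eta>\<close> from
  \<open>L\<^sup>1\<close> to \<open>L\<^sup>\<infinity>\<close>, at most \<open>\<eta> / sqrt (Im k)\<close> from \<open>L\<^sup>2\<close> to \<open>L\<^sup>\<infinity>\<close> and from \<open>L\<^sup>1\<close> to \<open>L\<^sup>2\<close>, and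
  norm \<open>1 / d\<close> on \<open>L\<^sup>2\<close>, where \<open>d\<close> is the distance of \<open>z\<close> to the spectrum of \<open>H\<^sub>0\<close>. Hence \<open>G V\<close> maps a
  function with bounds \<open>(\<alpha>, \<beta>)\<close> in \<open>L\<^sup>\<infinity>\<close> and \<open>L\<^sup>2\<close> to one with bounds \<open>M (\<alpha>, \<beta>)\<close>, where \<open>M\<close> has rows
  \<open>(\<eta> c, \<eta> \<epsilon> / sqrt (Im k))\<close> and \<open>(\<eta> c / sqrt (Im k), \<epsilon> / d)\<close>. The two hypotheses say precisely that
  \<open>M\<close> has spectral radius below 1, so \<open>G V\<close> is a contraction for a weighted norm on \<open>L\<^sup>2 \<inter> L\<^sup>\<infinity>\<close>. Since
  \<open>Q(z)\<^sup>n\<^sup>+\<^sup>1 = A (G V)\<^sup>n G B\<close>, the Neumann series of \<open>1 + Q(z)\<close> converges.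

  The bound \<open>1 / d\<close> needs no Fourier transform: \<open>H\<^sub>0\<close> is symmetric because the adjoint of the kernel
  at \<open>z\<close> is the kernel at \<open>cnj z\<close>, and testing the symmetry with \<open>\<sigma>\<^sub>3 h\<close> gives \<open>m \<parallel>h\<parallel> \<le> \<parallel>H\<^sub>0 h\<parallel>\<close>.
\<close>

section \<open>Square roots and polar decomposition of 2x2 matrices\<close>

text \<open>In general \<open>V\<close> is neither bounded nor integrable, so \<open>A\<close> and
  \<open>B\<close> are unbounded, and \<open>Q(z)\<close> need not have norm below 1 on L^2.
  Regrouping the factors by \<open>B A = V\<close> moves the iteration to \<open>G V\<close>. For
  this operator the intersection of L^2 with the bounded functions is the natural space:
  \<open>W\<close> times a bounded function is integrable, \<open>X\<close> times a
  square-integrable one is square-integrable, and \<open>G\<close> maps both back. Only the bounds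
  that form \<open>M\<close> have to be sharp. The estimates for \<open>A\<close> and
  \<open>B\<close>, which occur once at each end of the product, merely affect the prefactor of a
  geometric series and are crude. Square root and polar part are defined by \<open>THE\<close>;
  explicit 2x2 formulas yield existence, uniqueness and, above all, measurability in x.
  \<open>H\<close> is never constructed: \<open>is_dirac_opr\<close> reduces the claim to
  \<open>- 1\<close> lying in the resolvent set of \<open>Q(z)\<close>. The infimum
  \<open>C_eps\<close> may not be attained, but both hypotheses are strict and continuous in it, so
  they survive for some actual decomposition.\<close>

lemma mat2_eq_iff: "M = N \<longleftrightarrow> M$1$1 = N$1$1 \<and> M$1$2 = N$1$2 \<and> M$2$1 = N$2$1 \<and> M$2$2 = N$2$2"
  for M N :: "'a^2^2"
  by (auto simp: vec_eq_iff forall_2)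

lemma vec2_eq_iff: "v = w \<longleftrightarrow> v$1 = w$1 \<and> v$2 = w$2" for v w :: "'a^2"
  by (auto simp: vec_eq_iff forall_2)

lemma mat2_mult_nth: "(M ** N)$i$j = M$i$1 * N$1$j + M$i$2 * N$2$j"
  for M N :: "'a::semiring_1^2^2"
  by (simp add: matrix_matrix_mult_def sum_2)

lemma mat2_vec_nth: "(M *v v)$i = M$i$1 * v$1 + M$i$2 * v$2"
  for M :: "'a::semiring_1^2^2"
  by (simp add: matrix_vector_mult_def sum_2)

lemma norm_vec2: "norm v = sqrt ((norm (v$1))\<^sup>2 + (norm (v$2))\<^sup>2)" for v :: "'a::real_normed_vector^2"
  by (simp add: norm_vec_def L2_set_def sum_2)

lemma norm_mat2: "norm M = sqrt ((norm (M$1$1))\<^sup>2 + (norm (M$1$2))\<^sup>2 + (norm (M$2$1))\<^sup>2 + (norm (M$2$2))\<^sup>2)"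
  for M :: "'a::real_normed_vector^2^2"
  by (simp add: norm_vec2)

text \<open>Cauchy-Schwarz in each row. The norm of the matrix type is the Frobenius norm, which
  thereby dominates the operator norm.\<close>

lemma norm_matrix_vector_mult: "norm (M *v v) \<le> norm M * norm v"
  for M :: "'a::real_normed_field^'n^'m"
proof -
  have "norm ((M *v v)$i) \<le> norm (M$i) * norm v" for i
  proof -
    have "norm ((M *v v)$i) \<le> (\<Sum>j\<in>UNIV. norm (M$i$j) * norm (v$j))"
      unfolding matrix_vector_mult_def by (auto intro!: order_trans[OF norm_sum] simp: norm_mult)
    also have "\<dots> \<le> norm (M$i) * norm v"
      using L2_set_mult_ineq[of "\<lambda>j. norm (M$i$j)" "\<lambda>j. norm (v$j)" UNIV] by (simp add: norm_vec_def)
    finally show ?thesis .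
  qed
  then have "norm (M *v v) \<le> L2_set (\<lambda>i. norm (M$i) * norm v) UNIV"
    unfolding norm_vec_def[of "M *v v"] by (intro L2_set_mono) auto
  also have "\<dots> = norm M * norm v"
    by (simp add: norm_vec_def[of M] L2_set_left_distrib)
  finally show ?thesis .
qed

text \<open>Coordinates for Hermitian matrices in which positivity becomes nonnegativity of the
  diagonal and of the determinant, see \<open>psd_herm2\<close> and \<open>psdE\<close>.\<close>

definition herm2 :: "real \<Rightarrow> complex \<Rightarrow> real \<Rightarrow> complex^2^2" where
  "herm2 a b c = vector [vector [of_real a, b], vector [cnj b, of_real c]]"

lemma herm2_nth [simp]: "herm2 a b c $1$1 = of_real a" "herm2 a b c $1$2 = b"
  "herm2 a b c $2$1 = cnj b" "herm2 a b c $2$2 = of_real c"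
  by (simp_all add: herm2_def)

lemma herm2_form: "Re (\<Sum>i\<in>UNIV. cnj (v $ i) * (herm2 a b c *v v) $ i)
    = a * (norm (v$1))\<^sup>2 + 2 * Re (cnj (v$1) * b * v$2) + c * (norm (v$2))\<^sup>2"
  by (simp only: sum_2 mat2_vec_nth herm2_nth cmod_power2) (simp add: algebra_simps power2_eq_square)

text \<open>Since |b| is at most \<open>sqrt a * sqrt c\<close>, the inequality of arithmetic and
  geometric means lets the diagonal terms absorb the mixed term.\<close>

lemma psd_herm2:
  assumes "a \<ge> 0" "c \<ge> 0" "(norm b)\<^sup>2 \<le> a * c"
  shows "psd (herm2 a b c)"
  unfolding psd_def
proof (intro conjI allI)
  show "adjoint_mat (herm2 a b c) = herm2 a b c"
    by (simp add: mat2_eq_iff adjoint_mat_def)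
  fix v :: "complex^2"
  let ?x = "norm (v$1)" and ?y = "norm (v$2)"
  have b: "norm b \<le> sqrt a * sqrt c"
    using assms by (metis norm_ge_zero real_le_rsqrt real_sqrt_mult)
  have "- Re (cnj (v$1) * b * v$2) \<le> ?x * norm b * ?y"
    using abs_Re_le_cmod[of "cnj (v$1) * b * v$2"] by (simp add: norm_mult)
  also have "\<dots> \<le> ?x * (sqrt a * sqrt c) * ?y"
    using b by (intro mult_right_mono mult_left_mono) auto
  finally have "- Re (cnj (v$1) * b * v$2) \<le> (sqrt a * ?x) * (sqrt c * ?y)"
    by (simp only: mult_ac)
  then have "2 * (- Re (cnj (v$1) * b * v$2)) \<le> 2 * ((sqrt a * ?x) * (sqrt c * ?y))"
    by linarith
  also have "\<dots> \<le> (sqrt a * ?x)\<^sup>2 + (sqrt c * ?y)\<^sup>2"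
    using sum_squares_bound[of "sqrt a * ?x" "sqrt c * ?y"] by simp
  finally show "0 \<le> Re (\<Sum>i\<in>UNIV. cnj (v $ i) * (herm2 a b c *v v) $ i)"
    unfolding herm2_form using assms by (simp add: power_mult_distrib)
qed

lemma psdE:
  assumes "psd M"
  obtains a b c where "M = herm2 a b c" "a \<ge> 0" "c \<ge> 0" "(norm b)\<^sup>2 \<le> a * c"
proof -
  define a b c where "a = Re (M$1$1)" and "b = M$1$2" and "c = Re (M$2$2)"
  have "adjoint_mat M = M" using assms by (simp add: psd_def)
  then have adj: "cnj (M$1$1) = M$1$1" "cnj (M$1$2) = M$2$1" "cnj (M$2$2) = M$2$2"
    by (simp_all add: mat2_eq_iff adjoint_mat_def)
  then have M: "M = herm2 a b c"
    by (auto simp: mat2_eq_iff a_def b_def c_def complex_eq_iff)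
  have form: "0 \<le> a * (norm x)\<^sup>2 + 2 * Re (cnj x * b * y) + c * (norm y)\<^sup>2" for x y
  proof -
    have "0 \<le> Re (\<Sum>i\<in>UNIV. cnj (vector [x, y] $ i) * (herm2 a b c *v vector [x, y]) $ i)"
      using assms M by (simp only: psd_def)
    then show ?thesis unfolding herm2_form by simp
  qed
  have a: "a \<ge> 0" and c: "c \<ge> 0" using form[of 1 0] form[of 0 1] by auto
  \<comment> \<open>The test vectors (b, -a) and (c, -cnj b) yield the determinant multiplied by a
    diagonal entry. If both diagonal entries vanish, this says nothing, and (b, -1) is tested
    instead.\<close>
  have "0 \<le> a * (a * c - (norm b)\<^sup>2)"
    using form[of b "- of_real a"] unfolding cmod_power2
    by (simp add: algebra_simps power2_eq_square)
  moreover have "0 \<le> c * (a * c - (norm b)\<^sup>2)"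
    using form[of "of_real c" "- cnj b"] unfolding cmod_power2
    by (simp add: algebra_simps power2_eq_square)
  moreover have "(norm b)\<^sup>2 = 0" if "a = 0" "c = 0"
  proof -
    have "Re (cnj b * b * (-1)) = - (norm b)\<^sup>2"
      by (simp add: cmod_power2) (simp add: power2_eq_square)
    then have "(norm b)\<^sup>2 \<le> 0"
      using form[of b "-1"] unfolding that by simp
    then show ?thesis by simp
  qed
  ultimately have "(norm b)\<^sup>2 \<le> a * c"
    using a c by (cases "a = 0"; cases "c = 0") (auto simp: zero_le_mult_iff mult_le_0_iff)
  with M a c that show ?thesis by blast
qed

lemma herm2_square: "herm2 a b c ** herm2 a b c
    = herm2 (a\<^sup>2 + (norm b)\<^sup>2) (b * of_real (a + c)) (c\<^sup>2 + (norm b)\<^sup>2)"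
proof -
  have "of_real ((norm b)\<^sup>2) = b * cnj b" by (rule complex_norm_square)
  then show ?thesis
    unfolding mat2_eq_iff mat2_mult_nth herm2_nth of_real_add
    by (simp add: power2_eq_square algebra_simps)
qed

text \<open>By Cayley-Hamilton, a positive square root \<open>S\<close> of \<open>P\<close> satisfies \<open>tr S \<cdot> S = P + det S\<close>, where
  \<open>det S = sqrt (det P)\<close> and \<open>(tr S)\<^sup>2 = tr P + 2 det S\<close>. For \<open>tr S = 0\<close> the division below gives
  the correct value \<open>0\<close>.\<close>

definition herm2_root :: "real \<Rightarrow> complex \<Rightarrow> real \<Rightarrow> complex^2^2" where
  "herm2_root p q r = (let d = sqrt (p * r - (norm q)\<^sup>2); t = sqrt (p + r + 2 * d)
     in herm2 ((p + d) / t) (q / of_real t) ((r + d) / t))"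

text \<open>Uniqueness half: the determinant of the square is the square of
  \<open>a * c - \<beta>\<close>, whose sign is known by positivity, and trace plus twice that root
  is the square of a + c. So both invariants of the root are recovered from its square.\<close>

lemma herm2_root_square:
  assumes "a \<ge> 0" "c \<ge> 0" "(norm b)\<^sup>2 \<le> a * c"
  shows "herm2_root (a\<^sup>2 + (norm b)\<^sup>2) (b * of_real (a + c)) (c\<^sup>2 + (norm b)\<^sup>2) = herm2 a b c"
proof -
  define \<beta> where "\<beta> = (norm b)\<^sup>2"
  have "(a\<^sup>2 + \<beta>) * (c\<^sup>2 + \<beta>) - (norm (b * of_real (a + c)))\<^sup>2 = (a * c - \<beta>)\<^sup>2"
    by (simp add: norm_mult power_mult_distrib \<beta>_def[symmetric] del: of_real_add)
       (simp add: power2_eq_square algebra_simps)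
  then have d: "sqrt ((a\<^sup>2 + \<beta>) * (c\<^sup>2 + \<beta>) - (norm (b * of_real (a + c)))\<^sup>2) = a * c - \<beta>"
    using assms by (simp add: \<beta>_def)
  have "(a\<^sup>2 + \<beta>) + (c\<^sup>2 + \<beta>) + 2 * (a * c - \<beta>) = (a + c)\<^sup>2"
    by (simp add: power2_eq_square algebra_simps)
  then have t: "sqrt ((a\<^sup>2 + \<beta>) + (c\<^sup>2 + \<beta>) + 2 * (a * c - \<beta>)) = a + c"
    using assms by simp
  have "b = 0" if "a + c = 0"
  proof -
    have "a = 0" using that assms by simp
    then show ?thesis using assms by simp
  qed
  moreover have "a\<^sup>2 + \<beta> + (a * c - \<beta>) = a * (a + c)" "c\<^sup>2 + \<beta> + (a * c - \<beta>) = c * (a + c)"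
    by (simp_all add: power2_eq_square algebra_simps)
  moreover have "a + c = 0 \<Longrightarrow> a = 0 \<and> c = 0" using assms by simp
  ultimately show ?thesis
    unfolding herm2_root_def \<beta>_def[symmetric] Let_def d t
    by (cases "a + c = 0") (auto simp: mat2_eq_iff simp del: of_real_add)
qed

text \<open>Existence half: the Cayley-Hamilton formula is squared entry by entry. For t = 0
  positivity forces p, q and r to vanish, in agreement with division by zero.\<close>

lemma herm2_root_psd:
  assumes "p \<ge> 0" "r \<ge> 0" "(norm q)\<^sup>2 \<le> p * r"
  shows "psd (herm2_root p q r)" "herm2_root p q r ** herm2_root p q r = herm2 p q r"
proof -
  define d t where "d = sqrt (p * r - (norm q)\<^sup>2)" and "t = sqrt (p + r + 2 * d)"
  have d: "d \<ge> 0" "d\<^sup>2 = p * r - (norm q)\<^sup>2" using assms by (simp_all add: d_def)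
  have t: "t \<ge> 0" "t\<^sup>2 = p + r + 2 * d" using assms d by (simp_all add: t_def)
  have eq: "herm2_root p q r = herm2 ((p + d) / t) (q / of_real t) ((r + d) / t)"
    by (simp add: herm2_root_def d_def t_def Let_def)
  have "(norm q)\<^sup>2 \<le> (p + d) * (r + d)"
    using assms d by (intro order_trans[OF assms(3)] mult_mono) auto
  then have "(norm q)\<^sup>2 / t\<^sup>2 \<le> (p + d) * (r + d) / t\<^sup>2"
    by (intro divide_right_mono) auto
  then have "(norm (q / of_real t))\<^sup>2 \<le> (p + d) / t * ((r + d) / t)"
    using t by (simp add: norm_divide power_divide power2_eq_square)
  then show "psd (herm2_root p q r)"
    unfolding eq using assms d t by (intro psd_herm2) auto
  show "herm2_root p q r ** herm2_root p q r = herm2 p q r"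
  proof (cases "t = 0")
    case True
    then have "p = 0" "r = 0" "d = 0" using t d assms by auto
    then have "q = 0" using assms by simp
    with \<open>p = 0\<close> \<open>r = 0\<close> True show ?thesis
      unfolding eq by (simp add: mat2_eq_iff mat2_mult_nth)
  next
    case False
    have q: "(norm q)\<^sup>2 = p * r - d\<^sup>2" using d by simp
    have 1: "((p + d) / t)\<^sup>2 + (norm (q / of_real t))\<^sup>2 = p"
    proof -
      have "((p + d) / t)\<^sup>2 + (norm (q / of_real t))\<^sup>2 = ((p + d)\<^sup>2 + (norm q)\<^sup>2) / t\<^sup>2"
        by (simp add: norm_divide power_divide flip: add_divide_distrib)
      also have "(p + d)\<^sup>2 + (norm q)\<^sup>2 = p * t\<^sup>2"
        unfolding q t(2) by (simp add: power2_eq_square algebra_simps)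
      finally show ?thesis using False by simp
    qed
    have 2: "((r + d) / t)\<^sup>2 + (norm (q / of_real t))\<^sup>2 = r"
    proof -
      have "((r + d) / t)\<^sup>2 + (norm (q / of_real t))\<^sup>2 = ((r + d)\<^sup>2 + (norm q)\<^sup>2) / t\<^sup>2"
        by (simp add: norm_divide power_divide flip: add_divide_distrib)
      also have "(r + d)\<^sup>2 + (norm q)\<^sup>2 = r * t\<^sup>2"
        unfolding q t(2) by (simp add: power2_eq_square algebra_simps)
      finally show ?thesis using False by simp
    qed
    have 3: "q / of_real t * of_real ((p + d) / t + (r + d) / t) = q"
    proof -
      have "(p + d) / t + (r + d) / t = t\<^sup>2 / t"
        unfolding t(2) by (simp add: add_divide_distrib)
      then show ?thesis using False by (simp add: power2_eq_square)
    qed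
    show ?thesis unfolding eq herm2_square 1 2 3 ..
  qed
qed

text \<open>Two positive roots of one matrix are the same value of \<open>herm2_root\<close>; this
  makes the \<open>THE\<close> in \<open>mat_sqrt\<close> well defined.\<close>

lemma mat_sqrt_eq: "psd S \<Longrightarrow> mat_sqrt (S ** S) = S"
proof -
  have inj: "T = U" if TU: "psd T" "psd U" "T ** T = U ** U" for T U
  proof -
    obtain a b c where T: "T = herm2 a b c" "a \<ge> 0" "c \<ge> 0" "(norm b)\<^sup>2 \<le> a * c"
      using TU(1) by (rule psdE)
    obtain a' b' c' where U: "U = herm2 a' b' c'" "a' \<ge> 0" "c' \<ge> 0" "(norm b')\<^sup>2 \<le> a' * c'"
      using TU(2) by (rule psdE)
    have "a\<^sup>2 + (norm b)\<^sup>2 = a'\<^sup>2 + (norm b')\<^sup>2" "b * of_real (a + c) = b' * of_real (a' + c')"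
      "c\<^sup>2 + (norm b)\<^sup>2 = c'\<^sup>2 + (norm b')\<^sup>2"
      using TU(3) unfolding T(1) U(1) herm2_square mat2_eq_iff herm2_nth of_real_eq_iff by auto
    then show ?thesis
      using herm2_root_square[OF T(2-)] herm2_root_square[OF U(2-)] T(1) U(1) by simp
  qed
  assume "psd S"
  then show ?thesis unfolding mat_sqrt_def by (intro the_equality) (auto intro: inj)
qed

lemma mat_sqrt_herm2:
  assumes "p \<ge> 0" "r \<ge> 0" "(norm q)\<^sup>2 \<le> p * r"
  shows "mat_sqrt (herm2 p q r) = herm2_root p q r"
  using mat_sqrt_eq[OF herm2_root_psd(1)[OF assms]] herm2_root_psd(2)[OF assms] by simp

lemma mat_sqrt_psd:
  assumes "psd P" shows "psd (mat_sqrt P)" "mat_sqrt P ** mat_sqrt P = P"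
proof -
  obtain p q r where P: "P = herm2 p q r" "p \<ge> 0" "r \<ge> 0" "(norm q)\<^sup>2 \<le> p * r"
    using assms by (rule psdE)
  show "psd (mat_sqrt P)" "mat_sqrt P ** mat_sqrt P = P"
    using herm2_root_psd[OF P(2-)] mat_sqrt_herm2[OF P(2-)] P(1) by simp_all
qed

lemma psd_adjoint_mult: "psd (adjoint_mat M ** M)"
  unfolding psd_def
proof (intro conjI allI)
  show "adjoint_mat (adjoint_mat M ** M) = adjoint_mat M ** M"
    by (simp add: mat2_eq_iff mat2_mult_nth adjoint_mat_def mult.commute)
  fix v :: "complex^2"
  have "(\<Sum>i\<in>UNIV. cnj (v $ i) * (adjoint_mat M ** M *v v) $ i)
      = cnj ((M *v v)$1) * (M *v v)$1 + cnj ((M *v v)$2) * (M *v v)$2"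
    by (simp add: sum_2 mat2_vec_nth mat2_mult_nth adjoint_mat_def algebra_simps)
  also have "Re \<dots> = (norm ((M *v v)$1))\<^sup>2 + (norm ((M *v v)$2))\<^sup>2"
    by (simp add: cmod_power2) (simp add: power2_eq_square)
  finally show "0 \<le> Re (\<Sum>i\<in>UNIV. cnj (v $ i) * (adjoint_mat M ** M *v v) $ i)"
    by simp
qed

lemma psd_mat_abs: "psd (mat_abs M)"
  and mat_abs_square: "mat_abs M ** mat_abs M = adjoint_mat M ** M"
  unfolding mat_abs_def by (rule mat_sqrt_psd psd_adjoint_mult)+

lemma adjoint_mult_eq_herm2: "adjoint_mat M ** M
    = herm2 ((norm (M$1$1))\<^sup>2 + (norm (M$2$1))\<^sup>2) (cnj (M$1$1) * M$1$2 + cnj (M$2$1) * M$2$2)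
        ((norm (M$1$2))\<^sup>2 + (norm (M$2$2))\<^sup>2)"
  unfolding mat2_eq_iff mat2_mult_nth herm2_nth of_real_add complex_norm_square
  by (simp add: adjoint_mat_def mult.commute)

text \<open>Lagrange's identity, i.e. multiplicativity of the determinant in \<open>herm2\<close>
  coordinates. It turns the square root inside \<open>herm2_root\<close> into
  \<open>norm (det M)\<close>.\<close>

lemma adjoint_mult_det:
  "((norm (M$1$1))\<^sup>2 + (norm (M$2$1))\<^sup>2) * ((norm (M$1$2))\<^sup>2 + (norm (M$2$2))\<^sup>2)
      - (norm (cnj (M$1$1) * M$1$2 + cnj (M$2$1) * M$2$2))\<^sup>2 = (norm (det M))\<^sup>2"
  for M :: "complex^2^2"
  unfolding det_2 of_real_eq_iff[where 'a = complex, symmetric] of_real_add of_real_mult of_real_diff complex_norm_square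
  by (simp add: algebra_simps)

lemma mat_abs_eq: "mat_abs M = herm2_root
    ((norm (M$1$1))\<^sup>2 + (norm (M$2$1))\<^sup>2) (cnj (M$1$1) * M$1$2 + cnj (M$2$1) * M$2$2)
    ((norm (M$1$2))\<^sup>2 + (norm (M$2$2))\<^sup>2)"
proof -
  have "(norm (cnj (M$1$1) * M$1$2 + cnj (M$2$1) * M$2$2))\<^sup>2
      \<le> ((norm (M$1$1))\<^sup>2 + (norm (M$2$1))\<^sup>2) * ((norm (M$1$2))\<^sup>2 + (norm (M$2$2))\<^sup>2)"
    using adjoint_mult_det[of M] by (metis diff_ge_0_iff_ge zero_le_power2)
  then show ?thesis
    unfolding mat_abs_def adjoint_mult_eq_herm2 by (intro mat_sqrt_herm2) auto
qed

section \<open>An explicit polar decomposition\<close>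

definition coadj :: "complex^2^2 \<Rightarrow> complex^2^2" where
  "coadj M = vector [vector [cnj (M$2$2), - cnj (M$2$1)], vector [- cnj (M$1$2), cnj (M$1$1)]]"

text \<open>This is the trace of \<open>mat_abs M\<close>: its square is the trace of
  \<open>adjoint_mat M ** M\<close>, which is the squared Frobenius norm, plus twice the determinant
  of \<open>mat_abs M\<close>, which is \<open>norm (det M)\<close>.\<close>

definition polar_denom :: "complex^2^2 \<Rightarrow> real" where
  "polar_denom M = sqrt ((norm M)\<^sup>2 + 2 * norm (det M))"

text \<open>If \<open>M = U |M|\<close> with \<open>U\<close> unitary, the adjoint of the adjugate of \<open>M\<close> is
  \<open>coadj M = cnj (det U) U adj |M|\<close>. As \<open>|M| + adj |M| = tr |M|\<close> and \<open>det U = sgn (det M)\<close>, this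
  yields \<open>tr |M| \<cdot> U = M + sgn (det M) coadj M\<close>, which remains true for singular \<open>M\<close>, when
  \<open>sgn (det M) = 0\<close>.\<close>

definition polar2 :: "complex^2^2 \<Rightarrow> complex^2^2" where
  "polar2 M = (\<chi> i j. (M$i$j + sgn (det M) * coadj M$i$j) / of_real (polar_denom M))"

lemma coadj_nth [simp]: "coadj M$1$1 = cnj (M$2$2)" "coadj M$1$2 = - cnj (M$2$1)"
  "coadj M$2$1 = - cnj (M$1$2)" "coadj M$2$2 = cnj (M$1$1)"
  by (simp_all add: coadj_def)

lemma norm_coadj: "norm (coadj M) = norm M"
  by (simp add: norm_mat2 add_ac)

lemma norm_le_polar_denom: "norm M \<le> polar_denom M"
  unfolding polar_denom_def by (rule real_le_rsqrt) simp

lemma polar_denom_nonneg: "0 \<le> polar_denom M"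
  by (simp add: polar_denom_def)

lemma polar_denom_eq_0_iff: "polar_denom M = 0 \<longleftrightarrow> M = 0"
proof
  show "polar_denom M = 0 \<Longrightarrow> M = 0" using norm_le_polar_denom[of M] by simp
  show "M = 0 \<Longrightarrow> polar_denom M = 0" by (simp add: polar_denom_def det_2)
qed

lemma norm_mat2_square_complex: "of_real ((norm M)\<^sup>2) = M$1$1 * cnj (M$1$1) + M$1$2 * cnj (M$1$2)
    + M$2$1 * cnj (M$2$1) + M$2$2 * cnj (M$2$2)" for M :: "complex^2^2"
  unfolding complex_norm_square[symmetric] norm_mat2 by simp

lemma polar_denom_square: "(polar_denom M)\<^sup>2 = (norm M)\<^sup>2 + 2 * norm (det M)"
  by (simp add: polar_denom_def)

lemma sgn_mult_norm: "sgn z * of_real (norm z) = z" for z :: complex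
  by (simp add: sgn_eq)

text \<open>Cayley-Hamilton for \<open>mat_abs M\<close>. Keeping the trace as a factor on the left
  makes it hold for \<open>M = 0\<close> too and leaves polynomial identities to check
  later.\<close>

lemma mat_abs_denom: "of_real (polar_denom M) * mat_abs M$i$j
    = (adjoint_mat M ** M)$i$j + of_real (norm (det M)) * (mat 1)$i$j"
proof -
  let ?p = "(norm (M$1$1))\<^sup>2 + (norm (M$2$1))\<^sup>2" and ?r = "(norm (M$1$2))\<^sup>2 + (norm (M$2$2))\<^sup>2"
    and ?q = "cnj (M$1$1) * M$1$2 + cnj (M$2$1) * M$2$2"
  have t: "sqrt (?p + ?r + 2 * norm (det M)) = polar_denom M"
    unfolding polar_denom_def norm_mat2 by (simp add: add_ac)
  have A: "mat_abs M = herm2 ((?p + norm (det M)) / polar_denom M) (?q / of_real (polar_denom M))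
      ((?r + norm (det M)) / polar_denom M)"
    unfolding mat_abs_eq herm2_root_def adjoint_mult_det Let_def t[symmetric] by simp
  show ?thesis
  proof (cases "M = 0")
    case True
    then show ?thesis by (simp add: polar_denom_def det_2 mat2_mult_nth)
  next
    case False
    then have "polar_denom M \<noteq> 0" by (simp add: polar_denom_eq_0_iff)
    moreover have "i = 1 \<or> i = 2" "j = 1 \<or> j = 2" using exhaust_2 by auto
    ultimately show ?thesis
      unfolding A adjoint_mult_eq_herm2 by (auto simp: mat_def)
  qed
qed

lemma polar2_denom: "of_real (polar_denom M) * polar2 M$i$j = M$i$j + sgn (det M) * coadj M$i$j"
proof (cases "M = 0")
  case True
  then show ?thesis by (simp add: polar_denom_def det_2)
next
  case False
  then show ?thesis by (simp add: polar2_def polar_denom_eq_0_iff)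
qed

lemma polar2_mat_abs: "polar2 M ** mat_abs M = M"
proof (cases "M = 0")
  case True
  then show ?thesis by (simp add: mat2_eq_iff mat2_mult_nth polar2_def polar_denom_def det_2)
next
  case False
  then have t: "of_real (polar_denom M) \<noteq> (0::complex)" by (simp add: polar_denom_eq_0_iff)
  define s d where "s = sgn (det M)" and "d = complex_of_real (norm (det M))"
  have sd: "s * d = M$1$1 * M$2$2 - M$1$2 * M$2$1"
    unfolding s_def d_def sgn_mult_norm by (simp add: det_2)
  have sD: "s * cnj (M$1$1 * M$2$2 - M$1$2 * M$2$1) = d"
  proof -
    have "s * cnj (det M) = d"
    proof (cases "det M = 0")
      case False
      then show ?thesis
        unfolding s_def d_def sgn_eq
        by (simp add: divide_simps flip: complex_norm_square) (simp add: power2_eq_square)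
    qed (simp add: s_def d_def)
    then show ?thesis by (simp add: det_2)
  qed
  have tt: "of_real (polar_denom M) * of_real (polar_denom M) = M$1$1 * cnj (M$1$1)
      + M$1$2 * cnj (M$1$2) + M$2$1 * cnj (M$2$1) + M$2$2 * cnj (M$2$2) + 2 * d"
    unfolding power2_eq_square[symmetric] of_real_power[symmetric] polar_denom_square of_real_add
      norm_mat2_square_complex by (simp add: d_def)
  \<comment> \<open>Both denominators are cleared. The product then differs from the claim only by
    multiples of \<open>s * cnj (det M) - d\<close> and \<open>s * d - det M\<close>, which vanish
    because s is the phase and d the modulus of the determinant.\<close>
  have "of_real (polar_denom M) * of_real (polar_denom M) * (polar2 M ** mat_abs M)$i$j
      = of_real (polar_denom M) * of_real (polar_denom M) * M$i$j" for i j
  proof -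
    have "of_real (polar_denom M) * of_real (polar_denom M) * (polar2 M ** mat_abs M)$i$j
        = (of_real (polar_denom M) * polar2 M$i$1) * (of_real (polar_denom M) * mat_abs M$1$j)
        + (of_real (polar_denom M) * polar2 M$i$2) * (of_real (polar_denom M) * mat_abs M$2$j)"
      by (simp add: mat2_mult_nth algebra_simps)
    also have "\<dots> = of_real (polar_denom M) * of_real (polar_denom M) * M$i$j
        + (s * cnj (M$1$1 * M$2$2 - M$1$2 * M$2$1) - d) * M$i$j
        + (s * d - (M$1$1 * M$2$2 - M$1$2 * M$2$1)) * coadj M$i$j"
      unfolding polar2_denom mat_abs_denom tt s_def[symmetric] d_def[symmetric]
      using exhaust_2[of i] exhaust_2[of j]
      by (elim disjE; simp add: mat2_mult_nth adjoint_mat_def mat_def; simp add: algebra_simps)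
    also have "\<dots> = of_real (polar_denom M) * of_real (polar_denom M) * M$i$j"
      by (simp add: sd sD del: complex_cnj_diff complex_cnj_mult)
    finally show ?thesis .
  qed
  with t show ?thesis by (simp add: vec_eq_iff)
qed

text \<open>The conditions in \<open>polar_part\<close> prescribe U on the range of
  \<open>mat_abs M\<close> and on the kernel of M. As these span the space, U is unique.\<close>

lemma polar_split_vector: "\<exists>w1 w2. v = mat_abs M *v w1 + w2 \<and> M *v w2 = 0"
proof (cases "M = 0 \<or> det M \<noteq> 0")
  case True
  show ?thesis
  proof (cases "M = 0")
    case True
    then show ?thesis by (intro exI[of _ 0] exI[of _ v]) simp
  next
    case False
    obtain a b c where A: "mat_abs M = herm2 a b c"
      using psd_mat_abs by (rule psdE) auto
    have "det (mat_abs M) \<noteq> 0"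
    proof
      assume "det (mat_abs M) = 0"
      then have "det (polar2 M ** mat_abs M) = 0" by (simp add: det_mul)
      with True False show False by (simp add: polar2_mat_abs)
    qed
    then have "invertible (mat_abs M)" by (simp add: invertible_det_nz)
    then obtain N where "mat_abs M ** N = mat 1" by (auto simp: invertible_def)
    then have "v = mat_abs M *v (N *v v)" by (simp add: matrix_vector_mul_assoc)
    then show ?thesis by (intro exI[of _ "N *v v"] exI[of _ 0]) simp
  qed
next
  case False
  \<comment> \<open>In the rank-one case \<open>mat_abs M\<close> is t times the projection onto the
    orthogonal complement of the kernel, hence the component outside the kernel is
    \<open>mat_abs M\<close> applied to v / t.\<close>
  define t where "t = complex_of_real (polar_denom M)"
  have t: "t \<noteq> 0" using False by (simp add: t_def polar_denom_eq_0_iff)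
  have U: "t * polar2 M$i$j = M$i$j" for i j
    using polar2_denom[of M i j] False by (simp add: t_def)
  have "M *v (v - mat_abs M *v (inverse t *s v)) = 0"
  proof -
    have "M *v w = t *s (polar2 M *v w)" for w
      by (simp add: vec2_eq_iff mat2_vec_nth distrib_left mult.assoc[symmetric] U)
    then have "M *v (mat_abs M *v (inverse t *s v)) = t *s ((polar2 M ** mat_abs M) *v (inverse t *s v))"
      by (simp only: matrix_vector_mul_assoc[symmetric])
    also have "\<dots> = M *v v"
      using t unfolding polar2_mat_abs by (simp add: vec2_eq_iff mat2_vec_nth field_simps)
    finally show ?thesis by (simp add: matrix_vector_mult_diff_distrib)
  qed
  then show ?thesis by (intro exI[of _ "inverse t *s v"] exI[of _ "v - mat_abs M *v (inverse t *s v)"]) simp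
qed

lemma polar2_unitary:
  assumes "det M \<noteq> 0" shows "adjoint_mat (polar2 M) ** polar2 M = mat 1"
proof -
  have t: "of_real (polar_denom M) \<noteq> (0::complex)"
    using assms by (auto simp: polar_denom_eq_0_iff det_2)
  define s d where "s = sgn (det M)" and "d = complex_of_real (norm (det M))"
  have ss: "s * cnj s = 1"
    using assms unfolding s_def complex_norm_square[symmetric] by (simp add: norm_sgn)
  have "d = cnj s * (s * d)" using ss by (simp add: mult.commute mult.left_commute)
  also have "s * d = det M" unfolding s_def d_def by (rule sgn_mult_norm)
  finally have sD: "cnj s * (M$1$1 * M$2$2 - M$1$2 * M$2$1) = d" by (simp add: det_2)
  have "cnj (cnj s * (M$1$1 * M$2$2 - M$1$2 * M$2$1)) = d" unfolding sD by (simp add: d_def)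
  then have sD': "s * (cnj (M$1$1) * cnj (M$2$2) - cnj (M$1$2) * cnj (M$2$1)) = d" by simp
  have tt: "of_real (polar_denom M) * of_real (polar_denom M) = M$1$1 * cnj (M$1$1)
      + M$1$2 * cnj (M$1$2) + M$2$1 * cnj (M$2$1) + M$2$2 * cnj (M$2$2) + 2 * d"
    unfolding power2_eq_square[symmetric] of_real_power[symmetric] polar_denom_square of_real_add
      norm_mat2_square_complex by (simp add: d_def)
  have "of_real (polar_denom M) * of_real (polar_denom M) * (adjoint_mat (polar2 M) ** polar2 M)$i$j
      = of_real (polar_denom M) * of_real (polar_denom M) * mat 1$i$j" for i j
  proof -
    have "of_real (polar_denom M) * of_real (polar_denom M) * (adjoint_mat (polar2 M) ** polar2 M)$i$j
        = cnj (of_real (polar_denom M) * polar2 M$1$i) * (of_real (polar_denom M) * polar2 M$1$j)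
        + cnj (of_real (polar_denom M) * polar2 M$2$i) * (of_real (polar_denom M) * polar2 M$2$j)"
      by (simp add: mat2_mult_nth adjoint_mat_def algebra_simps)
    also have "\<dots> = of_real (polar_denom M) * of_real (polar_denom M) * mat 1$i$j
        + (s * cnj s - 1) * (cnj (coadj M$1$i) * coadj M$1$j + cnj (coadj M$2$i) * coadj M$2$j)
        + (s * (cnj (M$1$1) * cnj (M$2$2) - cnj (M$1$2) * cnj (M$2$1)) - d) * mat 1$i$j
        + (cnj s * (M$1$1 * M$2$2 - M$1$2 * M$2$1) - d) * mat 1$i$j"
      unfolding polar2_denom tt s_def[symmetric]
      using exhaust_2[of i] exhaust_2[of j]
      by (elim disjE; simp add: mat_def; simp add: algebra_simps)
    also have "\<dots> = of_real (polar_denom M) * of_real (polar_denom M) * mat 1$i$j"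
      by (simp add: ss sD sD')
    finally show ?thesis .
  qed
  with t show ?thesis by (simp add: vec_eq_iff)
qed

lemma polar2_partial_isometry: "polar2 M ** adjoint_mat (polar2 M) ** polar2 M = polar2 M"
proof (cases "det M = 0")
  case False
  then show ?thesis
    by (simp add: matrix_mul_assoc[symmetric] polar2_unitary)
next
  case D: True
  show ?thesis
  proof (cases "M = 0")
    case True
    then show ?thesis by (simp add: mat2_eq_iff mat2_mult_nth polar2_def polar_denom_def det_2)
  next
    case False
    define t where "t = complex_of_real (polar_denom M)"
    have t: "t \<noteq> 0" using False by (simp add: t_def polar_denom_eq_0_iff)
    have U: "polar2 M$i$j = M$i$j / t" for i j
      using polar2_denom[of M i j] D t by (simp add: t_def field_simps)
    have ct: "cnj t = t" by (simp add: t_def)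
    have tt: "t * t = M$1$1 * cnj (M$1$1) + M$1$2 * cnj (M$1$2) + M$2$1 * cnj (M$2$1) + M$2$2 * cnj (M$2$2)"
      unfolding t_def power2_eq_square[symmetric] of_real_power[symmetric] polar_denom_square of_real_add
        norm_mat2_square_complex by (simp add: D)
    \<comment> \<open>Cayley-Hamilton for \<open>adjoint_mat M ** M\<close>, multiplied by M. Since
      \<open>det M\<close> vanishes, t squared is the trace of that product.\<close>
    have "(M ** adjoint_mat M ** M)$i$j = t * t * M$i$j
        - (M$1$1 * M$2$2 - M$1$2 * M$2$1) * coadj M$i$j" for i j
      unfolding tt using exhaust_2[of i] exhaust_2[of j]
      by (elim disjE; simp add: mat2_mult_nth adjoint_mat_def; simp add: algebra_simps)
    then have M: "(M ** adjoint_mat M ** M)$i$j = t * t * M$i$j" for i j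
      using D by (simp add: det_2)
    have "(polar2 M ** adjoint_mat (polar2 M) ** polar2 M)$i$j = (M ** adjoint_mat M ** M)$i$j / (t * t * t)" for i j
      using t by (simp add: mat2_mult_nth adjoint_mat_def U ct field_simps)
    then show ?thesis using t by (simp add: vec_eq_iff M U)
  qed
qed

lemma polar2_kernel: "polar2 M *v v = 0 \<longleftrightarrow> M *v v = 0"
proof (cases "det M = 0")
  case False
  have "v = 0" if "polar2 M *v v = 0"
  proof -
    have "v = adjoint_mat (polar2 M) *v (polar2 M *v v)"
      using False by (simp add: matrix_vector_mul_assoc polar2_unitary)
    with that show ?thesis by simp
  qed
  moreover have "v = 0" if "M *v v = 0"
  proof -
    obtain N where "N ** M = mat 1" using False by (auto simp: invertible_det_nz[symmetric] invertible_def)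
    then have "v = N *v (M *v v)" by (simp add: matrix_vector_mul_assoc)
    with that show ?thesis by simp
  qed
  ultimately show ?thesis by auto
next
  case D: True
  show ?thesis
  proof (cases "M = 0")
    case True
    then show ?thesis by (simp add: vec2_eq_iff mat2_vec_nth polar2_def polar_denom_def det_2)
  next
    case False
    define t where "t = complex_of_real (polar_denom M)"
    have t: "t \<noteq> 0" using False by (simp add: t_def polar_denom_eq_0_iff)
    have U: "t * polar2 M$i$j = M$i$j" for i j
      using polar2_denom[of M i j] D by (simp add: t_def)
    have "M *v v = t *s (polar2 M *v v)"
      by (simp add: vec2_eq_iff mat2_vec_nth distrib_left mult.assoc[symmetric] U)
    with t show ?thesis by (simp add: vec2_eq_iff)
  qed
qed

lemma polar_part_eq: "polar_part M = polar2 M"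
  unfolding polar_part_def
proof (rule the_equality)
  show "polar2 M ** adjoint_mat (polar2 M) ** polar2 M = polar2 M \<and> M = polar2 M ** mat_abs M
      \<and> (\<forall>v. polar2 M *v v = 0 \<longleftrightarrow> M *v v = 0)"
    by (simp add: polar2_partial_isometry polar2_mat_abs polar2_kernel)
next
  fix U assume U: "U ** adjoint_mat U ** U = U \<and> M = U ** mat_abs M \<and> (\<forall>v. U *v v = 0 \<longleftrightarrow> M *v v = 0)"
  have "U *v v = polar2 M *v v" for v
  proof -
    obtain w1 w2 where v: "v = mat_abs M *v w1 + w2" and w2: "M *v w2 = 0"
      using polar_split_vector by blast
    have "U ** mat_abs M = M" "U *v w2 = 0" using U w2 by auto
    then have "U *v v = M *v w1"
      by (simp add: v matrix_vector_right_distrib matrix_vector_mul_assoc)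
    moreover have "polar2 M *v v = M *v w1"
      using polar2_kernel[of M w2] w2
      by (simp add: v matrix_vector_right_distrib matrix_vector_mul_assoc polar2_mat_abs)
    ultimately show ?thesis by simp
  qed
  then show "U = polar2 M" by (simp add: matrix_eq)
qed

text \<open>Both summands of the numerator have Frobenius norm at most that of M, which the
  denominator dominates. The value 2 is not sharp; it only enters a prefactor.\<close>

lemma norm_polar_part: "norm (polar_part M) \<le> 2"
proof (cases "M = 0")
  case True
  then have "polar_part M = 0"
    unfolding polar_part_eq by (simp add: mat2_eq_iff polar2_def polar_denom_def det_2)
  then show ?thesis by simp
next
  case False
  then have t: "polar_denom M > 0"
    using polar_denom_eq_0_iff polar_denom_nonneg by (metis less_eq_real_def)
  have "polar2 M = (1 / polar_denom M) *\<^sub>R (M + (\<chi> i j. sgn (det M) * coadj M$i$j))"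
    by (simp add: vec_eq_iff polar2_def scaleR_conv_of_real[where 'a = complex] divide_inverse mult.commute)
  then have "norm (polar2 M) = norm (M + (\<chi> i j. sgn (det M) * coadj M$i$j)) / polar_denom M"
    using t by simp
  also have "\<dots> \<le> (norm M + norm M) / polar_denom M"
  proof (intro divide_right_mono polar_denom_nonneg order_trans[OF norm_triangle_ineq] add_left_mono)
    have "norm (\<chi> i j. sgn (det M) * coadj M$i$j) = norm (sgn (det M)) * norm (coadj M)"
      unfolding norm_mat2 vec_lambda_beta norm_mult power_mult_distrib distrib_left[symmetric] real_sqrt_mult
      by simp
    also have "\<dots> \<le> norm M"
      unfolding norm_coadj by (simp add: norm_sgn)
    finally show "norm (\<chi> i j. sgn (det M) * coadj M$i$j) \<le> norm M" .
  qed
  also have "\<dots> = 2 * (norm M / polar_denom M)" by simp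
  also have "norm M / polar_denom M \<le> 1"
    using t norm_le_polar_denom[of M] by simp
  finally show ?thesis unfolding polar_part_eq by simp
qed

lemma norm_mat_abs: "norm (mat_abs M) = norm M"
proof -
  obtain a b c where A: "mat_abs M = herm2 a b c"
    using psd_mat_abs by (rule psdE) auto
  from mat_abs_square[of M] have "a\<^sup>2 + (norm b)\<^sup>2 = (norm (M$1$1))\<^sup>2 + (norm (M$2$1))\<^sup>2"
    "c\<^sup>2 + (norm b)\<^sup>2 = (norm (M$1$2))\<^sup>2 + (norm (M$2$2))\<^sup>2"
    unfolding A herm2_square adjoint_mult_eq_herm2 mat2_eq_iff herm2_nth of_real_eq_iff by auto
  then show ?thesis unfolding A norm_mat2 by simp
qed

text \<open>The squared Frobenius norm of a Hermitian root of P is the trace of P, and each of the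
  two diagonal entries is at most \<open>norm P\<close>.\<close>

lemma norm_mat_sqrt_square:
  assumes "psd P" shows "(norm (mat_sqrt P))\<^sup>2 \<le> 2 * norm P"
proof -
  obtain a b c where A: "mat_sqrt P = herm2 a b c"
    using mat_sqrt_psd(1)[OF assms] by (rule psdE) auto
  have P: "P = herm2 (a\<^sup>2 + (norm b)\<^sup>2) (b * of_real (a + c)) (c\<^sup>2 + (norm b)\<^sup>2)"
    using mat_sqrt_psd(2)[OF assms] unfolding A herm2_square by (rule sym)
  have nth: "norm (P$i$i) \<le> norm P" for i
    by (rule order_trans[OF Finite_Cartesian_Product.norm_nth_le Finite_Cartesian_Product.norm_nth_le])
  have "norm (P$1$1) = a\<^sup>2 + (norm b)\<^sup>2" "norm (P$2$2) = c\<^sup>2 + (norm b)\<^sup>2"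
    by (subst P; simp only: herm2_nth norm_of_real; simp)+
  moreover have "(norm (mat_sqrt P))\<^sup>2 = (a\<^sup>2 + (norm b)\<^sup>2) + (c\<^sup>2 + (norm b)\<^sup>2)"
    unfolding A norm_mat2 by simp
  ultimately show ?thesis using nth[of 1] nth[of 2] by simp
qed

definition mat_A :: "complex^2^2 \<Rightarrow> complex^2^2" where
  "mat_A M = mat_sqrt (mat_abs M)"

definition mat_B :: "complex^2^2 \<Rightarrow> complex^2^2" where
  "mat_B M = polar_part M ** mat_sqrt (mat_abs M)"

lemma mat_B_mat_A: "mat_B M *v (mat_A M *v v) = M *v v"
  by (simp add: mat_A_def mat_B_def matrix_vector_mul_assoc matrix_mul_assoc[symmetric]
      mat_sqrt_psd(2)[OF psd_mat_abs] polar_part_eq polar2_mat_abs)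

lemma norm_mat_A_vec: "(norm (mat_A M *v v))\<^sup>2 \<le> 2 * norm M * (norm v)\<^sup>2"
proof -
  have "(norm (mat_A M *v v))\<^sup>2 \<le> (norm (mat_A M) * norm v)\<^sup>2"
    by (intro power_mono norm_matrix_vector_mult) auto
  also have "\<dots> \<le> 2 * norm M * (norm v)\<^sup>2"
    unfolding power_mult_distrib mat_A_def
    using norm_mat_sqrt_square[OF psd_mat_abs, of M] by (intro mult_right_mono) (auto simp: norm_mat_abs)
  finally show ?thesis .
qed

lemma norm_mat_B_vec: "(norm (mat_B M *v v))\<^sup>2 \<le> 8 * norm M * (norm v)\<^sup>2"
proof -
  have "norm (mat_B M *v v) = norm (polar_part M *v (mat_A M *v v))"
    by (simp add: mat_B_def mat_A_def matrix_vector_mul_assoc)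
  also have "\<dots> \<le> norm (polar_part M) * norm (mat_A M *v v)"
    by (rule norm_matrix_vector_mult)
  also have "\<dots> \<le> 2 * norm (mat_A M *v v)"
    by (intro mult_right_mono norm_polar_part) auto
  finally have "(norm (mat_B M *v v))\<^sup>2 \<le> (2 * norm (mat_A M *v v))\<^sup>2"
    by (intro power_mono) auto
  then show ?thesis using norm_mat_A_vec[of M v] by (simp add: power_mult_distrib)
qed

section \<open>Measurability of the matrix functions\<close>

lemma borel_measurable_matI:
  assumes "\<And>i j. (\<lambda>x. f x $ i $ j) \<in> borel_measurable M"
  shows "(f :: _ \<Rightarrow> complex^'n^'m) \<in> borel_measurable M"
  unfolding borel_measurable_euclidean_space[of f]
proof (rule ballI)
  fix b :: "complex^'n^'m" assume "b \<in> Basis"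
  then obtain i j u where "b = axis i (axis j u)" by (auto simp: Basis_vec_def)
  moreover have "(\<lambda>x. f x $ i $ j \<bullet> u) \<in> borel_measurable M"
    using assms by measurable
  ultimately show "(\<lambda>x. f x \<bullet> b) \<in> borel_measurable M"
    by (simp add: inner_axis)
qed

lemma borel_measurable_vecI:
  assumes "\<And>i. (\<lambda>x. f x $ i) \<in> borel_measurable M"
  shows "(f :: _ \<Rightarrow> complex^'n) \<in> borel_measurable M"
  unfolding borel_measurable_euclidean_space[of f]
proof (rule ballI)
  fix b :: "complex^'n" assume "b \<in> Basis"
  then obtain i u where "b = axis i u" by (auto simp: Basis_vec_def)
  moreover have "(\<lambda>x. f x $ i \<bullet> u) \<in> borel_measurable M"
    using assms by measurable
  ultimately show "(\<lambda>x. f x \<bullet> b) \<in> borel_measurable M"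
    by (simp add: inner_axis)
qed

lemma borel_measurable_mat_nth [measurable]:
  "f \<in> borel_measurable M \<Longrightarrow> (\<lambda>x. (f x :: complex^'n^'m) $ i $ j) \<in> borel_measurable M"
  by (erule measurable_compose) (intro borel_measurable_continuous_onI continuous_intros)

lemma borel_measurable_vec_nth [measurable]:
  "f \<in> borel_measurable M \<Longrightarrow> (\<lambda>x. (f x :: complex^'n) $ i) \<in> borel_measurable M"
  by (erule measurable_compose) (intro borel_measurable_continuous_onI continuous_intros)

lemma borel_measurable_matrix_vector_mult [measurable]:
  assumes [measurable]: "f \<in> borel_measurable M" "g \<in> borel_measurable M"
  shows "(\<lambda>x. (f x :: complex^'n^'m) *v g x) \<in> borel_measurable M"
  by (rule borel_measurable_vecI) (simp add: matrix_vector_mult_def)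

lemma borel_measurable_matrix_mult [measurable]:
  assumes [measurable]: "f \<in> borel_measurable M" "g \<in> borel_measurable M"
  shows "(\<lambda>x. (f x :: complex^'n^'m) ** g x) \<in> borel_measurable M"
  by (rule borel_measurable_matI) (simp add: matrix_matrix_mult_def)

lemma borel_measurable_cnj [measurable]: "f \<in> borel_measurable M \<Longrightarrow> (\<lambda>x. cnj (f x)) \<in> borel_measurable M"
  by (erule measurable_compose) (intro borel_measurable_continuous_onI continuous_intros)

text \<open>Here the closed formulas pay off: a description by \<open>THE\<close> gives no access to
  measurability, whereas roots, quotients and \<open>sgn\<close> are measurable.\<close>

lemma borel_measurable_herm2_root [measurable]:
  assumes [measurable]: "p \<in> borel_measurable M" "q \<in> borel_measurable M" "r \<in> borel_measurable M"
  shows "(\<lambda>x. herm2_root (p x) (q x) (r x)) \<in> borel_measurable M"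
proof (rule borel_measurable_matI)
  fix i j :: 2
  show "(\<lambda>x. herm2_root (p x) (q x) (r x) $ i $ j) \<in> borel_measurable M"
    using exhaust_2[of i] exhaust_2[of j] by (elim disjE; simp add: herm2_root_def Let_def del: of_real_add; measurable)
qed

lemma borel_measurable_det2 [measurable]:
  assumes [measurable]: "f \<in> borel_measurable M"
  shows "(\<lambda>x. det (f x :: complex^2^2)) \<in> borel_measurable M"
  unfolding det_2 by measurable

lemma borel_measurable_mat_abs [measurable]:
  assumes [measurable]: "f \<in> borel_measurable M"
  shows "(\<lambda>x. mat_abs (f x)) \<in> borel_measurable M"
  unfolding mat_abs_eq by measurable

lemma mat_A_eq: "mat_A M = herm2_root (Re (mat_abs M$1$1)) (mat_abs M$1$2) (Re (mat_abs M$2$2))"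
proof -
  obtain a b c where A: "mat_abs M = herm2 a b c" "a \<ge> 0" "c \<ge> 0" "(norm b)\<^sup>2 \<le> a * c"
    using psd_mat_abs by (rule psdE) auto
  show ?thesis unfolding mat_A_def A(1) by (simp add: mat_sqrt_herm2[OF A(2-4)])
qed

lemma borel_measurable_mat_A [measurable]:
  assumes [measurable]: "f \<in> borel_measurable M"
  shows "(\<lambda>x. mat_A (f x)) \<in> borel_measurable M"
  unfolding mat_A_eq by measurable

lemma borel_measurable_mat_B [measurable]:
  assumes [measurable]: "f \<in> borel_measurable M"
  shows "(\<lambda>x. mat_B (f x)) \<in> borel_measurable M"
proof -
  have "(\<lambda>x. polar_part (f x)) \<in> borel_measurable M"
  proof (rule borel_measurable_matI)
    fix i j :: 2
    show "(\<lambda>x. polar_part (f x) $ i $ j) \<in> borel_measurable M"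
      using exhaust_2[of i] exhaust_2[of j]
      by (elim disjE; simp add: polar_part_eq polar2_def polar_denom_def sgn_eq; measurable)
  qed
  then show ?thesis
    unfolding mat_B_def mat_A_def[symmetric] by measurable
qed

section \<open>Completeness of the space of spinors and Neumann series\<close>

lemma borel_measurable_lebesgue_continuous: "continuous_on UNIV f \<Longrightarrow> f \<in> borel_measurable lebesgue"
  by (intro measurable_completion) (simp add: borel_measurable_continuous_onI)

lemma borel_measurable_rep_spinor [measurable]: "rep_spinor f \<in> borel_measurable lebesgue"
  using rep_spinor_L2[of f] by (simp add: L2_fun_def)

lemma integrable_rep_spinor: "integrable lebesgue (\<lambda>x. (norm (rep_spinor f x))\<^sup>2)"
  using rep_spinor_L2[of f] by (simp add: L2_fun_def)

lemma norm_spinor_square: "(norm f)\<^sup>2 = (LINT x|lebesgue. (norm (rep_spinor f x))\<^sup>2)" for f :: spinor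
  by (simp add: power2_norm_eq_inner inner_spinor_def)

lemma nn_integral_rep_spinor:
  "(\<integral>\<^sup>+x. ennreal ((norm (rep_spinor f x))\<^sup>2) \<partial>lebesgue) = ennreal ((norm f)\<^sup>2)"
  unfolding norm_spinor_square by (rule nn_integral_eq_integral[OF integrable_rep_spinor]) simp

text \<open>Working with the nonnegative integral yields membership and norm bound at once, without
  a prior integrability proof.\<close>

lemma L2_funI:
  assumes [measurable]: "f \<in> borel_measurable lebesgue"
    and le: "(\<integral>\<^sup>+x. ennreal ((norm (f x))\<^sup>2) \<partial>lebesgue) \<le> ennreal (c\<^sup>2)" and "c \<ge> 0"
  shows "f \<in> L2_fun" "norm (abs_spinor f) \<le> c"
proof -
  have "(\<integral>\<^sup>+x. ennreal (norm ((norm (f x))\<^sup>2)) \<partial>lebesgue) < \<infinity>"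
    using le by (simp add: order_le_less_trans[OF _ ennreal_less_top])
  then show L2: "f \<in> L2_fun"
    unfolding L2_fun_def by (auto intro: integrableI_bounded)
  have "ennreal ((norm (abs_spinor f))\<^sup>2) = (\<integral>\<^sup>+x. ennreal ((norm (f x))\<^sup>2) \<partial>lebesgue)"
    unfolding nn_integral_rep_spinor[symmetric]
    by (rule nn_integral_cong_AE) (use rep_abs_spinor[OF L2] in \<open>eventually_elim, simp\<close>)
  with le have "ennreal ((norm (abs_spinor f))\<^sup>2) \<le> ennreal (c\<^sup>2)" by (simp only:)
  then have "(norm (abs_spinor f))\<^sup>2 \<le> c\<^sup>2" by simp
  then show "norm (abs_spinor f) \<le> c"
    using \<open>c \<ge> 0\<close> by (rule power2_le_imp_le)
qed

lemma nn_integral_abs_spinor: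
  assumes "f \<in> L2_fun"
  shows "(\<integral>\<^sup>+x. ennreal ((norm (f x))\<^sup>2) \<partial>lebesgue) = ennreal ((norm (abs_spinor f))\<^sup>2)"
  unfolding nn_integral_rep_spinor[symmetric]
  by (rule nn_integral_cong_AE) (use rep_abs_spinor[OF assms] in \<open>eventually_elim, simp\<close>)

lemma L2_fun_dominated:
  assumes f: "f \<in> L2_fun" and [measurable]: "g \<in> borel_measurable lebesgue"
    and le: "AE x in lebesgue. norm (g x) \<le> c * norm (f x)" and c: "c \<ge> 0"
  shows "g \<in> L2_fun" "norm (abs_spinor g) \<le> c * norm (abs_spinor f)"
proof -
  have [measurable]: "f \<in> borel_measurable lebesgue" using f by (simp add: L2_fun_def)
  have "(\<integral>\<^sup>+x. ennreal ((norm (g x))\<^sup>2) \<partial>lebesgue) \<le> (\<integral>\<^sup>+x. ennreal (c\<^sup>2) * ennreal ((norm (f x))\<^sup>2) \<partial>lebesgue)"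
  proof (rule nn_integral_mono_AE)
    show "AE x in lebesgue. ennreal ((norm (g x))\<^sup>2) \<le> ennreal (c\<^sup>2) * ennreal ((norm (f x))\<^sup>2)"
      using le
    proof eventually_elim
      case (elim x)
      then have "(norm (g x))\<^sup>2 \<le> (c * norm (f x))\<^sup>2" by (intro power_mono) auto
      then show ?case by (simp add: power_mult_distrib flip: ennreal_mult)
    qed
  qed
  also have "\<dots> = ennreal ((c * norm (abs_spinor f))\<^sup>2)"
    by (subst nn_integral_cmult) (auto simp: nn_integral_abs_spinor[OF f] power_mult_distrib ennreal_mult)
  finally have *: "(\<integral>\<^sup>+x. ennreal ((norm (g x))\<^sup>2) \<partial>lebesgue) \<le> ennreal ((c * norm (abs_spinor f))\<^sup>2)" .
  show "g \<in> L2_fun" "norm (abs_spinor g) \<le> c * norm (abs_spinor f)"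
    by (rule L2_funI[OF _ *]; use c in simp)+
qed

lemma abs_spinor_eqI:
  assumes "f \<in> L2_fun" "AE x in lebesgue. rep_spinor g x = f x"
  shows "g = abs_spinor f"
  unfolding spinor_eq_iff using rep_abs_spinor[OF assms(1)] assms(2) by eventually_elim simp

lemma rep_spinor_diff:
  "AE x in lebesgue. rep_spinor (f - g) x = rep_spinor f x - rep_spinor g x"
proof -
  have "f - g = f + (- 1) *\<^sub>R g" by simp
  then show ?thesis
    using rep_spinor_plus[of f "(- 1) *\<^sub>R g"] rep_spinor_scaleR[of "-1" g]
    by (auto elim!: eventually_elim2)
qed

lemma bounded_linear_cscale: "bounded_linear (cscale c)"
  and norm_cscale: "norm (cscale c f) = norm c * norm f"
proof -
  show n: "norm (cscale c f) = norm c * norm f" for f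
  proof -
    have "(norm (cscale c f))\<^sup>2 = (LINT x|lebesgue. (norm c)\<^sup>2 * (norm (rep_spinor f x))\<^sup>2)"
      unfolding norm_spinor_square
      by (rule integral_cong_AE)
        (use rep_spinor_cscale[of c f] in \<open>auto elim!: eventually_mono simp: vec_norm_smult power_mult_distrib\<close>)
    also have "\<dots> = (norm c * norm f)\<^sup>2"
      by (simp add: norm_spinor_square power_mult_distrib)
    finally show ?thesis by simp
  qed
  show "bounded_linear (cscale c)"
  proof (rule bounded_linear_intro[where K = "norm c"])
    fix f g r
    show "cscale c (f + g) = cscale c f + cscale c g"
      unfolding spinor_eq_iff
      using rep_spinor_cscale[of c "f + g"] rep_spinor_cscale[of c f] rep_spinor_cscale[of c g]
        rep_spinor_plus[of f g] rep_spinor_plus[of "cscale c f" "cscale c g"]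
      by eventually_elim (simp add: vector_add_ldistrib)
    show "cscale c (r *\<^sub>R f) = r *\<^sub>R cscale c f"
      unfolding spinor_eq_iff
      using rep_spinor_cscale[of c "r *\<^sub>R f"] rep_spinor_cscale[of c f]
        rep_spinor_scaleR[of r f] rep_spinor_scaleR[of r "cscale c f"]
      by eventually_elim (simp add: vec_eq_iff)
  qed (simp add: n)
qed

lemma cscale_diff_left: "cscale (a - b) f = cscale a f - cscale b f"
  unfolding spinor_eq_iff
  using rep_spinor_cscale[of "a - b" f] rep_spinor_cscale[of a f] rep_spinor_cscale[of b f]
    rep_spinor_diff[of "cscale a f" "cscale b f"]
  by eventually_elim (simp add: vec_eq_iff left_diff_distrib)

lemma cscale_one [simp]: "cscale 1 f = f"
  unfolding spinor_eq_iff using rep_spinor_cscale[of 1 f] by eventually_elim simp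

lemma cscale_minus_one [simp]: "cscale (- 1) f = - f"
  using cscale_diff_left[of 0 1 f] norm_cscale[of 0 f] by simp

lemma cscale_cscale: "cscale a (cscale b f) = cscale (a * b) f"
  unfolding spinor_eq_iff
  using rep_spinor_cscale[of a "cscale b f"] rep_spinor_cscale[of "a * b" f] rep_spinor_cscale[of b f]
  by eventually_elim simp

lemma Cauchy_fast_subseq:
  fixes X :: "nat \<Rightarrow> 'a::metric_space"
  assumes "Cauchy X" "\<And>n. e n > 0"
  obtains r :: "nat \<Rightarrow> nat" where "strict_mono r" "\<And>n. dist (X (r (Suc n))) (X (r n)) < e n"
proof -
  have "\<exists>r. \<forall>n. (\<forall>m\<ge>r n. \<forall>k\<ge>r n. dist (X m) (X k) < e n) \<and> r n < (r (Suc n) :: nat)"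
  proof (rule dependent_nat_choice)
    show "\<exists>x. \<forall>m\<ge>x. \<forall>k\<ge>x. dist (X m) (X k) < e 0"
      using assms unfolding Cauchy_def by auto
    fix x n
    obtain M where "\<forall>m\<ge>M. \<forall>k\<ge>M. dist (X m) (X k) < e (Suc n)"
      using assms unfolding Cauchy_def by meson
    then show "\<exists>y. (\<forall>m\<ge>y. \<forall>k\<ge>y. dist (X m) (X k) < e (Suc n)) \<and> x < y"
      by (intro exI[of _ "max M (Suc x)"]) auto
  qed
  then obtain r where r: "\<And>n m k. m \<ge> r n \<Longrightarrow> k \<ge> r n \<Longrightarrow> dist (X m) (X k) < e n" "\<And>n. r n < r (Suc n)"
    by blast
  show ?thesis
    by (rule that[of r]) (auto simp: strict_mono_Suc_iff r less_imp_le)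
qed

text \<open>Riesz-Fischer: a rapidly converging subsequence converges almost everywhere, and Fatou's
  lemma bounds the distance of the pointwise limit from its members.\<close>

instance spinor :: banach
proof
  fix X :: "nat \<Rightarrow> spinor" assume "Cauchy X"
  then obtain r where r: "strict_mono r" "\<And>n. dist (X (r (Suc n))) (X (r n)) < (1/2)^n"
    by (rule Cauchy_fast_subseq[where e = "\<lambda>n. (1/2)^n"]) auto
  define Y where "Y n = rep_spinor (X (r n))" for n
  define D where "D n x = norm (Y (Suc n) x - Y n x)" for n x
  have [measurable]: "Y n \<in> borel_measurable lebesgue" for n by (simp add: Y_def)
  have [measurable]: "D n \<in> borel_measurable lebesgue" for n unfolding D_def by measurable
  have diff: "(\<integral>\<^sup>+x. ennreal ((norm (Y m x - Y n x))\<^sup>2) \<partial>lebesgue) = ennreal ((dist (X (r m)) (X (r n)))\<^sup>2)" for m n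
    unfolding dist_norm nn_integral_rep_spinor[symmetric]
    by (rule nn_integral_cong_AE)
      (use rep_spinor_diff[of "X (r m)" "X (r n)"] in \<open>eventually_elim, simp add: Y_def\<close>)
  have "(\<integral>\<^sup>+x. (\<Sum>n. ennreal (2^n * (D n x)\<^sup>2)) \<partial>lebesgue) = (\<Sum>n. \<integral>\<^sup>+x. ennreal (2^n * (D n x)\<^sup>2) \<partial>lebesgue)"
    by (rule nn_integral_suminf) measurable
  also have "\<dots> \<le> (\<Sum>n. ennreal ((1/2)^n))"
  proof (intro suminf_le)
    fix n
    have "(\<integral>\<^sup>+x. ennreal (2^n * (D n x)\<^sup>2) \<partial>lebesgue) = ennreal (2^n) * ennreal ((dist (X (r (Suc n))) (X (r n)))\<^sup>2)"
      unfolding diff[symmetric] by (simp add: ennreal_mult nn_integral_cmult D_def)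
    also have "\<dots> \<le> ennreal (2^n) * ennreal (((1/2)^n)\<^sup>2)"
      using r(2)[of n] by (intro mult_left_mono ennreal_leI power_mono) auto
    also have "\<dots> = ennreal ((1/2)^n)"
      by (simp add: ennreal_mult[symmetric] power2_eq_square power_mult_distrib[symmetric] mult.assoc[symmetric])
    finally show "(\<integral>\<^sup>+x. ennreal (2^n * (D n x)\<^sup>2) \<partial>lebesgue) \<le> ennreal ((1/2)^n)" .
  qed auto
  also have "\<dots> = ennreal (\<Sum>n. (1/2)^n)"
    by (rule suminf_ennreal2) (auto intro: summable_geometric)
  finally have "(\<integral>\<^sup>+x. (\<Sum>n. ennreal (2^n * (D n x)\<^sup>2)) \<partial>lebesgue) \<noteq> \<infinity>"
    using ennreal_less_top by (metis infinity_ennreal_def leD order_top_class.top_greatest top.not_eq_extremum)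
  then have "AE x in lebesgue. (\<Sum>n. ennreal (2^n * (D n x)\<^sup>2)) \<noteq> \<infinity>"
    by (intro nn_integral_PInf_AE) auto
  then have conv: "AE x in lebesgue. (\<lambda>n. Y n x) \<longlonglongrightarrow> lim (\<lambda>n. Y n x)"
  proof eventually_elim
    fix x assume fin: "(\<Sum>n. ennreal (2^n * (D n x)\<^sup>2)) \<noteq> \<infinity>"
    define C where "C = enn2real (\<Sum>n. ennreal (2^n * (D n x)\<^sup>2))"
    have C: "(\<Sum>n. ennreal (2^n * (D n x)\<^sup>2)) = ennreal C" "C \<ge> 0"
      using fin by (auto simp: C_def less_top)
    \<comment> \<open>The weight 2^n is a compromise: squared distances below 4^-n keep the weighted
      integrals summable, and a finite weighted sum at x still forces the increments to decay like
      2^(-n/2).\<close>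
    have "D n x \<le> sqrt C * (sqrt (1/2))^n" for n
    proof -
      have "(\<Sum>k\<in>{n}. ennreal (2^k * (D k x)\<^sup>2)) \<le> (\<Sum>n. ennreal (2^n * (D n x)\<^sup>2))"
        by (rule sum_le_suminf) auto
      then have "2^n * (D n x)\<^sup>2 \<le> C" using C by simp
      then have "(D n x)\<^sup>2 \<le> C * (1/2)^n" by (simp add: field_simps power_divide)
      then show ?thesis
        by (metis real_le_rsqrt real_sqrt_mult real_sqrt_power)
    qed
    then have "summable (\<lambda>n. D n x)"
      by (intro summable_comparison_test[of "\<lambda>n. D n x" "\<lambda>n. sqrt C * (sqrt (1/2))^n"] summable_mult summable_geometric)
        (auto simp: D_def real_sqrt_divide)
    then have "summable (\<lambda>n. Y (Suc n) x - Y n x)"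
      unfolding D_def by (rule summable_norm_cancel)
    then have "convergent (\<lambda>n. Y n x - Y 0 x)"
      by (simp add: summable_iff_convergent sum_lessThan_telescope[of "\<lambda>n. Y n x"])
    then have "convergent (\<lambda>n. (Y n x - Y 0 x) + Y 0 x)"
      by (intro convergent_add convergent_const)
    then have "convergent (\<lambda>n. Y n x)" by simp
    then show "(\<lambda>n. Y n x) \<longlonglongrightarrow> lim (\<lambda>n. Y n x)" by (simp add: convergent_LIMSEQ_iff)
  qed
  define g where "g x = lim (\<lambda>n. Y n x)" for x
  have [measurable]: "g \<in> borel_measurable lebesgue"
    unfolding g_def by measurable
  have le: "(\<integral>\<^sup>+x. ennreal ((norm (g x - Y n x))\<^sup>2) \<partial>lebesgue) \<le> ennreal (e\<^sup>2)"
    if e: "\<And>m. m \<ge> n \<Longrightarrow> dist (X (r m)) (X (r n)) \<le> e" for n e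
  proof -
    have "(\<integral>\<^sup>+x. ennreal ((norm (g x - Y n x))\<^sup>2) \<partial>lebesgue)
        = (\<integral>\<^sup>+x. liminf (\<lambda>m. ennreal ((norm (Y m x - Y n x))\<^sup>2)) \<partial>lebesgue)"
    proof (rule nn_integral_cong_AE)
      show "AE x in lebesgue. ennreal ((norm (g x - Y n x))\<^sup>2) = liminf (\<lambda>m. ennreal ((norm (Y m x - Y n x))\<^sup>2))"
        using conv
      proof eventually_elim
        fix x assume "(\<lambda>n. Y n x) \<longlonglongrightarrow> lim (\<lambda>n. Y n x)"
        then have "(\<lambda>m. ennreal ((norm (Y m x - Y n x))\<^sup>2)) \<longlonglongrightarrow> ennreal ((norm (g x - Y n x))\<^sup>2)"
          unfolding g_def by (intro tendsto_intros)
        then show "ennreal ((norm (g x - Y n x))\<^sup>2) = liminf (\<lambda>m. ennreal ((norm (Y m x - Y n x))\<^sup>2))"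
          by (rule lim_imp_Liminf[OF sequentially_bot, symmetric])
      qed
    qed
    also have "\<dots> \<le> liminf (\<lambda>m. \<integral>\<^sup>+x. ennreal ((norm (Y m x - Y n x))\<^sup>2) \<partial>lebesgue)"
      by (rule nn_integral_liminf) measurable
    also have "\<dots> \<le> limsup (\<lambda>m. \<integral>\<^sup>+x. ennreal ((norm (Y m x - Y n x))\<^sup>2) \<partial>lebesgue)"
      by (rule Liminf_le_Limsup) simp
    also have "\<dots> \<le> ennreal (e\<^sup>2)"
      unfolding diff
      by (rule Limsup_bounded)
        (use e in \<open>auto intro!: eventually_sequentiallyI[of n] ennreal_leI power_mono\<close>)
    finally show ?thesis .
  qed
  have "Cauchy (X \<circ> r)" using \<open>Cauchy X\<close> r(1) by (rule Cauchy_subseq_Cauchy)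
  have ball: "\<exists>N. \<forall>n\<ge>N. (\<integral>\<^sup>+x. ennreal ((norm (g x - Y n x))\<^sup>2) \<partial>lebesgue) \<le> ennreal (e\<^sup>2)" if "e > 0" for e
  proof -
    from metric_CauchyD[OF \<open>Cauchy (X \<circ> r)\<close> \<open>e > 0\<close>] obtain N
      where "\<And>m n. m \<ge> N \<Longrightarrow> n \<ge> N \<Longrightarrow> dist (X (r m)) (X (r n)) < e" by auto
    then show ?thesis by (intro exI[of _ N] allI impI le) (auto intro: less_imp_le)
  qed
  have gY: "(\<lambda>x. g x - Y n x) \<in> L2_fun" if "(\<integral>\<^sup>+x. ennreal ((norm (g x - Y n x))\<^sup>2) \<partial>lebesgue) \<le> ennreal (e\<^sup>2)" "e > 0" for n e
    by (rule L2_funI(1)[OF _ that(1)]) (use that in auto)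
  obtain N where "(\<integral>\<^sup>+x. ennreal ((norm (g x - Y N x))\<^sup>2) \<partial>lebesgue) \<le> ennreal (1\<^sup>2)"
    using ball[of 1] by auto
  then have "(\<lambda>x. g x - Y N x) \<in> L2_fun" by (rule gY) simp
  from L2_fun_add[OF this rep_spinor_L2[of "X (r N)"]] have gL2: "g \<in> L2_fun"
    by (simp add: Y_def)
  have "(X \<circ> r) \<longlonglongrightarrow> abs_spinor g"
  proof (rule metric_LIMSEQ_I)
    fix e :: real assume "e > 0"
    then obtain N where N: "\<And>n. n \<ge> N \<Longrightarrow> (\<integral>\<^sup>+x. ennreal ((norm (g x - Y n x))\<^sup>2) \<partial>lebesgue) \<le> ennreal ((e/2)\<^sup>2)"
      using ball[of "e/2"] by auto
    show "\<exists>no. \<forall>n\<ge>no. dist ((X \<circ> r) n) (abs_spinor g) < e"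
    proof (intro exI allI impI)
      fix n assume n: "n \<ge> N"
      have "(\<lambda>x. g x - Y n x) \<in> L2_fun" "norm (abs_spinor (\<lambda>x. g x - Y n x)) \<le> e / 2"
        using L2_funI[OF _ N[OF n]] \<open>e > 0\<close> by auto
      moreover have "abs_spinor g - X (r n) = abs_spinor (\<lambda>x. g x - Y n x)"
        by (rule abs_spinor_eqI)
          (use calculation(1) rep_spinor_diff[of "abs_spinor g" "X (r n)"] rep_abs_spinor[OF gL2] in
            \<open>auto elim!: eventually_elim2 simp: Y_def\<close>)
      ultimately show "dist ((X \<circ> r) n) (abs_spinor g) < e"
        using \<open>e > 0\<close> by (simp add: dist_norm norm_minus_commute)
    qed
  qed
  then have "X \<longlonglongrightarrow> abs_spinor g"
    using Cauchy_converges_subseq[OF \<open>Cauchy X\<close> r(1), of "abs_spinor g"] by simp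
  then show "convergent X" by (rule convergentI)
qed

text \<open>Only the powers are required to decay geometrically, not the norm of T to be below 1:
  the contraction property will hold in a weighted norm on a different space.\<close>

lemma Neumann_series:
  fixes T :: "'a::banach \<Rightarrow> 'a"
  assumes T: "bounded_linear T" and q: "0 \<le> q" "q < 1" and pow: "\<And>n f. norm ((T ^^ n) f) \<le> c * q ^ n * norm f"
  obtains S where "bounded_linear S" "\<And>f. S (f + T f) = f" "\<And>f. S f + T (S f) = f"
proof -
  interpret T: bounded_linear T by fact
  define a where "a f n = (-1) ^ n *\<^sub>R (T ^^ n) f" for f n
  have lin: "(T ^^ n) (f + g) = (T ^^ n) f + (T ^^ n) g" "(T ^^ n) (r *\<^sub>R f) = r *\<^sub>R (T ^^ n) f" for n f g r
    by (induction n) (auto simp: T.add T.scaleR)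
  have bound: "norm (a f n) \<le> c * norm f * q ^ n" for f n
    using pow[of n f] by (simp add: a_def mult_ac)
  have summ: "summable (\<lambda>n. c * norm f * q ^ n)" for f
    using q by (intro summable_mult summable_geometric) auto
  have sa: "summable (a f)" for f
    by (rule summable_comparison_test[OF _ summ[of f]]) (use bound in auto)
  define S where "S f = suminf (a f)" for f
  have Suc: "suminf (\<lambda>n. a f (Suc n)) = S f - f" for f
    unfolding S_def using suminf_split_head[OF sa[of f]] by (simp add: a_def)
  have T_a: "T (a f n) = - a f (Suc n)" "a (T f) n = - a f (Suc n)" for f n
    by (simp_all add: a_def T.scaleR funpow_swap1)
  have "T (S f) = f - S f" for f
    unfolding S_def T.suminf[OF sa]
    using suminf_minus[of "\<lambda>n. a f (Suc n)"] sa[of f] Suc[of f]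
    by (simp add: T_a summable_Suc_iff S_def)
  moreover have "S (T f) = f - S f" for f
  proof -
    have "a (T f) = (\<lambda>n. - a f (Suc n))" using T_a(2) by auto
    then show ?thesis
      using suminf_minus[of "\<lambda>n. a f (Suc n)"] sa[of f] Suc[of f]
      by (simp add: summable_Suc_iff S_def)
  qed
  moreover have S_add: "S (f + g) = S f + S g" for f g
  proof -
    have "a (f + g) = (\<lambda>n. a f n + a g n)" by (auto simp: a_def lin scaleR_add_right)
    then show ?thesis unfolding S_def using suminf_add[OF sa[of f] sa[of g]] by simp
  qed
  moreover have "bounded_linear S"
  proof (rule bounded_linear_intro[where K = "c / (1 - q)"])
    fix f r
    have "a (r *\<^sub>R f) = (\<lambda>n. r *\<^sub>R a f n)" by (auto simp: a_def lin mult.commute)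
    then show "S (r *\<^sub>R f) = r *\<^sub>R S f"
      unfolding S_def suminf_scaleR_right[OF sa[of f]] by simp
    have "norm (S f) \<le> (\<Sum>n. c * norm f * q ^ n)"
      unfolding S_def using bound by (rule norm_suminf_le) (rule summ)
    also have "\<dots> = norm f * (c / (1 - q))"
      using q by (subst suminf_mult) (auto simp: suminf_geometric)
    finally show "norm (S f) \<le> norm f * (c / (1 - q))" .
  qed (rule S_add)
  ultimately show ?thesis by (intro that[of S]) auto
qed

text \<open>Identifies the closure in \<open>bs_opr\<close>: the full graph is closed by continuity
  of Q, and the continuous map from f to (f, Q f) carries a dense set to a dense part of it.\<close>

lemma closure_bounded_linear_graph:
  assumes Q: "bounded_linear Q" and D: "closure D = UNIV"
  shows "closure {(f, Q f) | f. f \<in> D} = {(f, Q f) | f. True}"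
proof
  have cont: "continuous_on UNIV Q" using Q by (rule linear_continuous_on)
  have "closed {p. snd p = Q (fst p)}"
    by (intro closed_Collect_eq continuous_intros continuous_on_compose2[OF cont]) auto
  then show "closure {(f, Q f) | f. f \<in> D} \<subseteq> {(f, Q f) | f. True}"
    by (intro closure_minimal) (auto elim!: back_subst[of closed])
  have "(\<lambda>f. (f, Q f)) ` closure D \<subseteq> closure ((\<lambda>f. (f, Q f)) ` D)"
    unfolding D by (intro image_closure_subset[where S = D, unfolded D] continuous_intros cont closure_subset) auto
  then show "{(f, Q f) | f. True} \<subseteq> closure {(f, Q f) | f. f \<in> D}"
    unfolding D by (simp add: image_def Setcompr_eq_image)
qed

section \<open>Resolvent sets of graphs\<close>

lemma opr_diff_scalar_iff: "(f, g) \<in> opr_diff T (opr_scalar z) \<longleftrightarrow> (f, g + cscale z f) \<in> T"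
  unfolding opr_diff_def opr_scalar_def by (auto simp: algebra_simps)

lemma resolvent_set_iff:
  "z \<in> resolvent_set T \<longleftrightarrow> (\<exists>R. bounded_linear R \<and> (\<forall>f g. (f, g + cscale z f) \<in> T \<longleftrightarrow> f = R g))"
proof -
  have "resolvent T z = {(g, R g) | g. True} \<longleftrightarrow> (\<forall>f g. (f, g + cscale z f) \<in> T \<longleftrightarrow> f = R g)" for R
    by (auto simp: resolvent_def set_eq_iff opr_diff_scalar_iff)
  then show ?thesis by (simp add: resolvent_set_def)
qed

text \<open>(T - w) R = 1 + (z - w) R, so \<open>R (S g)\<close> inverts T - w when S inverts the
  right-hand side. Openness makes the spectrum closed, so that points off it have positive
  distance.\<close>

lemma open_resolvent_set: "open (resolvent_set T)"
  unfolding open_contains_ball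
proof
  fix z assume "z \<in> resolvent_set T"
  then obtain R where R: "bounded_linear R" "\<And>f g. (f, g + cscale z f) \<in> T \<longleftrightarrow> f = R g"
    by (auto simp: resolvent_set_iff)
  obtain K where K: "K > 0" "\<And>f. norm (R f) \<le> norm f * K"
    using bounded_linear.pos_bounded[OF R(1)] by auto
  have "w \<in> resolvent_set T" if w: "dist z w < 1 / K" for w
  proof -
    define P where "P f = cscale (z - w) (R f)" for f
    define q where "q = norm (z - w) * K"
    have P: "bounded_linear P"
      unfolding P_def using bounded_linear_compose[OF bounded_linear_cscale R(1)] by simp
    have "norm (P f) \<le> q * norm f" for f
      using mult_left_mono[OF K(2)[of f] norm_ge_zero[of "z - w"]]
      by (simp add: P_def norm_cscale q_def mult_ac)
    then have "norm ((P ^^ n) f) \<le> 1 * q ^ n * norm f" for n f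
    proof (induction n)
      case (Suc n)
      have "norm ((P ^^ Suc n) f) \<le> q * norm ((P ^^ n) f)" using Suc.prems by simp
      also have "\<dots> \<le> q * (1 * q ^ n * norm f)"
        using Suc K(1) by (intro mult_left_mono) (auto simp: q_def)
      finally show ?case by (simp add: mult_ac)
    qed simp
    moreover have "0 \<le> q" "q < 1" using K(1) w by (auto simp: q_def dist_norm field_simps)
    ultimately obtain S where S: "bounded_linear S" "\<And>f. S (f + P f) = f" "\<And>f. S f + P (S f) = f"
      using Neumann_series[OF P, of q 1] by metis
    have "(f, g + cscale w f) \<in> T \<longleftrightarrow> f = R (S g)" for f g
    proof -
      have "g + cscale w f = (g - cscale (z - w) f) + cscale z f"
        by (simp add: cscale_diff_left)
      then have "(f, g + cscale w f) \<in> T \<longleftrightarrow> f = R (g - cscale (z - w) f)" using R(2) by metis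
      also have "\<dots> \<longleftrightarrow> f = R (S g)"
      proof
        assume f: "f = R (g - cscale (z - w) f)"
        define h where "h = g - cscale (z - w) f"
        have "h + P h = g" using f by (simp add: P_def h_def)
        then have "h = S g" using S(2) by metis
        then show "f = R (S g)" using f h_def by simp
      next
        assume f: "f = R (S g)"
        then have "g - cscale (z - w) f = S g"
          using S(3)[of g] by (simp add: P_def algebra_simps)
        then show "f = R (g - cscale (z - w) f)" using f by simp
      qed
      finally show ?thesis .
    qed
    then show ?thesis
      unfolding resolvent_set_iff using bounded_linear_compose[OF R(1) S(1)] by blast
  qed
  then show "\<exists>e>0. ball z e \<subseteq> resolvent_set T"
    using K(1) by (intro exI[of _ "1 / K"]) auto
qed

text \<open>Representatives of spinors are only Lebesgue measurable, so Tonelli and Fubini are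
  applied to the completed measure itself.\<close>

lemma sigma_finite_lebesgue: "sigma_finite_measure (lebesgue :: real measure)"
proof
  show "\<exists>A. countable A \<and> A \<subseteq> sets lebesgue \<and> \<Union>A = space (lebesgue :: real measure)
      \<and> (\<forall>a\<in>A. emeasure lebesgue a \<noteq> \<infinity>)"
  proof (intro exI[of _ "range (\<lambda>n::nat. {- real n..real n})"] conjI ballI)
    have "\<exists>n::nat. - real n \<le> x \<and> x \<le> real n" for x
      using real_arch_simple[of "\<bar>x\<bar>"] by (auto simp: abs_le_iff) (metis minus_le_iff)
    then show "(\<Union>n::nat. {- real n..real n}) = space (lebesgue :: real measure)"
      by auto
  qed auto
qed

interpretation lebesgue: sigma_finite_measure "lebesgue :: real measure"
  by (rule sigma_finite_lebesgue)

interpretation lebesgue_pair: pair_sigma_finite "lebesgue :: real measure" "lebesgue :: real measure" ..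

lemma borel_measurable_fst_lebesgue [measurable]: "fst \<in> borel_measurable (lebesgue \<Otimes>\<^sub>M N)"
  and borel_measurable_snd_lebesgue [measurable]: "snd \<in> borel_measurable (N \<Otimes>\<^sub>M lebesgue)"
  by (rule measurable_compose[OF measurable_fst] measurable_compose[OF measurable_snd],
      rule id_borel_measurable_lebesgue[unfolded id_def])+

section \<open>The Green kernel of the free Dirac operator\<close>

lemma nn_integral_exp_abs:
  fixes c x :: real assumes "c > 0"
  shows "(\<integral>\<^sup>+y. ennreal (exp (- c * \<bar>x - y\<bar>)) \<partial>lebesgue) = ennreal (2 / c)"
    and "(\<integral>\<^sup>+y. ennreal (exp (- c * \<bar>y - x\<bar>)) \<partial>lebesgue) = ennreal (2 / c)"
proof -
  have half: "(\<integral>\<^sup>+y. ennreal (exp (- c * y)) * indicator {0..} y \<partial>lborel) = ennreal (0 - (- exp (- c * 0) / c))"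
  proof (rule nn_integral_FTC_atLeast)
    show "((\<lambda>y. - exp (- c * y) / c) has_real_derivative exp (- c * y)) (at y)" for y
      using assms by (auto intro!: derivative_eq_intros simp: field_simps)
    have "filterlim (\<lambda>y. - c * y) at_bot at_top"
      using assms by (intro filterlim_tendsto_neg_mult_at_bot[OF tendsto_const] filterlim_ident) auto
    then have "((\<lambda>y. - exp (- c * y) / c) \<longlongrightarrow> - 0 / c) at_top"
      by (intro tendsto_intros filterlim_compose[OF exp_at_bot]) (use assms in auto)
    then show "((\<lambda>y. - exp (- c * y) / c) \<longlongrightarrow> 0) at_top" by simp
  qed auto
  have "(\<integral>\<^sup>+y. ennreal (exp (- c * \<bar>y\<bar>)) \<partial>lborel)
      = (\<integral>\<^sup>+y. ennreal (exp (- c * y)) * indicator {0..} y + ennreal (exp (c * y)) * indicator {..<0} y \<partial>lborel)"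
    by (intro nn_integral_cong) (auto simp: indicator_def)
  also have "\<dots> = (\<integral>\<^sup>+y. ennreal (exp (- c * y)) * indicator {0..} y \<partial>lborel)
      + (\<integral>\<^sup>+y. ennreal (exp (c * y)) * indicator {..<0} y \<partial>lborel)"
    by (rule nn_integral_add) auto
  also have "(\<integral>\<^sup>+y. ennreal (exp (c * y)) * indicator {..<0} y \<partial>lborel)
      = (\<integral>\<^sup>+y. ennreal (exp (- c * y)) * indicator {0<..} y \<partial>lborel)"
    by (subst nn_integral_real_affine[where c = "-1" and t = 0]) (auto intro!: nn_integral_cong simp: indicator_def)
  also have "\<dots> = (\<integral>\<^sup>+y. ennreal (exp (- c * y)) * indicator {0..} y \<partial>lborel)"
    by (intro nn_integral_cong_AE) (use AE_lborel_singleton[of 0] in \<open>auto elim!: eventually_mono simp: indicator_def\<close>)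
  finally have *: "(\<integral>\<^sup>+y. ennreal (exp (- c * \<bar>y\<bar>)) \<partial>lborel) = ennreal (2 / c)"
    using assms unfolding half by (simp flip: ennreal_plus)
  have "(\<integral>\<^sup>+y. ennreal (exp (- c * \<bar>x - y\<bar>)) \<partial>lborel) = (\<integral>\<^sup>+y. ennreal (exp (- c * \<bar>y\<bar>)) \<partial>lborel)"
    by (subst nn_integral_real_affine[where c = "-1" and t = x]) auto
  then show "(\<integral>\<^sup>+y. ennreal (exp (- c * \<bar>x - y\<bar>)) \<partial>lebesgue) = ennreal (2 / c)"
    unfolding nn_integral_completion * .
  then show "(\<integral>\<^sup>+y. ennreal (exp (- c * \<bar>y - x\<bar>)) \<partial>lebesgue) = ennreal (2 / c)"
    by (simp only: abs_minus_commute)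
qed

text \<open>The scalar majorant of the Green operator. Values in \<open>ennreal\<close> let all
  estimates be stated before any convergence is known.\<close>

definition exp_conv :: "real \<Rightarrow> (real \<Rightarrow> ennreal) \<Rightarrow> real \<Rightarrow> ennreal" where
  "exp_conv c u x = (\<integral>\<^sup>+y. ennreal (exp (- c * \<bar>x - y\<bar>)) * u y \<partial>lebesgue)"

lemma borel_measurable_exp_kernel [measurable]:
  fixes c x :: real
  shows "(\<lambda>y. exp (- c * \<bar>x - y\<bar>)) \<in> borel_measurable lebesgue"
  "(\<lambda>(x, y). exp (- c * \<bar>x - y\<bar>)) \<in> borel_measurable (lebesgue \<Otimes>\<^sub>M lebesgue)"
  "(\<lambda>p. exp (- c * \<bar>fst p - snd p\<bar>)) \<in> borel_measurable (lebesgue \<Otimes>\<^sub>M lebesgue)"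
proof -
  have "(\<lambda>y. exp (- c * \<bar>x - y\<bar>)) \<in> borel_measurable borel"
    by (intro borel_measurable_continuous_onI continuous_intros)
  then show "(\<lambda>y. exp (- c * \<bar>x - y\<bar>)) \<in> borel_measurable lebesgue"
    by (intro measurable_completion) simp
  have "(\<lambda>p :: real \<times> real. exp (- c * \<bar>fst p - snd p\<bar>)) \<in> borel_measurable borel"
    by (intro borel_measurable_continuous_onI continuous_intros)
  from measurable_compose[OF borel_measurable_Pair[OF borel_measurable_fst_lebesgue borel_measurable_snd_lebesgue] this]
  show "(\<lambda>p. exp (- c * \<bar>fst p - snd p\<bar>)) \<in> borel_measurable (lebesgue \<Otimes>\<^sub>M lebesgue)"
    by simp
  then show "(\<lambda>(x, y). exp (- c * \<bar>x - y\<bar>)) \<in> borel_measurable (lebesgue \<Otimes>\<^sub>M lebesgue)"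
    by (simp add: case_prod_unfold)
qed

lemma borel_measurable_exp_conv [measurable]:
  assumes [measurable]: "u \<in> borel_measurable lebesgue"
  shows "exp_conv c u \<in> borel_measurable lebesgue"
proof -
  have "(\<lambda>p. ennreal (exp (- c * \<bar>fst p - snd p\<bar>)) * u (snd p)) \<in> borel_measurable (lebesgue \<Otimes>\<^sub>M lebesgue)"
    by measurable
  then show ?thesis
    unfolding exp_conv_def by (intro lebesgue.borel_measurable_nn_integral) (simp add: case_prod_unfold)
qed

lemma exp_conv_le_nn_integral: "c \<ge> 0 \<Longrightarrow> exp_conv c u x \<le> (\<integral>\<^sup>+y. u y \<partial>lebesgue)"
  unfolding exp_conv_def
proof (rule nn_integral_mono)
  fix y assume "c \<ge> 0"
  then have "ennreal (exp (- c * \<bar>x - y\<bar>)) \<le> 1" by simp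
  then have "ennreal (exp (- c * \<bar>x - y\<bar>)) * u y \<le> 1 * u y" by (rule mult_right_mono) simp
  then show "ennreal (exp (- c * \<bar>x - y\<bar>)) * u y \<le> u y" by simp
qed

lemma exp_conv_mono: "(\<And>y. u y \<le> v y) \<Longrightarrow> exp_conv c u x \<le> exp_conv c v x"
  unfolding exp_conv_def by (intro nn_integral_mono mult_left_mono) auto

lemma nn_integral_exp_conv:
  assumes [measurable]: "u \<in> borel_measurable lebesgue" and "c > 0"
  shows "(\<integral>\<^sup>+x. exp_conv c u x \<partial>lebesgue) = ennreal (2 / c) * (\<integral>\<^sup>+y. u y \<partial>lebesgue)"
proof -
  have "(\<integral>\<^sup>+x. exp_conv c u x \<partial>lebesgue)
      = (\<integral>\<^sup>+y. (\<integral>\<^sup>+x. ennreal (exp (- c * \<bar>x - y\<bar>)) * u y \<partial>lebesgue) \<partial>lebesgue)"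
    unfolding exp_conv_def
  proof (rule lebesgue_pair.Fubini'[symmetric])
    have "(\<lambda>p. ennreal (exp (- c * \<bar>fst p - snd p\<bar>)) * u (snd p)) \<in> borel_measurable (lebesgue \<Otimes>\<^sub>M lebesgue)"
      by measurable
    then show "(\<lambda>(x, y). ennreal (exp (- c * \<bar>x - y\<bar>)) * u y) \<in> borel_measurable (lebesgue \<Otimes>\<^sub>M lebesgue)"
      by (simp add: case_prod_unfold)
  qed
  also have "\<dots> = (\<integral>\<^sup>+y. ennreal (2 / c) * u y \<partial>lebesgue)"
  proof (rule nn_integral_cong)
    fix y
    have "(\<lambda>x. exp (- c * \<bar>x - y\<bar>)) \<in> borel_measurable lebesgue"
      using borel_measurable_exp_kernel(1)[of c y] by (simp only: abs_minus_commute)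
    then show "(\<integral>\<^sup>+x. ennreal (exp (- c * \<bar>x - y\<bar>)) * u y \<partial>lebesgue) = ennreal (2 / c) * u y"
      by (subst nn_integral_multc) (simp_all only: measurable_compose[OF _ measurable_ennreal] nn_integral_exp_abs(2)[OF \<open>c > 0\<close>])
  qed
  also have "\<dots> = ennreal (2 / c) * (\<integral>\<^sup>+y. u y \<partial>lebesgue)"
    by (rule nn_integral_cmult) measurable
  finally show ?thesis .
qed

text \<open>Cauchy-Schwarz with the exponential as weight: half of the exponent goes to each
  factor.\<close>

lemma exp_conv_Cauchy_Schwarz:
  assumes [measurable]: "u \<in> borel_measurable lebesgue" "v \<in> borel_measurable lebesgue"
  shows "(exp_conv c (\<lambda>y. u y * v y) x)\<^sup>2 \<le> exp_conv c (\<lambda>y. (u y)\<^sup>2) x * exp_conv c (\<lambda>y. (v y)\<^sup>2) x"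
proof -
  have *: "ennreal (exp (- c * t)) = (ennreal (exp (- (c/2) * t)))\<^sup>2" for t
    by (simp add: ennreal_power power2_eq_square flip: exp_add ennreal_mult)
  have "(\<integral>\<^sup>+y. (ennreal (exp (- (c/2) * \<bar>x - y\<bar>)) * u y) * (ennreal (exp (- (c/2) * \<bar>x - y\<bar>)) * v y) \<partial>lebesgue)\<^sup>2
      \<le> (\<integral>\<^sup>+y. (ennreal (exp (- (c/2) * \<bar>x - y\<bar>)) * u y)\<^sup>2 \<partial>lebesgue)
        * (\<integral>\<^sup>+y. (ennreal (exp (- (c/2) * \<bar>x - y\<bar>)) * v y)\<^sup>2 \<partial>lebesgue)"
    by (rule Cauchy_Schwarz_nn_integral) measurable
  then show ?thesis
    unfolding exp_conv_def * power_mult_distrib by (simp add: power2_eq_square mult_ac)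
qed

text \<open>Here the whole exponential goes to one factor; its square has rate 2c and integral 1/c.
  This constant must be sharp, since it produces the \<open>Im k\<close> in the hypothesis.\<close>

lemma exp_conv_square_le:
  assumes [measurable]: "u \<in> borel_measurable lebesgue" and "c > 0"
  shows "(exp_conv c u x)\<^sup>2 \<le> ennreal (1 / c) * (\<integral>\<^sup>+y. (u y)\<^sup>2 \<partial>lebesgue)"
proof -
  have "(exp_conv c u x)\<^sup>2 \<le> (\<integral>\<^sup>+y. (ennreal (exp (- c * \<bar>x - y\<bar>)))\<^sup>2 \<partial>lebesgue) * (\<integral>\<^sup>+y. (u y)\<^sup>2 \<partial>lebesgue)"
    unfolding exp_conv_def by (rule Cauchy_Schwarz_nn_integral) measurable
  also have "(\<integral>\<^sup>+y. (ennreal (exp (- c * \<bar>x - y\<bar>)))\<^sup>2 \<partial>lebesgue) = (\<integral>\<^sup>+y. ennreal (exp (- (2 * c) * \<bar>x - y\<bar>)) \<partial>lebesgue)"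
    by (intro nn_integral_cong) (simp add: ennreal_power power2_eq_square flip: exp_add ennreal_mult)
  also have "\<dots> = ennreal (1 / c)"
    using assms by (subst nn_integral_exp_abs(1)) auto
  finally show ?thesis .
qed

text \<open>The dual estimate, with the same constant. Splitting u into two roots leaves a
  convolution of rate 2c, whose integral over x is again governed by 1/c.\<close>

lemma nn_integral_exp_conv_square_L1:
  assumes [measurable]: "u \<in> borel_measurable lebesgue" and "c > 0" and nonneg: "\<And>y. u y \<ge> 0"
  shows "(\<integral>\<^sup>+x. (exp_conv c (\<lambda>y. ennreal (u y)) x)\<^sup>2 \<partial>lebesgue) \<le> ennreal (1 / c) * (\<integral>\<^sup>+y. ennreal (u y) \<partial>lebesgue)\<^sup>2"
proof -
  have "(exp_conv c (\<lambda>y. ennreal (u y)) x)\<^sup>2 \<le> exp_conv (2 * c) (\<lambda>y. ennreal (u y)) x * (\<integral>\<^sup>+y. ennreal (u y) \<partial>lebesgue)" for x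
  proof -
    have sq: "ennreal (sqrt (u y)) * ennreal (sqrt (u y)) = ennreal (u y)" for y
      using nonneg by (simp flip: ennreal_mult)
    have ex: "ennreal (exp (- c * t)) * ennreal (exp (- c * t)) = ennreal (exp (- (2 * c) * t))" for t
      by (simp flip: exp_add ennreal_mult)
    have "(\<integral>\<^sup>+y. (ennreal (exp (- c * \<bar>x - y\<bar>)) * ennreal (sqrt (u y))) * ennreal (sqrt (u y)) \<partial>lebesgue)\<^sup>2
       \<le> (\<integral>\<^sup>+y. (ennreal (exp (- c * \<bar>x - y\<bar>)) * ennreal (sqrt (u y)))\<^sup>2 \<partial>lebesgue) * (\<integral>\<^sup>+y. (ennreal (sqrt (u y)))\<^sup>2 \<partial>lebesgue)"
      by (rule Cauchy_Schwarz_nn_integral) measurable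
    moreover have "(ennreal (exp (- c * \<bar>x - y\<bar>)) * ennreal (sqrt (u y)))\<^sup>2 = ennreal (exp (- (2 * c) * \<bar>x - y\<bar>)) * ennreal (u y)" for y
      unfolding ex[symmetric] sq[symmetric] power2_eq_square by (simp only: mult_ac)
    moreover have "(ennreal (sqrt (u y)))\<^sup>2 = ennreal (u y)" for y
      unfolding power2_eq_square by (rule sq)
    moreover have "(ennreal (exp (- c * \<bar>x - y\<bar>)) * ennreal (sqrt (u y))) * ennreal (sqrt (u y)) = ennreal (exp (- c * \<bar>x - y\<bar>)) * ennreal (u y)" for y
      unfolding mult.assoc sq ..
    ultimately show ?thesis unfolding exp_conv_def by (simp only:)
  qed
  then have "(\<integral>\<^sup>+x. (exp_conv c (\<lambda>y. ennreal (u y)) x)\<^sup>2 \<partial>lebesgue)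
      \<le> (\<integral>\<^sup>+x. exp_conv (2 * c) (\<lambda>y. ennreal (u y)) x * (\<integral>\<^sup>+y. ennreal (u y) \<partial>lebesgue) \<partial>lebesgue)"
    by (intro nn_integral_mono)
  also have "\<dots> = ennreal (1 / c) * (\<integral>\<^sup>+y. ennreal (u y) \<partial>lebesgue)\<^sup>2"
  proof -
    have "(\<integral>\<^sup>+x. exp_conv (2 * c) (\<lambda>y. ennreal (u y)) x \<partial>lebesgue) = ennreal (2 / (2 * c)) * (\<integral>\<^sup>+y. ennreal (u y) \<partial>lebesgue)"
      using \<open>c > 0\<close> by (intro nn_integral_exp_conv) auto
    then show ?thesis
      by (subst nn_integral_multc) (auto simp: power2_eq_square mult.assoc)
  qed
  finally show ?thesis .
qed

text \<open>A Schur test with weight u. It is meant for \<open>u\<^sup>2\<close> comparable to |V|,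
  which may be neither bounded nor integrable but has a bounded exponential convolution.\<close>

lemma nn_integral_exp_conv_square_L2:
  assumes [measurable]: "u \<in> borel_measurable lebesgue" "v \<in> borel_measurable lebesgue" and "c > 0"
    and L: "\<And>x. exp_conv c (\<lambda>y. (u y)\<^sup>2) x \<le> L"
  shows "(\<integral>\<^sup>+x. (exp_conv c (\<lambda>y. u y * v y) x)\<^sup>2 \<partial>lebesgue) \<le> L * ennreal (2 / c) * (\<integral>\<^sup>+y. (v y)\<^sup>2 \<partial>lebesgue)"
proof -
  have "(\<integral>\<^sup>+x. (exp_conv c (\<lambda>y. u y * v y) x)\<^sup>2 \<partial>lebesgue) \<le> (\<integral>\<^sup>+x. L * exp_conv c (\<lambda>y. (v y)\<^sup>2) x \<partial>lebesgue)"
    by (intro nn_integral_mono order_trans[OF exp_conv_Cauchy_Schwarz] mult_right_mono L) auto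
  also have "\<dots> = L * ennreal (2 / c) * (\<integral>\<^sup>+y. (v y)\<^sup>2 \<partial>lebesgue)"
    using \<open>c > 0\<close> by (simp add: nn_integral_cmult nn_integral_exp_conv mult.assoc)
  finally show ?thesis .
qed

text \<open>From \<open>H\<^sub>0\<^sup>2 - z\<^sup>2 = - d\<^sup>2/dx\<^sup>2 - k\<^sup>2\<close>
  the resolvent is \<open>H\<^sub>0 + z\<close> applied to the scalar Green function (i / 2k) exp(i
  k |x|); differentiating that function gives the entries with \<open>sgn\<close>.\<close>

definition dirac_kernel :: "real \<Rightarrow> complex \<Rightarrow> complex \<Rightarrow> real \<Rightarrow> complex^2^2" where
  "dirac_kernel m z k x = (let e = \<i> / 2 * exp (\<i> * k * of_real \<bar>x\<bar>) in
     vector [vector [e * ((z + of_real m) / k), e * of_real (sgn x)],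
             vector [e * of_real (sgn x), e * ((z - of_real m) / k)]])"

lemma dirac_kernel_nth:
  "dirac_kernel m z k x $1$1 = \<i> / 2 * exp (\<i> * k * of_real \<bar>x\<bar>) * ((z + of_real m) / k)"
  "dirac_kernel m z k x $1$2 = \<i> / 2 * exp (\<i> * k * of_real \<bar>x\<bar>) * of_real (sgn x)"
  "dirac_kernel m z k x $2$1 = \<i> / 2 * exp (\<i> * k * of_real \<bar>x\<bar>) * of_real (sgn x)"
  "dirac_kernel m z k x $2$2 = \<i> / 2 * exp (\<i> * k * of_real \<bar>x\<bar>) * ((z - of_real m) / k)"
  by (simp_all add: dirac_kernel_def Let_def)

lemma borel_measurable_dirac_kernel [measurable]: "dirac_kernel m z k \<in> borel_measurable borel"
proof (rule borel_measurable_matI)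
  fix i j :: 2
  show "(\<lambda>x. dirac_kernel m z k x $ i $ j) \<in> borel_measurable borel"
    using exhaust_2[of i] exhaust_2[of j] by (elim disjE; simp add: dirac_kernel_nth; measurable)
qed

lemma borel_measurable_dirac_kernel_pair [measurable]:
  "(\<lambda>p. dirac_kernel m z k (fst p - snd p)) \<in> borel_measurable (lebesgue \<Otimes>\<^sub>M lebesgue)"
  "(\<lambda>y. dirac_kernel m z k (x - y)) \<in> borel_measurable lebesgue"
proof -
  have "(\<lambda>p. fst p - snd p) \<in> borel_measurable (lebesgue \<Otimes>\<^sub>M lebesgue :: (real \<times> real) measure)"
    by (intro borel_measurable_diff borel_measurable_fst_lebesgue borel_measurable_snd_lebesgue)
  from measurable_compose[OF this borel_measurable_dirac_kernel]
  show "(\<lambda>p. dirac_kernel m z k (fst p - snd p)) \<in> borel_measurable (lebesgue \<Otimes>\<^sub>M lebesgue)" .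
  have "(\<lambda>y. x - y) \<in> borel_measurable borel" by measurable
  from measurable_compose[OF this borel_measurable_dirac_kernel]
  show "(\<lambda>y. dirac_kernel m z k (x - y)) \<in> borel_measurable lebesgue"
    by (intro measurable_completion) simp
qed

lemma ennreal_le_of_square_le: "E\<^sup>2 \<le> ennreal (B\<^sup>2) \<Longrightarrow> 0 \<le> B \<Longrightarrow> E \<le> ennreal B"
proof (cases E)
  case (real r)
  assume "E\<^sup>2 \<le> ennreal (B\<^sup>2)" "0 \<le> B"
  then have "r\<^sup>2 \<le> B\<^sup>2" using real by (simp add: ennreal_power)
  then show ?thesis using real \<open>0 \<le> B\<close> by (simp add: power2_le_iff_abs_le)
qed (simp add: power2_eq_square ennreal_top_mult top_unique)

lemma matrix_vector_mult_scaleR: "M *v (r *\<^sub>R v) = r *\<^sub>R (M *v v)" for M :: "complex^'n^'m"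
  by (simp add: vec_eq_iff matrix_vector_mult_def scaleR_right.sum)

text \<open>The root k is a parameter, rather than \<open>momentum m z\<close>, so that the same
  results can be instantiated at the conjugate point, where the adjoint kernel lives.\<close>

locale dirac_green =
  fixes m :: real and z k :: complex
  assumes k_square: "k\<^sup>2 = z\<^sup>2 - (of_real m)\<^sup>2" and k_pos: "Im k > 0"
begin

abbreviation "eta_z \<equiv> eta (norm (Phi m z))"
abbreviation "pot g \<equiv> exp_conv (Im k) (\<lambda>y. ennreal (norm (g y)))"

definition green :: "(real \<Rightarrow> complex^2) \<Rightarrow> real \<Rightarrow> complex^2" where
  "green g x = (LINT y|lebesgue. dirac_kernel m z k (x - y) *v g y)"

lemma k_nonzero: "k \<noteq> 0"
  using k_pos by auto

lemma k_square_factor: "k * k = (z + of_real m) * (z - of_real m)"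
  using k_square by (simp add: power2_eq_square algebra_simps)

lemma eta_z_square: "eta_z\<^sup>2 = 1 / 2 + 1 / 4 * (norm (Phi m z) + inverse (norm (Phi m z)))"
  and eta_z_pos: "eta_z > 0"
proof -
  have "1 / 2 + 1 / 4 * (norm (Phi m z) + inverse (norm (Phi m z))) > 0"
    by (intro add_pos_nonneg) auto
  then show "eta_z\<^sup>2 = 1 / 2 + 1 / 4 * (norm (Phi m z) + inverse (norm (Phi m z)))" "eta_z > 0"
    by (simp_all add: eta_def)
qed

text \<open>Origin of \<open>eta\<close>: with a = |z + m|, b = |z - m| and |k|^2 = a b, the squared
  entries sum to the exponential factor times 1/2 + (a/b + b/a)/4. For nonzero x the matrix has rank
  one, so the Frobenius norm equals the operator norm and nothing is lost.\<close>

lemma norm_dirac_kernel: "norm (dirac_kernel m z k x) \<le> eta_z * exp (- Im k * \<bar>x\<bar>)"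
proof -
  define a b where "a = norm (z + of_real m)" and "b = norm (z - of_real m)"
  have ab: "(norm k)\<^sup>2 = a * b"
    unfolding a_def b_def norm_mult[symmetric] k_square_factor[symmetric] by (simp add: norm_mult power2_eq_square)
  then have nz: "a \<noteq> 0" "b \<noteq> 0" using k_nonzero by auto
  have "(norm (dirac_kernel m z k x))\<^sup>2
      = (exp (- Im k * \<bar>x\<bar>) / 2)\<^sup>2 * (a\<^sup>2 / (norm k)\<^sup>2 + 2 * (sgn x)\<^sup>2 + b\<^sup>2 / (norm k)\<^sup>2)"
    unfolding norm_mat2 dirac_kernel_nth norm_mult norm_divide norm_exp_eq_Re a_def b_def
    by (simp add: power_mult_distrib power_divide) (simp add: algebra_simps, simp add: sgn_if)
  also have "\<dots> \<le> (exp (- Im k * \<bar>x\<bar>) / 2)\<^sup>2 * (a\<^sup>2 / (norm k)\<^sup>2 + 2 * 1 + b\<^sup>2 / (norm k)\<^sup>2)"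
  proof -
    have "(sgn x)\<^sup>2 \<le> 1" by (cases x "0::real" rule: linorder_cases) (simp_all add: sgn_real_def)
    then show ?thesis by (intro mult_left_mono add_mono order_refl) simp_all
  qed
  also have "\<dots> = (exp (- Im k * \<bar>x\<bar>))\<^sup>2 * (1 / 2 + 1 / 4 * (a / b + b / a))"
    unfolding ab using nz by (simp add: field_simps power2_eq_square)
  also have "\<dots> = (eta_z * exp (- Im k * \<bar>x\<bar>))\<^sup>2"
    unfolding power_mult_distrib eta_z_square by (simp add: Phi_def norm_divide a_def b_def mult.commute)
  finally show ?thesis
    by (rule power2_le_imp_le) (use eta_z_pos in auto)
qed

lemma nn_integral_kernel_le:
  "(\<integral>\<^sup>+y. ennreal (norm (dirac_kernel m z k (x - y) *v g y)) \<partial>lebesgue)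
    \<le> ennreal eta_z * pot g x"
  if [measurable]: "g \<in> borel_measurable lebesgue"
proof -
  have "(\<integral>\<^sup>+y. ennreal (norm (dirac_kernel m z k (x - y) *v g y)) \<partial>lebesgue)
      \<le> (\<integral>\<^sup>+y. ennreal eta_z * (ennreal (exp (- Im k * \<bar>x - y\<bar>)) * ennreal (norm (g y))) \<partial>lebesgue)"
  proof (rule nn_integral_mono)
    fix y
    have "norm (dirac_kernel m z k (x - y) *v g y) \<le> norm (dirac_kernel m z k (x - y)) * norm (g y)"
      by (rule norm_matrix_vector_mult)
    also have "\<dots> \<le> eta_z * exp (- Im k * \<bar>x - y\<bar>) * norm (g y)"
      by (intro mult_right_mono norm_dirac_kernel) auto
    finally have "ennreal (norm (dirac_kernel m z k (x - y) *v g y)) \<le> ennreal (eta_z * exp (- Im k * \<bar>x - y\<bar>) * norm (g y))"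
      by (rule ennreal_leI)
    then show "ennreal (norm (dirac_kernel m z k (x - y) *v g y))
        \<le> ennreal eta_z * (ennreal (exp (- Im k * \<bar>x - y\<bar>)) * ennreal (norm (g y)))"
      using eta_z_pos by (simp add: ennreal_mult mult.assoc)
  qed
  also have "\<dots> = ennreal eta_z * pot g x"
    unfolding exp_conv_def by (rule nn_integral_cmult) measurable
  finally show ?thesis .
qed

lemma green_integrable:
  assumes [measurable]: "g \<in> borel_measurable lebesgue"
    and fin: "pot g x < \<infinity>"
  shows "integrable lebesgue (\<lambda>y. dirac_kernel m z k (x - y) *v g y)"
proof (rule integrableI_bounded)
  show "(\<integral>\<^sup>+y. ennreal (norm (dirac_kernel m z k (x - y) *v g y)) \<partial>lebesgue) < \<infinity>"
    using fin by (intro order_le_less_trans[OF nn_integral_kernel_le])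
      (auto simp: ennreal_mult_less_top)
qed measurable

lemma norm_green_le:
  assumes [measurable]: "g \<in> borel_measurable lebesgue"
  shows "ennreal (norm (green g x)) \<le> ennreal eta_z * pot g x"
proof (cases "integrable lebesgue (\<lambda>y. dirac_kernel m z k (x - y) *v g y)")
  case True
  then have "ennreal (norm (green g x)) \<le> (\<integral>\<^sup>+y. ennreal (norm (dirac_kernel m z k (x - y) *v g y)) \<partial>lebesgue)"
    unfolding green_def by (rule integral_norm_bound_ennreal)
  also have "\<dots> \<le> ennreal eta_z * pot g x"
    by (rule nn_integral_kernel_le) measurable
  finally show ?thesis .
next
  case False
  then show ?thesis unfolding green_def by (simp add: not_integrable_integral_eq)
qed

lemma borel_measurable_kernel_vec [measurable]:
  assumes [measurable]: "g \<in> borel_measurable lebesgue"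
  shows "(\<lambda>p. dirac_kernel m z k (fst p - snd p) *v g (snd p)) \<in> borel_measurable (lebesgue \<Otimes>\<^sub>M lebesgue)"
  by measurable

lemma borel_measurable_green [measurable]:
  assumes [measurable]: "g \<in> borel_measurable lebesgue"
  shows "green g \<in> borel_measurable lebesgue"
  unfolding green_def
  by (rule lebesgue.borel_measurable_lebesgue_integral)
    (use borel_measurable_kernel_vec[OF assms] in \<open>simp add: case_prod_unfold\<close>)

lemma green_cong_AE: "(AE y in lebesgue. f y = g y) \<Longrightarrow> f \<in> borel_measurable lebesgue \<Longrightarrow>
    g \<in> borel_measurable lebesgue \<Longrightarrow> green f x = green g x"
  unfolding green_def by (intro integral_cong_AE) (auto elim: eventually_mono)

lemma green_add:
  assumes "f \<in> borel_measurable lebesgue" "pot f x < \<infinity>"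
    and "g \<in> borel_measurable lebesgue" "pot g x < \<infinity>"
  shows "green (\<lambda>y. f y + g y) x = green f x + green g x"
  unfolding green_def matrix_vector_right_distrib
  by (intro Bochner_Integration.integral_add green_integrable assms)

lemma green_scaleR: "green (\<lambda>y. r *\<^sub>R f y) x = r *\<^sub>R green f x"
  unfolding green_def by (simp add: matrix_vector_mult_scaleR)

lemma norm_green_L1:
  assumes "integrable lebesgue g"
  shows "pot g x < \<infinity>"
    and "norm (green g x) \<le> eta_z * (LINT y|lebesgue. norm (g y))"
proof -
  have eq: "(\<integral>\<^sup>+y. ennreal (norm (g y)) \<partial>lebesgue) = ennreal (LINT y|lebesgue. norm (g y))"
    by (rule nn_integral_eq_integral) (use assms in auto)
  have le: "pot g x \<le> ennreal (LINT y|lebesgue. norm (g y))"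
    unfolding eq[symmetric] using k_pos by (intro exp_conv_le_nn_integral) simp
  then show "pot g x < \<infinity>"
    by (simp add: order_le_less_trans[OF _ ennreal_less_top])
  have "ennreal (norm (green g x)) \<le> ennreal eta_z * ennreal (LINT y|lebesgue. norm (g y))"
    using assms by (intro order_trans[OF norm_green_le] mult_left_mono le) auto
  then show "norm (green g x) \<le> eta_z * (LINT y|lebesgue. norm (g y))"
    using eta_z_pos by (simp flip: ennreal_mult)
qed

lemma norm_green_L2:
  assumes g: "g \<in> L2_fun"
  shows "pot g x < \<infinity>"
    and "norm (green g x) \<le> eta_z / sqrt (Im k) * norm (abs_spinor g)"
proof -
  have [measurable]: "g \<in> borel_measurable lebesgue" using g by (simp add: L2_fun_def)
  have "(pot g x)\<^sup>2 \<le> ennreal (1 / Im k) * (\<integral>\<^sup>+y. (ennreal (norm (g y)))\<^sup>2 \<partial>lebesgue)"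
    by (rule exp_conv_square_le) (use k_pos in measurable)
  also have "\<dots> = ennreal ((norm (abs_spinor g) / sqrt (Im k))\<^sup>2)"
    using k_pos by (simp add: ennreal_power nn_integral_abs_spinor[OF g] power_divide flip: ennreal_mult)
  finally have le: "pot g x \<le> ennreal (norm (abs_spinor g) / sqrt (Im k))"
    by (rule ennreal_le_of_square_le) (use k_pos in simp)
  then show "pot g x < \<infinity>"
    by (simp add: order_le_less_trans[OF _ ennreal_less_top])
  have "ennreal (norm (green g x)) \<le> ennreal eta_z * ennreal (norm (abs_spinor g) / sqrt (Im k))"
    by (intro order_trans[OF norm_green_le] mult_left_mono le) auto
  then show "norm (green g x) \<le> eta_z / sqrt (Im k) * norm (abs_spinor g)"
    using eta_z_pos k_pos by (simp flip: ennreal_mult)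
qed

lemma green_L2_funI:
  assumes [measurable]: "g \<in> borel_measurable lebesgue" and "c \<ge> 0"
    and le: "(\<integral>\<^sup>+x. (pot g x)\<^sup>2 \<partial>lebesgue) \<le> ennreal (c\<^sup>2)"
  shows "green g \<in> L2_fun" "norm (abs_spinor (green g)) \<le> eta_z * c"
proof -
  have "(\<integral>\<^sup>+x. ennreal ((norm (green g x))\<^sup>2) \<partial>lebesgue)
      \<le> (\<integral>\<^sup>+x. ennreal (eta_z\<^sup>2) * (pot g x)\<^sup>2 \<partial>lebesgue)"
  proof (rule nn_integral_mono)
    fix x
    have "(ennreal (norm (green g x)))\<^sup>2 \<le> (ennreal eta_z * pot g x)\<^sup>2"
      by (intro power_mono norm_green_le) auto
    then show "ennreal ((norm (green g x))\<^sup>2) \<le> ennreal (eta_z\<^sup>2) * (pot g x)\<^sup>2"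
      using eta_z_pos by (simp add: ennreal_power power_mult_distrib)
  qed
  also have "\<dots> = ennreal (eta_z\<^sup>2) * (\<integral>\<^sup>+x. (pot g x)\<^sup>2 \<partial>lebesgue)"
    by (rule nn_integral_cmult) measurable
  also have "\<dots> \<le> ennreal (eta_z\<^sup>2) * ennreal (c\<^sup>2)"
    by (intro mult_left_mono le) auto
  also have "\<dots> = ennreal ((eta_z * c)\<^sup>2)"
    by (simp add: power_mult_distrib ennreal_mult)
  finally have "(\<integral>\<^sup>+x. ennreal ((norm (green g x))\<^sup>2) \<partial>lebesgue) \<le> ennreal ((eta_z * c)\<^sup>2)" .
  then show "green g \<in> L2_fun" "norm (abs_spinor (green g)) \<le> eta_z * c"
    using eta_z_pos \<open>c \<ge> 0\<close> by (auto intro!: L2_funI)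
qed

lemma green_L1_L2:
  assumes "integrable lebesgue g"
  shows "green g \<in> L2_fun" "norm (abs_spinor (green g)) \<le> eta_z / sqrt (Im k) * (LINT y|lebesgue. norm (g y))"
proof -
  have [measurable]: "g \<in> borel_measurable lebesgue" using assms by auto
  have eq: "(\<integral>\<^sup>+y. ennreal (norm (g y)) \<partial>lebesgue) = ennreal (LINT y|lebesgue. norm (g y))"
    by (rule nn_integral_eq_integral) (use assms in auto)
  have "(\<integral>\<^sup>+x. (pot g x)\<^sup>2 \<partial>lebesgue)
      \<le> ennreal (1 / Im k) * (\<integral>\<^sup>+y. ennreal (norm (g y)) \<partial>lebesgue)\<^sup>2"
    by (rule nn_integral_exp_conv_square_L1) (use k_pos in auto)
  also have "\<dots> = ennreal (((LINT y|lebesgue. norm (g y)) / sqrt (Im k))\<^sup>2)"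
    unfolding eq using k_pos by (simp add: ennreal_power power_divide flip: ennreal_mult)
  finally have le: "(\<integral>\<^sup>+x. (pot g x)\<^sup>2 \<partial>lebesgue)
      \<le> ennreal (((LINT y|lebesgue. norm (g y)) / sqrt (Im k))\<^sup>2)" .
  show "green g \<in> L2_fun"
    by (rule green_L2_funI(1)[OF _ _ le]) (use k_pos in auto)
  show "norm (abs_spinor (green g)) \<le> eta_z / sqrt (Im k) * (LINT y|lebesgue. norm (g y))"
    using green_L2_funI(2)[OF _ _ le] k_pos by auto
qed

text \<open>Prepared for \<open>G B\<close>: the weight \<open>\<beta>\<close> is a root of a
  multiple of |V|. The weighted Cauchy-Schwarz inequality gives the pointwise bound and the Schur
  test the bound in L^2.\<close>

lemma green_weighted:
  assumes g [measurable]: "g \<in> borel_measurable lebesgue" and f: "f \<in> L2_fun"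
    and [measurable]: "\<beta> \<in> borel_measurable lebesgue" and "L \<ge> 0"
    and le: "\<And>y. norm (g y) \<le> \<beta> y * norm (f y)" and nonneg: "\<And>y. \<beta> y \<ge> 0"
    and L: "\<And>x. exp_conv (Im k) (\<lambda>y. ennreal ((\<beta> y)\<^sup>2)) x \<le> ennreal L"
  shows "pot g x < \<infinity>"
    and "norm (green g x) \<le> eta_z * (sqrt L * norm (abs_spinor f))"
    and "green g \<in> L2_fun"
    and "norm (abs_spinor (green g)) \<le> eta_z * (sqrt (L * (2 / Im k)) * norm (abs_spinor f))"
proof -
  have [measurable]: "f \<in> borel_measurable lebesgue" using f by (simp add: L2_fun_def)
  have mono: "pot g x
      \<le> exp_conv (Im k) (\<lambda>y. ennreal (\<beta> y) * ennreal (norm (f y))) x" for x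
    by (rule exp_conv_mono) (use le nonneg in \<open>simp flip: ennreal_mult\<close>)
  have F: "(\<integral>\<^sup>+y. (ennreal (norm (f y)))\<^sup>2 \<partial>lebesgue) = ennreal ((norm (abs_spinor f))\<^sup>2)"
    by (simp add: ennreal_power nn_integral_abs_spinor[OF f])
  have L': "exp_conv (Im k) (\<lambda>y. (ennreal (\<beta> y))\<^sup>2) x \<le> ennreal L" for x
    using L[of x] nonneg by (simp add: ennreal_power)
  have le1: "pot g x \<le> ennreal (sqrt L * norm (abs_spinor f))" for x
  proof (rule ennreal_le_of_square_le)
    have "(pot g x)\<^sup>2
        \<le> (exp_conv (Im k) (\<lambda>y. ennreal (\<beta> y) * ennreal (norm (f y))) x)\<^sup>2"
      by (intro power_mono mono) auto
    also have "\<dots> \<le> exp_conv (Im k) (\<lambda>y. (ennreal (\<beta> y))\<^sup>2) x * exp_conv (Im k) (\<lambda>y. (ennreal (norm (f y)))\<^sup>2) x"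
      by (rule exp_conv_Cauchy_Schwarz) measurable
    also have "\<dots> \<le> ennreal L * (\<integral>\<^sup>+y. (ennreal (norm (f y)))\<^sup>2 \<partial>lebesgue)"
      using k_pos by (intro mult_mono L' exp_conv_le_nn_integral) auto
    also have "\<dots> = ennreal ((sqrt L * norm (abs_spinor f))\<^sup>2)"
      unfolding F using \<open>L \<ge> 0\<close> by (simp add: power_mult_distrib ennreal_mult)
    finally show "(pot g x)\<^sup>2 \<le> ennreal ((sqrt L * norm (abs_spinor f))\<^sup>2)" .
  qed (use \<open>L \<ge> 0\<close> in simp)
  from le1[of x] show "pot g x < \<infinity>"
    by (simp add: order_le_less_trans[OF _ ennreal_less_top])
  have "ennreal (norm (green g x)) \<le> ennreal eta_z * ennreal (sqrt L * norm (abs_spinor f))"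
    by (intro order_trans[OF norm_green_le] mult_left_mono le1) auto
  then show "norm (green g x) \<le> eta_z * (sqrt L * norm (abs_spinor f))"
    using eta_z_pos \<open>L \<ge> 0\<close> by (simp flip: ennreal_mult)
  have "(\<integral>\<^sup>+x. (pot g x)\<^sup>2 \<partial>lebesgue)
      \<le> (\<integral>\<^sup>+x. (exp_conv (Im k) (\<lambda>y. ennreal (\<beta> y) * ennreal (norm (f y))) x)\<^sup>2 \<partial>lebesgue)"
    by (intro nn_integral_mono power_mono mono) auto
  also have "\<dots> \<le> ennreal L * ennreal (2 / Im k) * (\<integral>\<^sup>+y. (ennreal (norm (f y)))\<^sup>2 \<partial>lebesgue)"
    by (rule nn_integral_exp_conv_square_L2) (use k_pos L' in auto)
  also have "\<dots> = ennreal ((sqrt (L * (2 / Im k)) * norm (abs_spinor f))\<^sup>2)"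
    unfolding F using \<open>L \<ge> 0\<close> k_pos by (simp add: power_mult_distrib flip: ennreal_mult)
  finally have le2: "(\<integral>\<^sup>+x. (pot g x)\<^sup>2 \<partial>lebesgue)
      \<le> ennreal ((sqrt (L * (2 / Im k)) * norm (abs_spinor f))\<^sup>2)" .
  show "green g \<in> L2_fun" "norm (abs_spinor (green g)) \<le> eta_z * (sqrt (L * (2 / Im k)) * norm (abs_spinor f))"
    by (rule green_L2_funI[OF g _ le2]; use \<open>L \<ge> 0\<close> k_pos in simp)+
qed

text \<open>The Schur test with weight 1. This constant is too large for the theorem; it serves to
  define \<open>green_op\<close>, and the sharp bound by the distance to the spectrum follows from
  symmetry.\<close>

lemma green_L2:
  assumes "f \<in> L2_fun"
  shows "green f \<in> L2_fun" "norm (abs_spinor (green f)) \<le> 2 * eta_z / Im k * norm (abs_spinor f)"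
proof -
  have m: "f \<in> borel_measurable lebesgue" using assms by (simp add: L2_fun_def)
  have "exp_conv (Im k) (\<lambda>y. ennreal (1\<^sup>2)) x \<le> ennreal (2 / Im k)" for x
    unfolding exp_conv_def using nn_integral_exp_abs(1)[OF k_pos, of x] by simp
  note * = green_weighted(3,4)[OF m assms _ _ _ _ this]
  show "green f \<in> L2_fun"
    by (rule *(1)) (use k_pos in auto)
  have "norm (abs_spinor (green f)) \<le> eta_z * (sqrt (2 / Im k * (2 / Im k)) * norm (abs_spinor f))"
    by (rule *(2)) (use k_pos in auto)
  then show "norm (abs_spinor (green f)) \<le> 2 * eta_z / Im k * norm (abs_spinor f)"
    using k_pos unfolding real_sqrt_abs2 by (simp add: mult_ac)
qed

definition green_op :: "spinor \<Rightarrow> spinor" where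
  "green_op f = abs_spinor (green (rep_spinor f))"

lemma rep_green_op: "AE x in lebesgue. rep_spinor (green_op f) x = green (rep_spinor f) x"
  unfolding green_op_def by (intro rep_abs_spinor green_L2 rep_spinor_L2)

end

section \<open>The free resolvent\<close>

lemma integrable_continuous_compact_support:
  fixes f :: "real \<Rightarrow> 'a::{banach, second_countable_topology}"
  assumes "continuous_on UNIV f" and "\<And>x. \<bar>x\<bar> > r \<Longrightarrow> f x = 0"
  shows "integrable lebesgue f"
proof -
  have "integrable lborel (\<lambda>x. indicator {-r..r} x *\<^sub>R f x)"
    by (rule borel_integrable_compact) (auto intro: continuous_on_subset[OF assms(1)])
  also have "(\<lambda>x. indicator {-r..r} x *\<^sub>R f x) = f"
    using assms(2) by (auto simp: fun_eq_iff indicator_def abs_le_iff not_le)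
  finally show ?thesis
    by (simp add: integrable_completion borel_measurable_integrable)
qed

lemma L2_fun_test:
  assumes "continuous_on UNIV (\<phi> :: real \<Rightarrow> real)" and "\<And>x. \<bar>x\<bar> > r \<Longrightarrow> \<phi> x = 0"
  shows "(\<lambda>x. \<phi> x *\<^sub>R u) \<in> L2_fun"
proof -
  have [measurable]: "\<phi> \<in> borel_measurable lebesgue"
      using assms(1) by (rule borel_measurable_lebesgue_continuous)
  have "integrable lebesgue (\<lambda>x. (norm (\<phi> x *\<^sub>R u))\<^sup>2)"
    by (rule integrable_continuous_compact_support[where r = r])
      (use assms in \<open>auto intro!: continuous_intros\<close>)
  then show ?thesis by (simp add: L2_fun_def)
qed

lemma test_derivative_continuous:
  fixes \<phi> \<phi>' :: "real \<Rightarrow> real"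
  assumes deriv: "\<And>x. (\<phi> has_real_derivative \<phi>' x) (at x)" and supp: "\<And>x. \<bar>x\<bar> > r \<Longrightarrow> \<phi> x = 0"
  shows "continuous_on A \<phi>" "\<And>x. \<bar>x\<bar> > r \<Longrightarrow> \<phi>' x = 0"
proof -
  show "continuous_on A \<phi>"
    by (rule DERIV_continuous_on[OF has_field_derivative_at_within[OF deriv]])
  show "\<phi>' y = 0" if "\<bar>y\<bar> > r" for y
  proof -
    have "open {y. \<bar>y\<bar> > r}" by (intro open_Collect_less continuous_intros)
    then have "\<forall>\<^sub>F w in nhds y. \<phi> w = 0"
      unfolding eventually_nhds using that supp by auto
    then have "((\<lambda>_. 0) has_real_derivative \<phi>' y) (at y)"
      using deriv[of y] by (subst (asm) DERIV_cong_ev[OF refl _ refl]) auto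
    then show ?thesis using DERIV_const DERIV_unique by blast
  qed
qed

lemma integral_FTC_lebesgue:
  fixes F :: "real \<Rightarrow> 'a::euclidean_space"
  assumes "a \<le> b" "\<And>x. a \<le> x \<Longrightarrow> x \<le> b \<Longrightarrow> (F has_vector_derivative f x) (at x within {a..b})"
    and "continuous_on {a..b} f"
  shows "(LINT x|lebesgue. indicator {a..b} x *\<^sub>R f x) = F b - F a"
    and "integrable lebesgue (\<lambda>x. indicator {a..b} x *\<^sub>R f x)"
proof -
  have b: "has_bochner_integral lborel (\<lambda>x. indicator {a..b} x *\<^sub>R f x) (F b - F a)"
    by (rule has_bochner_integral_FTC_Icc[OF assms])
  then have m: "(\<lambda>x. indicator {a..b} x *\<^sub>R f x) \<in> borel_measurable lborel"
    by (auto simp: has_bochner_integral_iff)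
  show "(LINT x|lebesgue. indicator {a..b} x *\<^sub>R f x) = F b - F a"
    "integrable lebesgue (\<lambda>x. indicator {a..b} x *\<^sub>R f x)"
    using b m by (auto simp: integral_completion integrable_completion has_bochner_integral_iff)
qed

lemma bounded_linear_smult_vec: "bounded_linear (\<lambda>c. c *s (w :: complex^'n))"
  by (rule bounded_linear_intro[where K = "norm w"])
    (auto simp: vec_eq_iff algebra_simps vec_norm_smult)

lemma inner_adjoint_mat: "(M *v v) \<bullet> w = v \<bullet> (adjoint_mat M *v w)"
  by (simp add: inner_vec_def sum_2 mat2_vec_nth adjoint_mat_def inner_complex_def algebra_simps)

lemma inner_cscale_vec: "(c *s v) \<bullet> w = v \<bullet> (cnj c *s w)" for v w :: "complex^2"
  by (simp add: inner_vec_def sum_2 inner_complex_def algebra_simps)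

lemma sigma_nth [simp]: "sigma1$1$1 = 0" "sigma1$1$2 = 1" "sigma1$2$1 = 1" "sigma1$2$2 = 0"
  "sigma3$1$1 = 1" "sigma3$1$2 = 0" "sigma3$2$1 = 0" "sigma3$2$2 = -1"
  by (simp_all add: sigma1_def sigma3_def)

section \<open>The kernel as an inverse on test functions, and its adjoint\<close>

context dirac_green
begin

definition side_vec :: "complex \<Rightarrow> complex^2 \<Rightarrow> complex^2" where
  "side_vec s u = vector [s * u$1 + (z + of_real m) / k * u$2, (z - of_real m) / k * u$1 + s * u$2]"

text \<open>Writing \<open>K(t) = (i/2) exp (i k s t) M\<^sub>s\<close> with \<open>s = sgn t\<close>, one has
  \<open>M\<^sub>s (m \<sigma>\<^sub>3 - z) = - k s M\<^sub>s \<sigma>\<^sub>1\<close>, so that the kernel applied to \<open>(H\<^sub>0 - z) \<phi>\<close> is a total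
  derivative; \<open>side_vec s\<close> is \<open>M\<^sub>s \<sigma>\<^sub>1\<close>.\<close>

lemma dirac_kernel_side:
  assumes "s * s = 1" "sgn t = s" "t \<noteq> 0"
  shows "dirac_kernel m z k t *v (p *\<^sub>R (- \<i> *s (sigma1 *v u)) + q *\<^sub>R (of_real m *s (sigma3 *v u) - z *s u))
    = ((of_real p - \<i> * k * of_real s * of_real q) * exp (\<i> * k * of_real s * of_real t)) *s ((1/2) *s side_vec (of_real s) u)"
proof -
  have t: "\<bar>t\<bar> = s * t" using assms by (auto simp: sgn_if split: if_splits)
  have e: "exp (\<i> * k * of_real \<bar>t\<bar>) = exp (\<i> * k * of_real s * of_real t)"
    unfolding t by (simp add: mult.assoc)
  have ss: "complex_of_real s * of_real s = 1" using assms(1) by (metis of_real_1 of_real_mult)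
  have kk: "(z + of_real m) * (z - of_real m) / k = k" using k_nonzero unfolding k_square_factor[symmetric] by simp
  define E a b where "E = exp (\<i> * k * of_real s * of_real t)" and "a = (z + of_real m) / k" and "b = (z - of_real m) / k"
  have ab: "z + of_real m = a * k" "z - of_real m = b * k" "a * b = 1"
    using k_nonzero kk by (simp_all add: a_def b_def)
  have m1: "of_real m * v - z * v = - (b * k * v)" "- (of_real m * v) - z * v = - (a * k * v)" for v
    unfolding ab(1,2)[symmetric] by (simp_all add: algebra_simps)
  have ii: "\<i> * (\<i> * v) = - v" for v by (simp flip: mult.assoc)
  have 1: "\<i> / 2 * E * a * (of_real p * (- \<i> * v) + of_real q * (- (b * k * w)))
      + \<i> / 2 * E * of_real s * (of_real p * (- \<i> * w) + of_real q * (- (a * k * v)))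
      = (of_real p - \<i> * k * of_real s * of_real q) * E * (1 / 2 * (of_real s * w + a * v))" for v w
  proof -
    \<comment> \<open>The two sides differ by multiples of
      \<open>a * b - of_real s * of_real s\<close> and of \<open>1 + \<i> * \<i>\<close>, both zero;
      adding these terms makes the claim a ring identity in free symbols.\<close>
    have "(of_real p - \<i> * k * of_real s * of_real q) * E * (1 / 2 * (of_real s * w + a * v))
      = \<i> / 2 * E * a * (of_real p * (- \<i> * v) + of_real q * (- (b * k * w)))
      + \<i> / 2 * E * of_real s * (of_real p * (- \<i> * w) + of_real q * (- (a * k * v)))
      + \<i> / 2 * E * of_real q * k * w * (a * b - of_real s * of_real s)
      + E / 2 * of_real p * (1 + \<i> * \<i>) * (a * v + of_real s * w)"
      by (simp only: minus_mult_left minus_mult_right) (simp add: field_simps del: i_squared)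
    then show ?thesis using ab(3) ss by simp
  qed
  have 2: "\<i> / 2 * E * of_real s * (of_real p * (- \<i> * v) + of_real q * (- (b * k * w)))
      + \<i> / 2 * E * b * (of_real p * (- \<i> * w) + of_real q * (- (a * k * v)))
      = (of_real p - \<i> * k * of_real s * of_real q) * E * (1 / 2 * (b * w + of_real s * v))" for v w
  proof -
    have "(of_real p - \<i> * k * of_real s * of_real q) * E * (1 / 2 * (b * w + of_real s * v))
      = \<i> / 2 * E * of_real s * (of_real p * (- \<i> * v) + of_real q * (- (b * k * w)))
      + \<i> / 2 * E * b * (of_real p * (- \<i> * w) + of_real q * (- (a * k * v)))
      + \<i> / 2 * E * of_real q * k * v * (a * b - of_real s * of_real s)
      + E / 2 * of_real p * (1 + \<i> * \<i>) * (b * w + of_real s * v)"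
      by (simp only: minus_mult_left minus_mult_right) (simp add: field_simps del: i_squared)
    then show ?thesis using ab(3) ss by simp
  qed
  show ?thesis
    unfolding vec2_eq_iff mat2_vec_nth dirac_kernel_nth e E_def[symmetric] a_def[symmetric] b_def[symmetric] assms(2) side_vec_def
    using 1[of "u$2" "u$1"] 2[of "u$2" "u$1"]
    by (simp add: scaleR_conv_of_real[where 'a = complex] mat2_vec_nth m1) (simp add: algebra_simps)
qed

text \<open>The argument of \<open>green\<close> is \<open>H\<^sub>0 - z\<close> applied to
  \<open>\<phi>\<close> times u. Integrating the derivative on either side of x leaves boundary
  terms at x only, and half the difference of \<open>side_vec 1 u\<close> and
  \<open>side_vec (- 1) u\<close> is u: the jump of the kernel.\<close>

lemma green_test:
  fixes \<phi> \<phi>' :: "real \<Rightarrow> real"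
  assumes deriv: "\<And>x. (\<phi> has_real_derivative \<phi>' x) (at x)" and cont: "continuous_on UNIV \<phi>'"
    and supp: "\<And>x. \<bar>x\<bar> > r \<Longrightarrow> \<phi> x = 0"
  shows "green (\<lambda>y. \<phi>' y *\<^sub>R (- \<i> *s (sigma1 *v u)) + \<phi> y *\<^sub>R (of_real m *s (sigma3 *v u) - z *s u)) x = \<phi> x *\<^sub>R u"
    (is "green ?g x = _")
proof -
  define R where "R = \<bar>r\<bar> + \<bar>x\<bar> + 1"
  have cont\<phi>: "continuous_on A \<phi>" and \<phi>'0: "\<bar>y\<bar> > r \<Longrightarrow> \<phi>' y = 0" for A y
    using test_derivative_continuous[of \<phi> \<phi>' r] deriv supp by auto
  have cont': "continuous_on A \<phi>'" for A using cont by (rule continuous_on_subset) simp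
  define F where "F s y = (of_real (\<phi> y) * exp (\<i> * k * of_real s * of_real (x - y))) *s ((1/2) *s side_vec (of_real s) u)" for s y
  define f where "f s y = ((of_real (\<phi>' y) - \<i> * k * of_real s * of_real (\<phi> y)) * exp (\<i> * k * of_real s * of_real (x - y))) *s ((1/2) *s side_vec (of_real s) u)" for s y
  have F: "(F s has_vector_derivative f s y) (at y within A)" for s y A
  proof -
    have "((\<lambda>y. complex_of_real (\<phi> y)) has_vector_derivative of_real (\<phi>' y)) (at y within A)"
      by (rule has_vector_derivative_at_within[OF has_vector_derivative_of_real[OF deriv]])
    moreover have "((\<lambda>y. exp (\<i> * k * of_real s * of_real (x - y))) has_vector_derivative
        - (\<i> * k * of_real s) * exp (\<i> * k * of_real s * of_real (x - y))) (at y within A)"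
    proof -
      have "((\<lambda>w. exp (\<i> * k * of_real s * (of_real x - w))) has_field_derivative
          - (\<i> * k * of_real s) * exp (\<i> * k * of_real s * (of_real x - of_real y))) (at (of_real y))"
        by (auto intro!: derivative_eq_intros)
      from has_vector_derivative_real_field[OF this] show ?thesis
        by (simp add: o_def)
    qed
    ultimately have "((\<lambda>y. of_real (\<phi> y) * exp (\<i> * k * of_real s * of_real (x - y))) has_vector_derivative
        of_real (\<phi> y) * (- (\<i> * k * of_real s) * exp (\<i> * k * of_real s * of_real (x - y)))
        + of_real (\<phi>' y) * exp (\<i> * k * of_real s * of_real (x - y))) (at y within A)"
      by (rule has_vector_derivative_mult)
    also have "of_real (\<phi> y) * (- (\<i> * k * of_real s) * exp (\<i> * k * of_real s * of_real (x - y)))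
        + of_real (\<phi>' y) * exp (\<i> * k * of_real s * of_real (x - y))
      = (of_real (\<phi>' y) - \<i> * k * of_real s * of_real (\<phi> y)) * exp (\<i> * k * of_real s * of_real (x - y))"
      by (simp add: algebra_simps)
    finally show ?thesis
      unfolding F_def f_def by (rule bounded_linear.has_vector_derivative[OF bounded_linear_smult_vec])
  qed
  have f: "continuous_on A (f s)" for s A
    unfolding f_def
    by (intro bounded_linear.continuous_on[OF bounded_linear_smult_vec] continuous_intros cont\<phi> cont')
  have le: "- R \<le> x" "x \<le> R" by (auto simp: R_def)
  have "green ?g x = (LINT y|lebesgue. indicator {-R..x} y *\<^sub>R f 1 y + indicator {x..R} y *\<^sub>R f (-1) y)"
    unfolding green_def
  proof (rule integral_cong_AE)
    show "AE y in lebesgue. dirac_kernel m z k (x - y) *v ?g y = indicator {-R..x} y *\<^sub>R f 1 y + indicator {x..R} y *\<^sub>R f (-1) y"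
    proof -
      \<comment> \<open>The two indicators overlap at y = x, where the kernel also has a different
        value.\<close>
      have "AE y in lebesgue. y \<noteq> x"
        by (rule AE_completion) (rule AE_lborel_singleton)
      then show ?thesis
      proof eventually_elim
        fix y assume "y \<noteq> x"
        then consider "y < - R" | "- R \<le> y" "y < x" | "x < y" "y \<le> R" | "R < y" by linarith
        then show "dirac_kernel m z k (x - y) *v ?g y = indicator {-R..x} y *\<^sub>R f 1 y + indicator {x..R} y *\<^sub>R f (-1) y"
        proof cases
          case 1
          then have "\<bar>y\<bar> > r" by (auto simp: R_def)
          then show ?thesis using 1 le by (simp add: \<phi>'0 supp)
        next
          case 2
          then show ?thesis using dirac_kernel_side[of 1 "x - y"] le by (simp add: f_def)
        next
          case 3
          then show ?thesis using dirac_kernel_side[of "-1" "x - y"] le by (simp add: f_def)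
        next
          case 4
          then have "\<bar>y\<bar> > r" by (auto simp: R_def)
          then show ?thesis using 4 le by (simp add: \<phi>'0 supp)
        qed
      qed
    qed
    have "?g \<in> borel_measurable borel"
      by (intro borel_measurable_continuous_onI continuous_intros cont\<phi> cont')
    then have [measurable]: "?g \<in> borel_measurable lebesgue" by (intro measurable_completion) simp
    show "(\<lambda>y. dirac_kernel m z k (x - y) *v ?g y) \<in> borel_measurable lebesgue"
      by measurable
    show "(\<lambda>y. indicator {-R..x} y *\<^sub>R f 1 y + indicator {x..R} y *\<^sub>R f (-1) y) \<in> borel_measurable lebesgue"
      using integral_FTC_lebesgue(2)[OF le(1) F f] integral_FTC_lebesgue(2)[OF le(2) F f]
      by (intro borel_measurable_add) auto
  qed
  also have "\<dots> = (F 1 x - F 1 (- R)) + (F (- 1) R - F (- 1) x)"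
    using integral_FTC_lebesgue[OF le(1) F f, of 1] integral_FTC_lebesgue[OF le(2) F f, of "-1"]
    by (subst Bochner_Integration.integral_add) auto
  also have "\<dots> = \<phi> x *\<^sub>R u"
  proof -
    have "\<phi> R = 0" "\<phi> (- R) = 0" by (auto intro!: supp simp: R_def)
    then show ?thesis
      by (simp add: F_def vec2_eq_iff side_vec_def scaleR_conv_of_real[where 'a = complex] field_simps)
  qed
  finally show ?thesis .
qed

text \<open>Conjugation moves k to the lower half-plane, and the minus sign brings it back to the
  required branch.\<close>

lemma dirac_green_cnj: "dirac_green m (cnj z) (- cnj k)"
proof
  show "(- cnj k)\<^sup>2 = (cnj z)\<^sup>2 - (complex_of_real m)\<^sup>2"
    using arg_cong[OF k_square, of cnj] by simp
  show "0 < Im (- cnj k)" using k_pos by simp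
qed

abbreviation "green_adj \<equiv> dirac_green.green m (cnj z) (- cnj k)"

lemma adjoint_dirac_kernel: "adjoint_mat (dirac_kernel m z k t) = dirac_kernel m (cnj z) (- cnj k) (- t)"
  by (simp add: mat2_eq_iff adjoint_mat_def dirac_kernel_nth exp_cnj sgn_minus)

text \<open>Fubini. The double integral converges absolutely because the convolution majorant E of f
  is in L^2 and can be paired with |p|.\<close>

lemma green_adjoint:
  assumes f: "f \<in> L2_fun" and p: "p \<in> L2_fun"
  shows "(LINT x|lebesgue. green f x \<bullet> p x) = (LINT y|lebesgue. f y \<bullet> green_adj p y)"
proof -
  interpret adj: dirac_green m "cnj z" "- cnj k" by (rule dirac_green_cnj)
  have [measurable]: "f \<in> borel_measurable lebesgue" "p \<in> borel_measurable lebesgue"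
    using f p by (auto simp: L2_fun_def)
  define q where "q = (\<lambda>x y. (dirac_kernel m z k (x - y) *v f y) \<bullet> p x)"
  have m: "case_prod q \<in> borel_measurable (lebesgue \<Otimes>\<^sub>M lebesgue)"
    unfolding q_def case_prod_unfold by measurable
  define E where "E = pot f"
  have [measurable]: "E \<in> borel_measurable lebesgue" unfolding E_def by measurable
  have E2: "(\<integral>\<^sup>+x. (E x)\<^sup>2 \<partial>lebesgue) < \<infinity>"
  proof -
    have "exp_conv (Im k) (\<lambda>y. (1 :: ennreal)\<^sup>2) x \<le> ennreal (2 / Im k)" for x
      unfolding exp_conv_def using nn_integral_exp_abs(1)[OF k_pos, of x] by simp
    then have "(\<integral>\<^sup>+x. (exp_conv (Im k) (\<lambda>y. 1 * ennreal (norm (f y))) x)\<^sup>2 \<partial>lebesgue)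
        \<le> ennreal (2 / Im k) * ennreal (2 / Im k) * (\<integral>\<^sup>+y. (ennreal (norm (f y)))\<^sup>2 \<partial>lebesgue)"
      by (intro nn_integral_exp_conv_square_L2) (use k_pos in auto)
    also have "\<dots> < \<infinity>"
      by (simp add: ennreal_power nn_integral_abs_spinor[OF f] ennreal_mult_less_top)
    finally show ?thesis by (simp add: E_def)
  qed
  have "(\<integral>\<^sup>+x. ennreal (norm (p x)) * E x \<partial>lebesgue)\<^sup>2
      \<le> (\<integral>\<^sup>+x. (ennreal (norm (p x)))\<^sup>2 \<partial>lebesgue) * (\<integral>\<^sup>+x. (E x)\<^sup>2 \<partial>lebesgue)"
    by (rule Cauchy_Schwarz_nn_integral) measurable
  also have "\<dots> < \<infinity>"
    using E2 by (simp add: ennreal_power nn_integral_abs_spinor[OF p] ennreal_mult_less_top)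
  finally have fin: "(\<integral>\<^sup>+x. ennreal (norm (p x)) * E x \<partial>lebesgue) < \<infinity>"
    by (simp add: power_less_top_ennreal)
  have "(\<integral>\<^sup>+w. ennreal (norm (case_prod q w)) \<partial>(lebesgue \<Otimes>\<^sub>M lebesgue))
      = (\<integral>\<^sup>+x. \<integral>\<^sup>+y. ennreal (norm (q x y)) \<partial>lebesgue \<partial>lebesgue)"
    using m by (subst lebesgue.nn_integral_fst[symmetric]) auto
  also have "\<dots> \<le> (\<integral>\<^sup>+x. ennreal eta_z * (ennreal (norm (p x)) * E x) \<partial>lebesgue)"
  proof (rule nn_integral_mono)
    fix x
    have "(\<integral>\<^sup>+y. ennreal (norm (q x y)) \<partial>lebesgue)
        \<le> (\<integral>\<^sup>+y. ennreal (norm (p x)) * ennreal (norm (dirac_kernel m z k (x - y) *v f y)) \<partial>lebesgue)"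
    proof (rule nn_integral_mono)
      fix y
      have "norm (q x y) \<le> norm (p x) * norm (dirac_kernel m z k (x - y) *v f y)"
        unfolding q_def using Cauchy_Schwarz_ineq2[of "dirac_kernel m z k (x - y) *v f y" "p x"]
        by (simp add: mult.commute)
      then show "ennreal (norm (q x y)) \<le> ennreal (norm (p x)) * ennreal (norm (dirac_kernel m z k (x - y) *v f y))"
        by (simp flip: ennreal_mult)
    qed
    also have "\<dots> = ennreal (norm (p x)) * (\<integral>\<^sup>+y. ennreal (norm (dirac_kernel m z k (x - y) *v f y)) \<partial>lebesgue)"
      by (rule nn_integral_cmult) measurable
    also have "\<dots> \<le> ennreal (norm (p x)) * (ennreal eta_z * E x)"
      unfolding E_def by (intro mult_left_mono nn_integral_kernel_le) auto
    finally show "(\<integral>\<^sup>+y. ennreal (norm (q x y)) \<partial>lebesgue) \<le> ennreal eta_z * (ennreal (norm (p x)) * E x)"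
      by (simp add: mult_ac)
  qed
  also have "\<dots> = ennreal eta_z * (\<integral>\<^sup>+x. ennreal (norm (p x)) * E x \<partial>lebesgue)"
    by (rule nn_integral_cmult) measurable
  also have "\<dots> < \<infinity>" using fin by (simp add: ennreal_mult_less_top)
  finally have "integrable (lebesgue \<Otimes>\<^sub>M lebesgue) (case_prod q)"
    by (intro integrableI_bounded m)
  then have "(LINT y|lebesgue. LINT x|lebesgue. q x y) = (LINT x|lebesgue. LINT y|lebesgue. q x y)"
    by (rule lebesgue_pair.Fubini_integral)
  moreover have "(LINT y|lebesgue. q x y) = green f x \<bullet> p x" for x
    unfolding q_def green_def
    by (rule integral_inner_left) (rule green_integrable[OF _ norm_green_L2(1)[OF f]], measurable)
  moreover have "(LINT x|lebesgue. q x y) = f y \<bullet> green_adj p y" for y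
  proof -
    have "q x y = f y \<bullet> (dirac_kernel m (cnj z) (- cnj k) (y - x) *v p x)" for x
      by (simp add: q_def inner_adjoint_mat adjoint_dirac_kernel)
    then show ?thesis
      unfolding adj.green_def
      by (simp only:) (rule integral_inner_right, rule adj.green_integrable[OF _ adj.norm_green_L2(1)[OF p]], measurable)
  qed
  ultimately show ?thesis by simp
qed

end

section \<open>Pointwise linear maps and weak derivatives\<close>

lemma L2_fun_bounded_linear:
  assumes L: "bounded_linear L" and f: "f \<in> L2_fun"
  shows "(\<lambda>x. L (f x)) \<in> L2_fun"
proof -
  have m: "f \<in> borel_measurable lebesgue" using f by (simp add: L2_fun_def)
  obtain K where K: "K > 0" "\<And>v. norm (L v) \<le> norm v * K" using bounded_linear.pos_bounded[OF L] by auto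
  show ?thesis
  proof (rule L2_fun_dominated(1)[OF f, where c = K])
    show "(\<lambda>x. L (f x)) \<in> borel_measurable lebesgue"
      by (rule measurable_compose[OF m borel_measurable_continuous_onI[OF linear_continuous_on[OF L]]])
  qed (use K in \<open>auto simp: mult.commute\<close>)
qed

text \<open>L is applied to spinor values and need only be real-linear, so that complex conjugation
  is covered along with constant matrices.\<close>

definition pointwise_op :: "(complex^2 \<Rightarrow> complex^2) \<Rightarrow> spinor \<Rightarrow> spinor" where
  "pointwise_op L f = abs_spinor (\<lambda>x. L (rep_spinor f x))"

lemma rep_pointwise_op:
  "bounded_linear L \<Longrightarrow> AE x in lebesgue. rep_spinor (pointwise_op L f) x = L (rep_spinor f x)"
  unfolding pointwise_op_def by (rule rep_abs_spinor[OF L2_fun_bounded_linear[OF _ rep_spinor_L2]])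

lemma integrable_test_rep:
  assumes "continuous_on UNIV (\<phi> :: real \<Rightarrow> real)" and "\<And>x. \<bar>x\<bar> > r \<Longrightarrow> \<phi> x = 0"
  shows "integrable lebesgue (\<lambda>x. \<phi> x *\<^sub>R rep_spinor f x)"
proof -
  have [measurable]: "\<phi> \<in> borel_measurable lebesgue"
      using assms(1) by (rule borel_measurable_lebesgue_continuous)
  have "integrable lebesgue (\<lambda>x. (\<phi> x)\<^sup>2)"
    by (rule integrable_continuous_compact_support[where r = r])
      (use assms in \<open>auto intro!: continuous_intros\<close>)
  then have "integrable lebesgue (\<lambda>x. (\<phi> x)\<^sup>2 + (norm (rep_spinor f x))\<^sup>2)"
    using integrable_rep_spinor by (rule Bochner_Integration.integrable_add)
  then show ?thesis
  proof (rule Bochner_Integration.integrable_bound)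
    have "\<bar>a\<bar> * b \<le> a\<^sup>2 + b\<^sup>2" for a b :: real
    proof -
      have "0 \<le> a\<^sup>2 + b\<^sup>2" by simp
      then show ?thesis using sum_squares_bound[of "\<bar>a\<bar>" b] unfolding power2_abs by linarith
    qed
    then show "AE x in lebesgue. norm (\<phi> x *\<^sub>R rep_spinor f x) \<le> norm ((\<phi> x)\<^sup>2 + (norm (rep_spinor f x))\<^sup>2)"
      by simp
  qed measurable
qed

lemma has_weak_derivI:
  assumes "\<And>\<phi> \<phi>' r. (\<And>x. (\<phi> has_real_derivative \<phi>' x) (at x)) \<Longrightarrow> continuous_on UNIV \<phi> \<Longrightarrow> continuous_on UNIV \<phi>'
      \<Longrightarrow> (\<And>x. r < \<bar>x\<bar> \<Longrightarrow> \<phi> x = 0) \<Longrightarrow> (\<And>x. r < \<bar>x\<bar> \<Longrightarrow> \<phi>' x = 0)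
      \<Longrightarrow> (LINT x|lebesgue. \<phi>' x *\<^sub>R rep_spinor f x) = - (LINT x|lebesgue. \<phi> x *\<^sub>R rep_spinor g x)"
  shows "has_weak_deriv f g"
  unfolding has_weak_deriv_def
proof (intro allI impI, elim exE)
  fix \<phi> \<phi>' :: "real \<Rightarrow> real" and r
  assume t: "\<forall>x. (\<phi> has_real_derivative \<phi>' x) (at x)" "continuous_on UNIV \<phi>'" "\<forall>x. r < \<bar>x\<bar> \<longrightarrow> \<phi> x = 0"
  have "continuous_on UNIV \<phi>" "\<And>x. r < \<bar>x\<bar> \<Longrightarrow> \<phi>' x = 0"
    using test_derivative_continuous[of \<phi> \<phi>' r] t by auto
  then show "(LINT x|lebesgue. \<phi>' x *\<^sub>R rep_spinor f x) = - (LINT x|lebesgue. \<phi> x *\<^sub>R rep_spinor g x)"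
    using t by (intro assms[of \<phi> \<phi>' r]) auto
qed

lemma has_weak_deriv_pointwise_op:
  assumes L: "bounded_linear L" and d: "has_weak_deriv f f'"
  shows "has_weak_deriv (pointwise_op L f) (pointwise_op L f')"
proof (rule has_weak_derivI)
  fix \<phi> \<phi>' :: "real \<Rightarrow> real" and r
  assume t: "\<And>x. (\<phi> has_real_derivative \<phi>' x) (at x)" and c: "continuous_on UNIV \<phi>" "continuous_on UNIV \<phi>'"
    and r: "\<And>x. r < \<bar>x\<bar> \<Longrightarrow> \<phi> x = 0" "\<And>x. r < \<bar>x\<bar> \<Longrightarrow> \<phi>' x = 0"
  interpret L: bounded_linear L by fact
  have *: "(LINT x|lebesgue. \<psi> x *\<^sub>R rep_spinor (pointwise_op L g) x) = L (LINT x|lebesgue. \<psi> x *\<^sub>R rep_spinor g x)"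
    if "continuous_on UNIV \<psi>" "\<And>x. \<bar>x\<bar> > r \<Longrightarrow> \<psi> x = 0" for \<psi> g
  proof -
    have [measurable]: "\<psi> \<in> borel_measurable lebesgue"
      using that(1) by (rule borel_measurable_lebesgue_continuous)
    have "L (LINT x|lebesgue. \<psi> x *\<^sub>R rep_spinor g x) = (LINT x|lebesgue. L (\<psi> x *\<^sub>R rep_spinor g x))"
      by (rule integral_bounded_linear[OF L, symmetric]) (rule integrable_test_rep[OF that])
    also have "\<dots> = (LINT x|lebesgue. \<psi> x *\<^sub>R rep_spinor (pointwise_op L g) x)"
    proof (rule integral_cong_AE)
      show "AE x in lebesgue. L (\<psi> x *\<^sub>R rep_spinor g x) = \<psi> x *\<^sub>R rep_spinor (pointwise_op L g) x"
        using rep_pointwise_op[OF L, of g] by eventually_elim (simp add: L.scaleR)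
      show "(\<lambda>x. L (\<psi> x *\<^sub>R rep_spinor g x)) \<in> borel_measurable lebesgue"
        by (rule measurable_compose[OF _ borel_measurable_continuous_onI[OF linear_continuous_on[OF L]]]) measurable
    qed measurable
    finally show ?thesis by simp
  qed
  have "(LINT x|lebesgue. \<phi>' x *\<^sub>R rep_spinor f x) = - (LINT x|lebesgue. \<phi> x *\<^sub>R rep_spinor f' x)"
    using d[unfolded has_weak_deriv_def, rule_format, of \<phi> \<phi>'] t c r by blast
  then show "(LINT x|lebesgue. \<phi>' x *\<^sub>R rep_spinor (pointwise_op L f) x)
      = - (LINT x|lebesgue. \<phi> x *\<^sub>R rep_spinor (pointwise_op L f') x)"
    using *[OF c(2) r(2)] *[OF c(1) r(1)] by (simp add: L.neg)
qed

lemma bounded_linear_matrix_vector: "bounded_linear (\<lambda>v. M *v v)" for M :: "complex^'n^'m"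
  by (rule bounded_linear_intro[where K = "norm M"])
    (auto simp: matrix_vector_right_distrib matrix_vector_mult_scaleR norm_matrix_vector_mult mult.commute[of _ "norm M"])

lemma bounded_linear_smult_right: "bounded_linear (\<lambda>v. c *s v)" for c :: complex
  by (rule bounded_linear_intro[where K = "norm c"])
    (auto simp: vec_eq_iff algebra_simps vec_norm_smult)

lemma bounded_linear_sigma:
  "bounded_linear (\<lambda>v. \<i> *s (sigma1 *v v))" "bounded_linear (\<lambda>v. of_real m *s (sigma3 *v v))"
  by (rule bounded_linear_compose[OF bounded_linear_smult_right bounded_linear_matrix_vector])+

text \<open>The equation for \<open>H\<^sub>0 h = g\<close> solved for the derivative, using that i
  times \<open>sigma1\<close> inverts -i times \<open>sigma1\<close>.\<close>

lemma free_diracI: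
  assumes "has_weak_deriv h (pointwise_op (\<lambda>v. \<i> *s (sigma1 *v v)) (g - pointwise_op (\<lambda>v. of_real m *s (sigma3 *v v)) h))"
  shows "(h, g) \<in> free_dirac m"
proof -
  let ?w = "g - pointwise_op (\<lambda>v. of_real m *s (sigma3 *v v)) h"
  have "AE x in lebesgue. rep_spinor g x = - \<i> *s (sigma1 *v rep_spinor (pointwise_op (\<lambda>v. \<i> *s (sigma1 *v v)) ?w) x)
      + of_real m *s (sigma3 *v rep_spinor h x)"
    using rep_pointwise_op[OF bounded_linear_sigma(1), of ?w] rep_pointwise_op[OF bounded_linear_sigma(2), of m h]
      rep_spinor_diff[of g "pointwise_op (\<lambda>v. of_real m *s (sigma3 *v v)) h"]
  proof eventually_elim
    case (elim x)
    have "- \<i> *s (sigma1 *v (\<i> *s (sigma1 *v w))) = w" for w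
      by (simp add: vec2_eq_iff mat2_vec_nth flip: mult.assoc)
    with elim show ?case by simp
  qed
  then show ?thesis unfolding free_dirac_def using assms by blast
qed

context dirac_green
begin

text \<open>The discontinuous kernel is never differentiated. Paired with a vector u, the weak
  derivative identity is moved by \<open>green_adjoint\<close> onto the test function, where
  \<open>green_test\<close> at the conjugate point evaluates it.\<close>

lemma green_op_free_dirac: "(green_op f, f + cscale z (green_op f)) \<in> free_dirac m"
proof (rule free_diracI)
  interpret adj: dirac_green m "cnj z" "- cnj k" by (rule dirac_green_cnj)
  define h where "h = green_op f"
  let ?L1 = "\<lambda>v. \<i> *s (sigma1 *v v)" and ?L3 = "\<lambda>v. of_real m *s (sigma3 *v v)"
  define h' where "h' = pointwise_op ?L1 ((f + cscale z h) - pointwise_op ?L3 h)"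
  have reph: "AE x in lebesgue. rep_spinor h x = green (rep_spinor f) x"
    unfolding h_def by (rule rep_green_op)
  have reph': "AE x in lebesgue. rep_spinor h' x = ?L1 (rep_spinor f x + z *s green (rep_spinor f) x - ?L3 (green (rep_spinor f) x))"
    using rep_pointwise_op[OF bounded_linear_sigma(1), of "(f + cscale z h) - pointwise_op ?L3 h"]
      rep_pointwise_op[OF bounded_linear_sigma(2), of m h] rep_spinor_plus[of f "cscale z h"]
      rep_spinor_cscale[of z h] rep_spinor_diff[of "f + cscale z h" "pointwise_op ?L3 h"] reph
    unfolding h'_def by eventually_elim simp
  have "has_weak_deriv h h'"
  proof (rule has_weak_derivI)
    fix \<phi> \<phi>' :: "real \<Rightarrow> real" and r
    assume t: "\<And>x. (\<phi> has_real_derivative \<phi>' x) (at x)" and c: "continuous_on UNIV \<phi>" "continuous_on UNIV \<phi>'"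
      and r: "\<And>x. r < \<bar>x\<bar> \<Longrightarrow> \<phi> x = 0" "\<And>x. r < \<bar>x\<bar> \<Longrightarrow> \<phi>' x = 0"
    have "(LINT x|lebesgue. \<phi>' x *\<^sub>R rep_spinor h x) \<bullet> u = - (LINT x|lebesgue. \<phi> x *\<^sub>R rep_spinor h' x) \<bullet> u" for u
    proof -
      \<comment> \<open>With this choice \<open>\<phi>' u\<close> is the derivative part of
        \<open>H\<^sub>0\<close> applied to \<open>\<phi> u'\<close>. The vector w below supplies
        the remaining part of \<open>H\<^sub>0 - cnj z\<close>.\<close>
      define u' where "u' = ?L1 u"
      have u: "u = - \<i> *s (sigma1 *v u')"
        by (simp add: u'_def vec2_eq_iff mat2_vec_nth flip: mult.assoc)
      define w where "w = ?L3 u' - cnj z *s u'"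
      have L2: "(\<lambda>x. \<phi>' x *\<^sub>R u) \<in> L2_fun" "(\<lambda>x. \<phi> x *\<^sub>R u') \<in> L2_fun" "(\<lambda>x. \<phi> x *\<^sub>R w) \<in> L2_fun"
        using L2_fun_test[OF c(2), of r] L2_fun_test[OF c(1), of r] r by auto
      have m [measurable]: "(\<lambda>x. \<phi>' x *\<^sub>R u) \<in> borel_measurable lebesgue" "(\<lambda>x. \<phi> x *\<^sub>R u') \<in> borel_measurable lebesgue"
        "(\<lambda>x. \<phi> x *\<^sub>R w) \<in> borel_measurable lebesgue"
        using L2 by (auto simp: L2_fun_def)
      have \<phi>m: "\<phi> \<in> borel_measurable borel" using c(1) by (rule borel_measurable_continuous_onI)
      then have [measurable]: "\<phi> \<in> borel_measurable lebesgue" by (intro measurable_completion) simp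
      have [measurable]: "\<phi>' \<in> borel_measurable lebesgue"
      using c(2) by (rule borel_measurable_lebesgue_continuous)
      have 1: "(LINT x|lebesgue. \<phi>' x *\<^sub>R rep_spinor h x) \<bullet> u = (LINT x|lebesgue. rep_spinor f x \<bullet> green_adj (\<lambda>x. \<phi>' x *\<^sub>R u) x)"
      proof -
        have "(LINT x|lebesgue. \<phi>' x *\<^sub>R rep_spinor h x) \<bullet> u = (LINT x|lebesgue. (\<phi>' x *\<^sub>R rep_spinor h x) \<bullet> u)"
          by (rule integral_inner_left[symmetric]) (rule integrable_test_rep[OF c(2) r(2)])
        also have "\<dots> = (LINT x|lebesgue. green (rep_spinor f) x \<bullet> (\<phi>' x *\<^sub>R u))"
          by (rule integral_cong_AE) (measurable, use reph in \<open>eventually_elim, simp\<close>)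
        also have "\<dots> = (LINT x|lebesgue. rep_spinor f x \<bullet> green_adj (\<lambda>x. \<phi>' x *\<^sub>R u) x)"
          by (rule green_adjoint[OF rep_spinor_L2 L2(1)])
        finally show ?thesis .
      qed
      have i1: "integrable lebesgue (\<lambda>x. rep_spinor f x \<bullet> (\<phi> x *\<^sub>R u'))"
        by (rule L2_fun_inner_integrable[OF rep_spinor_L2 L2(2)])
      have i2: "integrable lebesgue (\<lambda>x. green (rep_spinor f) x \<bullet> (\<phi> x *\<^sub>R w))"
        by (rule L2_fun_inner_integrable[OF green_L2(1)[OF rep_spinor_L2] L2(3)])
      have 2: "- (LINT x|lebesgue. \<phi> x *\<^sub>R rep_spinor h' x) \<bullet> u
          = (LINT x|lebesgue. rep_spinor f x \<bullet> (\<phi> x *\<^sub>R u')) - (LINT x|lebesgue. rep_spinor f x \<bullet> green_adj (\<lambda>x. \<phi> x *\<^sub>R w) x)"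
      proof -
        have "- (LINT x|lebesgue. \<phi> x *\<^sub>R rep_spinor h' x) \<bullet> u = - (LINT x|lebesgue. (\<phi> x *\<^sub>R rep_spinor h' x) \<bullet> u)"
        proof -
          have "integrable lebesgue (\<lambda>x. \<phi> x *\<^sub>R rep_spinor h' x)"
            by (rule integrable_test_rep[OF c(1) r(1)])
          then have "(LINT x|lebesgue. (\<phi> x *\<^sub>R rep_spinor h' x) \<bullet> u) = (LINT x|lebesgue. \<phi> x *\<^sub>R rep_spinor h' x) \<bullet> u"
            by (intro integral_inner_left)
          then show ?thesis by simp
        qed
        also have "(LINT x|lebesgue. (\<phi> x *\<^sub>R rep_spinor h' x) \<bullet> u)
            = (LINT x|lebesgue. green (rep_spinor f) x \<bullet> (\<phi> x *\<^sub>R w) - rep_spinor f x \<bullet> (\<phi> x *\<^sub>R u'))"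
        proof (rule integral_cong_AE)
          show "AE x in lebesgue. (\<phi> x *\<^sub>R rep_spinor h' x) \<bullet> u
              = green (rep_spinor f) x \<bullet> (\<phi> x *\<^sub>R w) - rep_spinor f x \<bullet> (\<phi> x *\<^sub>R u')"
            using reph'
          proof eventually_elim
            case (elim x)
            have "?L1 (a + z *s b - ?L3 b) \<bullet> u = b \<bullet> w - a \<bullet> u'" for a b
              unfolding w_def u'_def
              by (simp add: inner_vec_def sum_2 mat2_vec_nth inner_complex_def algebra_simps)
            then show ?case unfolding elim inner_scaleR_left inner_scaleR_right by (simp only: right_diff_distrib)
          qed
        qed measurable
        also have "\<dots> = (LINT x|lebesgue. green (rep_spinor f) x \<bullet> (\<phi> x *\<^sub>R w)) - (LINT x|lebesgue. rep_spinor f x \<bullet> (\<phi> x *\<^sub>R u'))"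
          by (rule Bochner_Integration.integral_diff[OF i2 i1])
        also have "(LINT x|lebesgue. green (rep_spinor f) x \<bullet> (\<phi> x *\<^sub>R w)) = (LINT x|lebesgue. rep_spinor f x \<bullet> green_adj (\<lambda>x. \<phi> x *\<^sub>R w) x)"
          by (rule green_adjoint[OF rep_spinor_L2 L2(3)])
        finally show ?thesis by simp
      qed
      have "green_adj (\<lambda>x. \<phi>' x *\<^sub>R u) x + green_adj (\<lambda>x. \<phi> x *\<^sub>R w) x = \<phi> x *\<^sub>R u'" for x
      proof -
        have "green_adj (\<lambda>x. \<phi>' x *\<^sub>R u) x + green_adj (\<lambda>x. \<phi> x *\<^sub>R w) x = green_adj (\<lambda>x. \<phi>' x *\<^sub>R u + \<phi> x *\<^sub>R w) x"
          by (rule adj.green_add[OF m(1) adj.norm_green_L2(1)[OF L2(1)] m(3) adj.norm_green_L2(1)[OF L2(3)], symmetric])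
        also have "\<dots> = \<phi> x *\<^sub>R u'"
          unfolding w_def by (subst u) (rule adj.green_test[OF t c(2) r(1)])
        finally show ?thesis .
      qed
      then have "(LINT x|lebesgue. rep_spinor f x \<bullet> (\<phi> x *\<^sub>R u'))
          = (LINT x|lebesgue. rep_spinor f x \<bullet> green_adj (\<lambda>x. \<phi>' x *\<^sub>R u) x + rep_spinor f x \<bullet> green_adj (\<lambda>x. \<phi> x *\<^sub>R w) x)"
        by (simp flip: inner_add_right)
      also have "\<dots> = (LINT x|lebesgue. rep_spinor f x \<bullet> green_adj (\<lambda>x. \<phi>' x *\<^sub>R u) x)
          + (LINT x|lebesgue. rep_spinor f x \<bullet> green_adj (\<lambda>x. \<phi> x *\<^sub>R w) x)"
        by (intro Bochner_Integration.integral_add L2_fun_inner_integrable rep_spinor_L2 adj.green_L2 L2)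
      finally show ?thesis unfolding 1 2 by simp
    qed
    then show "(LINT x|lebesgue. \<phi>' x *\<^sub>R rep_spinor h x) = - (LINT x|lebesgue. \<phi> x *\<^sub>R rep_spinor h' x)"
      by (metis vector_eq_rdot)
  qed
  then show "has_weak_deriv (green_op f) (pointwise_op ?L1 ((f + cscale z (green_op f)) - pointwise_op ?L3 (green_op f)))"
    unfolding h'_def h_def .
qed

end

section \<open>The spectrum of the free operator and the norm of its resolvent\<close>

lemma has_weak_deriv_C1:
  fixes f f' :: "real \<Rightarrow> complex^2"
  assumes deriv: "\<And>x. (f has_vector_derivative f' x) (at x)" and cont: "continuous_on UNIV f'"
    and L2: "f \<in> L2_fun" "f' \<in> L2_fun"
  shows "has_weak_deriv (abs_spinor f) (abs_spinor f')"
proof (rule has_weak_derivI)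
  fix \<phi> \<phi>' :: "real \<Rightarrow> real" and r
  assume t: "\<And>x. (\<phi> has_real_derivative \<phi>' x) (at x)" and c: "continuous_on UNIV \<phi>" "continuous_on UNIV \<phi>'"
    and r: "\<And>x. r < \<bar>x\<bar> \<Longrightarrow> \<phi> x = 0" "\<And>x. r < \<bar>x\<bar> \<Longrightarrow> \<phi>' x = 0"
  define R where "R = \<bar>r\<bar> + 1"
  have contf: "continuous_on UNIV f"
    using deriv by (auto intro!: continuous_at_imp_continuous_on has_vector_derivative_continuous)
  have i1: "integrable lebesgue (\<lambda>x. \<phi>' x *\<^sub>R f x)"
    by (rule integrable_continuous_compact_support[where r = r]) (use c r contf in \<open>auto intro!: continuous_intros\<close>)
  have i2: "integrable lebesgue (\<lambda>x. \<phi> x *\<^sub>R f' x)"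
    by (rule integrable_continuous_compact_support[where r = r]) (use c r cont in \<open>auto intro!: continuous_intros\<close>)
  have AE_eq: "(LINT x|lebesgue. \<psi> x *\<^sub>R rep_spinor (abs_spinor g) x) = (LINT x|lebesgue. \<psi> x *\<^sub>R g x)"
    if "continuous_on UNIV (\<psi> :: real \<Rightarrow> real)" "g \<in> L2_fun" for \<psi> g
  proof (rule integral_cong_AE)
    have [measurable]: "\<psi> \<in> borel_measurable lebesgue"
      using that(1) by (rule borel_measurable_lebesgue_continuous)
    have [measurable]: "g \<in> borel_measurable lebesgue" using that(2) by (simp add: L2_fun_def)
    show "(\<lambda>x. \<psi> x *\<^sub>R rep_spinor (abs_spinor g) x) \<in> borel_measurable lebesgue"
      "(\<lambda>x. \<psi> x *\<^sub>R g x) \<in> borel_measurable lebesgue" by measurable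
    show "AE x in lebesgue. \<psi> x *\<^sub>R rep_spinor (abs_spinor g) x = \<psi> x *\<^sub>R g x"
      using rep_abs_spinor[OF that(2)] by eventually_elim simp
  qed
  have "(LINT x|lebesgue. \<phi>' x *\<^sub>R f x) + (LINT x|lebesgue. \<phi> x *\<^sub>R f' x)
      = (LINT x|lebesgue. \<phi> x *\<^sub>R f' x + \<phi>' x *\<^sub>R f x)"
    using Bochner_Integration.integral_add[OF i2 i1] by simp
  also have "\<dots> = (LINT x|lebesgue. indicator {-R..R} x *\<^sub>R (\<phi> x *\<^sub>R f' x + \<phi>' x *\<^sub>R f x))"
  proof (rule Bochner_Integration.integral_cong[OF refl])
    fix x
    show "\<phi> x *\<^sub>R f' x + \<phi>' x *\<^sub>R f x = indicator {-R..R} x *\<^sub>R (\<phi> x *\<^sub>R f' x + \<phi>' x *\<^sub>R f x)"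
    proof (cases "x \<in> {-R..R}")
      case False
      then have "r < \<bar>x\<bar>" by (auto simp: R_def)
      then show ?thesis using r by simp
    qed simp
  qed
  also have "\<dots> = \<phi> R *\<^sub>R f R - \<phi> (- R) *\<^sub>R f (- R)"
  proof (rule integral_FTC_lebesgue(1))
    show "((\<lambda>x. \<phi> x *\<^sub>R f x) has_vector_derivative \<phi> x *\<^sub>R f' x + \<phi>' x *\<^sub>R f x) (at x within {-R..R})" for x
      by (rule has_vector_derivative_at_within)
        (intro has_vector_derivative_scaleR t deriv)
    show "continuous_on {-R..R} (\<lambda>x. \<phi> x *\<^sub>R f' x + \<phi>' x *\<^sub>R f x)"
      by (rule continuous_on_subset[of UNIV]) (auto intro!: continuous_intros c cont contf)
  qed (simp add: R_def)
  also have "\<dots> = 0" by (simp add: r R_def)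
  finally show "(LINT x|lebesgue. \<phi>' x *\<^sub>R rep_spinor (abs_spinor f) x) = - (LINT x|lebesgue. \<phi> x *\<^sub>R rep_spinor (abs_spinor f') x)"
    unfolding AE_eq[OF c(2) L2(1)] AE_eq[OF c(1) L2(2)] by (simp add: eq_neg_iff_add_eq_0)
qed

lemma L2_fun_exp_decay:
  assumes [measurable]: "f \<in> borel_measurable lebesgue" and "c > 0" "b \<ge> 0"
    and le: "\<And>x. norm (f x) \<le> b * exp (- c * \<bar>x\<bar>)"
  shows "f \<in> L2_fun"
proof -
  have "(\<integral>\<^sup>+x. ennreal ((norm (f x))\<^sup>2) \<partial>lebesgue) \<le> (\<integral>\<^sup>+x. ennreal (b\<^sup>2) * ennreal (exp (- (2 * c) * \<bar>0 - x\<bar>)) \<partial>lebesgue)"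
  proof (rule nn_integral_mono)
    fix x
    have "(norm (f x))\<^sup>2 \<le> (b * exp (- c * \<bar>x\<bar>))\<^sup>2" by (intro power_mono le) auto
    also have "\<dots> = b\<^sup>2 * exp (- (2 * c) * \<bar>0 - x\<bar>)"
      by (simp add: power_mult_distrib power2_eq_square flip: exp_add)
    finally show "ennreal ((norm (f x))\<^sup>2) \<le> ennreal (b\<^sup>2) * ennreal (exp (- (2 * c) * \<bar>0 - x\<bar>))"
      by (simp flip: ennreal_mult)
  qed
  also have "\<dots> = ennreal (b\<^sup>2) * (\<integral>\<^sup>+x. ennreal (exp (- (2 * c) * \<bar>0 - x\<bar>)) \<partial>lebesgue)"
    by (rule nn_integral_cmult) measurable
  also have "\<dots> = ennreal (b\<^sup>2 * (2 / (2 * c)))"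
    using \<open>c > 0\<close> by (subst nn_integral_exp_abs(1)) (auto simp flip: ennreal_mult)
  also have "\<dots> = ennreal ((b * sqrt (1 / c))\<^sup>2)"
    using \<open>c > 0\<close> by (simp add: power_mult_distrib)
  finally show ?thesis
    by (rule L2_funI(1)[rotated]) (use assms in auto)
qed

text \<open>Approximate eigenfunctions \<open>exp (i k x - \<delta> sqrt (1 + x\<^sup>2)) u\<close> with \<open>k\<^sup>2 = \<lambda>\<^sup>2 - m\<^sup>2\<close>: the
  derivative of the cutoff is at most \<open>\<delta>\<close> times the cutoff.\<close>

lemma free_dirac_spectrum:
  assumes "\<bar>m\<bar> \<le> \<bar>l\<bar>"
  shows "complex_of_real l \<notin> resolvent_set (free_dirac m)"
proof
  assume "complex_of_real l \<in> resolvent_set (free_dirac m)"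
  then obtain T where T: "bounded_linear T" "\<And>f g. (f, g + cscale (of_real l) f) \<in> free_dirac m \<longleftrightarrow> f = T g"
    by (auto simp: resolvent_set_iff)
  obtain K where K: "K > 0" "\<And>f. norm (T f) \<le> norm f * K"
    using bounded_linear.pos_bounded[OF T(1)] by auto
  \<comment> \<open>Chosen so that \<open>\<delta> * K\<close> is 1/2: the residual estimate will
    give that the norm of f is at most half of itself.\<close>
  define \<delta> where "\<delta> = 1 / (2 * K)"
  have \<delta>: "\<delta> > 0" using K by (simp add: \<delta>_def)
  define k where "k = sqrt (l\<^sup>2 - m\<^sup>2)"
  have "m\<^sup>2 \<le> l\<^sup>2" using assms by (simp add: abs_le_square_iff)
  then have kk: "k * k = l * l - m * m" by (simp add: k_def power2_eq_square flip: real_sqrt_mult)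
  \<comment> \<open>An eigenvector of the symbol of \<open>H\<^sub>0\<close> at momentum k with
    eigenvalue l. The generic choice (l + m, k) degenerates to zero when l = -m, whence the separate
    case.\<close>
  obtain u :: "complex^2" where u: "u \<noteq> 0"
    "of_real k *s (sigma1 *v u) + of_real m *s (sigma3 *v u) = of_real l *s u"
  proof (cases "l + m = 0")
    case True
    then have "l = - m" by simp
    with kk have "k = 0" by simp
    show ?thesis
      by (rule that[of "vector [0, 1]"])
        (simp_all add: vec2_eq_iff mat2_vec_nth \<open>k = 0\<close> \<open>l = - m\<close>)
  next
    case False
    have "of_real k * of_real k = of_real l * of_real l - of_real m * (of_real m :: complex)"
      using arg_cong[OF kk, of complex_of_real] by simp
    moreover have "of_real l + of_real m \<noteq> (0 :: complex)"
      using False by (metis of_real_add of_real_eq_0_iff)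
    ultimately show ?thesis
      by (intro that[of "vector [of_real l + of_real m, of_real k]"])
        (auto simp: vec2_eq_iff mat2_vec_nth algebra_simps)
  qed
  \<comment> \<open>Replacing |x| by \<open>sqrt (1 + x\<^sup>2)\<close> makes the cutoff
    differentiable at 0, so that f is classically differentiable.\<close>
  define p where "p x = exp (- \<delta> * sqrt (1 + x\<^sup>2))" for x :: real
  define p' where "p' x = - \<delta> * (x / sqrt (1 + x\<^sup>2)) * p x" for x :: real
  have sq: "1 + x\<^sup>2 > 0" for x :: real by (simp add: add_pos_nonneg)
  have p: "(p has_real_derivative p' x) (at x)" for x
    unfolding p_def p'_def using sq[of x]
    by (auto intro!: derivative_eq_intros simp: field_simps)
  have p_pos: "p x > 0" for x by (simp add: p_def)
  have abs_le_sqrt: "\<bar>x\<bar> \<le> sqrt (1 + x\<^sup>2)" for x :: real by (rule real_le_rsqrt) simp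
  have p'_le: "\<bar>p' x\<bar> \<le> \<delta> * p x" for x
  proof -
    have "\<bar>x / sqrt (1 + x\<^sup>2)\<bar> \<le> 1" using abs_le_sqrt[of x] sq[of x] by (simp add: abs_divide)
    then have "\<bar>x / sqrt (1 + x\<^sup>2)\<bar> * (\<delta> * p x) \<le> 1 * (\<delta> * p x)"
      using \<delta> p_pos[of x] by (intro mult_right_mono) auto
    then show ?thesis using \<delta> p_pos[of x] by (simp add: p'_def abs_mult mult_ac)
  qed
  have p_le: "p x \<le> exp (- \<delta> * \<bar>x\<bar>)" for x
    using abs_le_sqrt[of x] \<delta> by (simp add: p_def)
  define e where "e x = exp (\<i> * of_real k * of_real x)" for x :: real
  have norm_e: "norm (e x) = 1" for x by (simp add: e_def)
  define f where "f x = (of_real (p x) * e x) *s u" for x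
  define f' where "f' x = ((of_real (p' x) + \<i> * of_real k * of_real (p x)) * e x) *s u" for x
  have deriv: "(f has_vector_derivative f' x) (at x)" for x
  proof -
    have "((\<lambda>w. exp (\<i> * of_real k * w)) has_field_derivative \<i> * of_real k * exp (\<i> * of_real k * of_real x)) (at (of_real x))"
      by (auto intro!: derivative_eq_intros)
    from has_vector_derivative_real_field[OF this]
    have "(e has_vector_derivative \<i> * of_real k * e x) (at x)"
      by (simp add: o_def e_def[abs_def])
    then have "((\<lambda>x. of_real (p x) * e x) has_vector_derivative of_real (p x) * (\<i> * of_real k * e x) + of_real (p' x) * e x) (at x)"
      by (rule has_vector_derivative_mult[OF has_vector_derivative_of_real[OF p]])
    also have "of_real (p x) * (\<i> * of_real k * e x) + of_real (p' x) * e x = (of_real (p' x) + \<i> * of_real k * of_real (p x)) * e x"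
      by (simp add: algebra_simps)
    finally show ?thesis
      unfolding f_def[abs_def] f'_def by (rule bounded_linear.has_vector_derivative[OF bounded_linear_smult_vec])
  qed
  have contp: "continuous_on UNIV p" using p by (rule DERIV_continuous_on[OF has_field_derivative_at_within])
  have contp': "continuous_on UNIV p'"
    unfolding p'_def using sq by (intro continuous_intros contp) (auto simp: less_imp_neq[symmetric])
  have conte: "continuous_on UNIV e" unfolding e_def by (intro continuous_intros)
  have contf: "continuous_on UNIV f" "continuous_on UNIV f'"
    unfolding f_def f'_def
    by (intro bounded_linear.continuous_on[OF bounded_linear_smult_vec] continuous_intros contp contp' conte)+
  have "f \<in> borel_measurable borel" "f' \<in> borel_measurable borel"
    using contf by (auto intro: borel_measurable_continuous_onI)
  then have [measurable]: "f \<in> borel_measurable lebesgue" "f' \<in> borel_measurable lebesgue"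
    by (auto intro!: measurable_completion)
  have norm_f: "norm (f x) = norm u * p x" for x
    using p_pos[of x] by (simp add: f_def vec_norm_smult norm_mult norm_e)
  have fL2: "f \<in> L2_fun"
    by (rule L2_fun_exp_decay[where c = \<delta> and b = "norm u"]) (use \<delta> p_le norm_f in \<open>auto intro: mult_left_mono\<close>)
  have f'L2: "f' \<in> L2_fun"
  proof (rule L2_fun_dominated(1)[OF fL2, where c = "\<delta> + \<bar>k\<bar>"])
    have "norm (f' x) \<le> (\<delta> + \<bar>k\<bar>) * norm (f x)" for x
    proof -
      have "norm (complex_of_real (p' x) + \<i> * of_real k * of_real (p x)) \<le> \<bar>p' x\<bar> + \<bar>k\<bar> * p x"
        using p_pos[of x] by (intro order_trans[OF norm_triangle_ineq]) (simp add: norm_mult)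
      also have "\<dots> \<le> (\<delta> + \<bar>k\<bar>) * p x" using p'_le[of x] by (simp add: algebra_simps)
      finally have "norm (complex_of_real (p' x) + \<i> * of_real k * of_real (p x)) * norm u \<le> (\<delta> + \<bar>k\<bar>) * p x * norm u"
        by (rule mult_right_mono) simp
      then show ?thesis unfolding norm_f by (simp add: f'_def vec_norm_smult norm_mult norm_e mult_ac)
    qed
    then show "AE x in lebesgue. norm (f' x) \<le> (\<delta> + \<bar>k\<bar>) * norm (f x)" by simp
  qed (use \<delta> in auto)
  \<comment> \<open>This is \<open>H\<^sub>0 - l\<close> applied to f: the plane wave cancels and
    only the derivative of the cutoff remains.\<close>
  define g where "g x = (- \<i> * of_real (p' x) * e x) *s (sigma1 *v u)" for x
  have contg: "continuous_on UNIV g"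
    unfolding g_def by (intro bounded_linear.continuous_on[OF bounded_linear_smult_vec] continuous_intros contp' conte)
  then have "g \<in> borel_measurable borel" by (rule borel_measurable_continuous_onI)
  then have [measurable]: "g \<in> borel_measurable lebesgue" by (auto intro!: measurable_completion)
  have "norm (g x) \<le> \<delta> * norm (f x)" for x
  proof -
    have "norm (sigma1 *v u) = norm u" by (simp add: norm_vec2 mat2_vec_nth add.commute)
    then show ?thesis
      unfolding norm_f using mult_right_mono[OF p'_le[of x] norm_ge_zero[of u]]
      by (simp add: g_def vec_norm_smult norm_mult norm_e mult_ac)
  qed
  then have gL2: "g \<in> L2_fun" and norm_g: "norm (abs_spinor g) \<le> \<delta> * norm (abs_spinor f)"
    using L2_fun_dominated[OF fL2, of g \<delta>] \<delta> by auto
  have "(abs_spinor f, abs_spinor g + cscale (of_real l) (abs_spinor f)) \<in> free_dirac m"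
    unfolding free_dirac_def
  proof (intro CollectI case_prodI exI conjI)
    show "has_weak_deriv (abs_spinor f) (abs_spinor f')"
      by (rule has_weak_deriv_C1[OF deriv contf(2) fL2 f'L2])
    have *: "g x + of_real l *s f x = - \<i> *s (sigma1 *v f' x) + of_real m *s (sigma3 *v f x)" for x
    proof -
      have "of_real m *s (sigma3 *v f x) = (of_real (p x) * e x) *s (of_real m *s (sigma3 *v u))"
        by (simp add: f_def vec2_eq_iff mat2_vec_nth mult_ac)
      also have "\<dots> = (of_real (p x) * e x) *s (of_real l *s u - of_real k *s (sigma1 *v u))"
        unfolding u(2)[symmetric] by simp
      finally show ?thesis
        by (simp only:) (simp add: f_def f'_def g_def vec2_eq_iff mat2_vec_nth algebra_simps)
    qed
    show "AE x in lebesgue. rep_spinor (abs_spinor g + cscale (of_real l) (abs_spinor f)) x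
        = - \<i> *s (sigma1 *v rep_spinor (abs_spinor f') x) + of_real m *s (sigma3 *v rep_spinor (abs_spinor f) x)"
      using rep_spinor_plus[of "abs_spinor g" "cscale (of_real l) (abs_spinor f)"]
        rep_spinor_cscale[of "of_real l" "abs_spinor f"] rep_abs_spinor[OF fL2] rep_abs_spinor[OF gL2]
        rep_abs_spinor[OF f'L2]
      by eventually_elim (simp add: *)
  qed
  then have "abs_spinor f = T (abs_spinor g)" using T(2) by blast
  then have "norm (abs_spinor f) \<le> norm (abs_spinor g) * K" using K(2) by metis
  also have "\<dots> \<le> \<delta> * norm (abs_spinor f) * K" using norm_g K(1) by (intro mult_right_mono) auto
  also have "\<dots> = norm (abs_spinor f) / 2" using K(1) by (simp add: \<delta>_def)
  finally have "abs_spinor f = 0" by simp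
  then have "AE x in lebesgue. f x = 0"
    using rep_abs_spinor[OF fL2] rep_spinor_zero by (auto elim: eventually_elim2)
  moreover have "f x \<noteq> 0" for x
    using norm_f[of x] p_pos[of x] u(1) by (metis mult_eq_0_iff norm_eq_zero less_irrefl)
  ultimately have "AE x in (lebesgue :: real measure). False" by simp
  then show False by (simp add: eventually_False ae_filter_eq_bot_iff)
qed

section \<open>Linearity and symmetries of the free operator\<close>

lemma has_weak_deriv_add:
  assumes "has_weak_deriv f f'" "has_weak_deriv g g'"
  shows "has_weak_deriv (f + g) (f' + g')"
proof (rule has_weak_derivI)
  fix \<phi> \<phi>' :: "real \<Rightarrow> real" and r
  assume t: "\<And>x. (\<phi> has_real_derivative \<phi>' x) (at x)" and c: "continuous_on UNIV \<phi>" "continuous_on UNIV \<phi>'"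
    and r: "\<And>x. r < \<bar>x\<bar> \<Longrightarrow> \<phi> x = 0" "\<And>x. r < \<bar>x\<bar> \<Longrightarrow> \<phi>' x = 0"
  have ex: "\<exists>R. \<forall>x. R < \<bar>x\<bar> \<longrightarrow> \<phi> x = 0" using r(1) by blast
  have *: "(LINT x|lebesgue. \<psi> x *\<^sub>R rep_spinor (a + b) x)
      = (LINT x|lebesgue. \<psi> x *\<^sub>R rep_spinor a x) + (LINT x|lebesgue. \<psi> x *\<^sub>R rep_spinor b x)"
    if "continuous_on UNIV \<psi>" "\<And>x. r < \<bar>x\<bar> \<Longrightarrow> \<psi> x = 0" for \<psi> a b
  proof -
    have [measurable]: "\<psi> \<in> borel_measurable lebesgue"
      using that(1) by (rule borel_measurable_lebesgue_continuous)
    have "(LINT x|lebesgue. \<psi> x *\<^sub>R rep_spinor (a + b) x)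
        = (LINT x|lebesgue. \<psi> x *\<^sub>R rep_spinor a x + \<psi> x *\<^sub>R rep_spinor b x)"
    proof (rule integral_cong_AE)
      show "AE x in lebesgue. \<psi> x *\<^sub>R rep_spinor (a + b) x = \<psi> x *\<^sub>R rep_spinor a x + \<psi> x *\<^sub>R rep_spinor b x"
        using rep_spinor_plus[of a b] by eventually_elim (simp add: scaleR_add_right)
    qed measurable
    also have "\<dots> = (LINT x|lebesgue. \<psi> x *\<^sub>R rep_spinor a x) + (LINT x|lebesgue. \<psi> x *\<^sub>R rep_spinor b x)"
      using integrable_test_rep[of \<psi> r] that by (intro Bochner_Integration.integral_add) auto
    finally show ?thesis .
  qed
  show "(LINT x|lebesgue. \<phi>' x *\<^sub>R rep_spinor (f + g) x) = - (LINT x|lebesgue. \<phi> x *\<^sub>R rep_spinor (f' + g') x)"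
    using *[of \<phi>', OF c(2) r(2)] *[of \<phi>, OF c(1) r(1)] assms[unfolded has_weak_deriv_def, rule_format, of \<phi> \<phi>', OF t c(2) ex] by simp
qed

lemma free_dirac_add:
  assumes "(f, g) \<in> free_dirac m" "(f', g') \<in> free_dirac m"
  shows "(f + f', g + g') \<in> free_dirac m"
proof -
  obtain d where d: "has_weak_deriv f d"
    "AE x in lebesgue. rep_spinor g x = - \<i> *s (sigma1 *v rep_spinor d x) + of_real m *s (sigma3 *v rep_spinor f x)"
    using assms(1) by (auto simp: free_dirac_def)
  obtain d' where d': "has_weak_deriv f' d'"
    "AE x in lebesgue. rep_spinor g' x = - \<i> *s (sigma1 *v rep_spinor d' x) + of_real m *s (sigma3 *v rep_spinor f' x)"
    using assms(2) by (auto simp: free_dirac_def)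
  have "AE x in lebesgue. rep_spinor (g + g') x = - \<i> *s (sigma1 *v rep_spinor (d + d') x) + of_real m *s (sigma3 *v rep_spinor (f + f') x)"
    using d(2) d'(2) rep_spinor_plus[of g g'] rep_spinor_plus[of d d'] rep_spinor_plus[of f f']
  proof eventually_elim
    case (elim x)
    show ?case
      unfolding elim(3,4,5) elim(1,2) by (simp add: vec2_eq_iff mat2_vec_nth algebra_simps)
  qed
  then show ?thesis unfolding free_dirac_def using has_weak_deriv_add[OF d(1) d'(1)] by blast
qed

text \<open>A symmetry is checked on the symbol, with a in place of the derivative and b in place of
  the value. T describes how the image under \<open>H\<^sub>0\<close> changes; its second argument
  is used when a multiple of the value appears.\<close>

lemma free_dirac_pointwise_op:
  assumes L: "bounded_linear L" and hg: "(h, g) \<in> free_dirac m"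
    and T: "\<And>a b. T (- \<i> *s (sigma1 *v a) + of_real m *s (sigma3 *v b)) b
        = - \<i> *s (sigma1 *v L a) + of_real m *s (sigma3 *v L b)"
    and g': "AE x in lebesgue. rep_spinor g' x = T (rep_spinor g x) (rep_spinor h x)"
  shows "(pointwise_op L h, g') \<in> free_dirac m"
proof -
  obtain d where d: "has_weak_deriv h d"
    "AE x in lebesgue. rep_spinor g x = - \<i> *s (sigma1 *v rep_spinor d x) + of_real m *s (sigma3 *v rep_spinor h x)"
    using hg by (auto simp: free_dirac_def)
  have "AE x in lebesgue. rep_spinor g' x = - \<i> *s (sigma1 *v rep_spinor (pointwise_op L d) x)
      + of_real m *s (sigma3 *v rep_spinor (pointwise_op L h) x)"
    using d(2) g' rep_pointwise_op[OF L, of d] rep_pointwise_op[OF L, of h]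
  proof eventually_elim
    case (elim x)
    show ?case unfolding elim(2) elim(1) T elim(3,4) ..
  qed
  then show ?thesis unfolding free_dirac_def using has_weak_deriv_pointwise_op[OF L d(1)] by blast
qed

lemma pointwise_op_smult: "pointwise_op (\<lambda>v. c *s v) f = cscale c f"
  unfolding pointwise_op_def
  by (rule abs_spinor_eqI[symmetric, OF L2_fun_smult[OF rep_spinor_L2] rep_spinor_cscale])

lemma free_dirac_cscale:
  assumes "(f, g) \<in> free_dirac m" shows "(cscale c f, cscale c g) \<in> free_dirac m"
  unfolding pointwise_op_smult[of c f, symmetric]
  by (rule free_dirac_pointwise_op[OF bounded_linear_smult_right assms, where T = "\<lambda>a b. c *s a"])
    (use rep_spinor_cscale[of c g] in \<open>auto simp: vec2_eq_iff mat2_vec_nth algebra_simps\<close>)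

text \<open>\<open>sigma3\<close> anticommutes with \<open>sigma1\<close>, so its anticommutator
  with \<open>H\<^sub>0\<close> is the constant 2m.\<close>

lemma free_dirac_sigma3:
  assumes "(f, g) \<in> free_dirac m"
  shows "(pointwise_op (\<lambda>v. sigma3 *v v) f, (2 * m) *\<^sub>R f - pointwise_op (\<lambda>v. sigma3 *v v) g) \<in> free_dirac m"
proof (rule free_dirac_pointwise_op[OF bounded_linear_matrix_vector assms, where T = "\<lambda>a b. (2 * m) *\<^sub>R b - sigma3 *v a"])
  show "(2 * m) *\<^sub>R b - sigma3 *v (- \<i> *s (sigma1 *v a) + of_real m *s (sigma3 *v b))
      = - \<i> *s (sigma1 *v (sigma3 *v a)) + of_real m *s (sigma3 *v (sigma3 *v b))" for a b
    by (simp add: vec2_eq_iff mat2_vec_nth scaleR_conv_of_real[where 'a = complex] algebra_simps)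
  show "AE x in lebesgue. rep_spinor ((2 * m) *\<^sub>R f - pointwise_op (\<lambda>v. sigma3 *v v) g) x
      = (2 * m) *\<^sub>R rep_spinor f x - sigma3 *v rep_spinor g x"
    using rep_spinor_diff[of "(2 * m) *\<^sub>R f" "pointwise_op (\<lambda>v. sigma3 *v v) g"] rep_spinor_scaleR[of "2 * m" f]
      rep_pointwise_op[OF bounded_linear_matrix_vector, of sigma3 g]
    by eventually_elim simp
qed

text \<open>The antiunitary symmetry \<open>f \<mapsto> \<sigma>\<^sub>3 cnj f\<close> of \<open>H\<^sub>0\<close> maps solutions at \<open>cnj z\<close> to solutions at \<open>z\<close>.\<close>

definition conj_vec :: "complex^2 \<Rightarrow> complex^2" where
  "conj_vec v = vector [cnj (v$1), - cnj (v$2)]"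

lemma bounded_linear_conj_vec: "bounded_linear conj_vec"
  by (rule bounded_linear_intro[where K = 1]) (auto simp: conj_vec_def vec2_eq_iff norm_vec2)

lemma pointwise_op_eq_0:
  assumes L: "bounded_linear L" and inj: "\<And>v. L v = 0 \<Longrightarrow> v = 0" and "pointwise_op L f = 0"
  shows "f = 0"
proof -
  have "AE x in lebesgue. rep_spinor f x = rep_spinor 0 x"
    using rep_pointwise_op[OF L, of f] rep_spinor_zero unfolding assms(3)
    by eventually_elim (auto dest: inj)
  then show ?thesis by (simp add: spinor_eq_iff)
qed

text \<open>Conjugation turns an eigenvector at \<open>cnj z\<close> into one at z, which the
  resolvent at z rules out. Injectivity at the conjugate point is thus obtained from the assumption
  at z alone.\<close>

lemma free_dirac_conj_eigen:
  assumes "(f, cscale (cnj z) f) \<in> free_dirac m" "z \<in> resolvent_set (free_dirac m)"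
  shows "f = 0"
proof -
  obtain R where R: "bounded_linear R" "\<And>f g. (f, g + cscale z f) \<in> free_dirac m \<longleftrightarrow> f = R g"
    using assms(2) by (auto simp: resolvent_set_iff)
  have "(pointwise_op conj_vec f, cscale z (pointwise_op conj_vec f)) \<in> free_dirac m"
  proof (rule free_dirac_pointwise_op[OF bounded_linear_conj_vec assms(1), where T = "\<lambda>a b. conj_vec a"])
    show "conj_vec (- \<i> *s (sigma1 *v a) + of_real m *s (sigma3 *v b))
        = - \<i> *s (sigma1 *v conj_vec a) + of_real m *s (sigma3 *v conj_vec b)" for a b
      by (simp add: vec2_eq_iff mat2_vec_nth conj_vec_def)
    show "AE x in lebesgue. rep_spinor (cscale z (pointwise_op conj_vec f)) x = conj_vec (rep_spinor (cscale (cnj z) f) x)"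
      using rep_spinor_cscale[of z "pointwise_op conj_vec f"] rep_spinor_cscale[of "cnj z" f]
        rep_pointwise_op[OF bounded_linear_conj_vec, of f]
    proof eventually_elim
      case (elim x)
      show ?case unfolding elim by (simp add: vec2_eq_iff conj_vec_def)
    qed
  qed
  then have "pointwise_op conj_vec f = R 0" using R(2)[of _ 0] by simp
  also have "R 0 = 0" by (rule linear_0[OF bounded_linear.linear[OF R(1)]])
  finally show "f = 0"
    by (rule pointwise_op_eq_0[OF bounded_linear_conj_vec, rotated]) (auto simp: conj_vec_def vec2_eq_iff)
qed

lemma inner_cscale: "cscale c f \<bullet> g = f \<bullet> cscale (cnj c) g"
  unfolding inner_spinor_def
proof (rule integral_cong_AE)
  show "AE x in lebesgue. rep_spinor (cscale c f) x \<bullet> rep_spinor g x = rep_spinor f x \<bullet> rep_spinor (cscale (cnj c) g) x"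
    using rep_spinor_cscale[of c f] rep_spinor_cscale[of "cnj c" g] by eventually_elim (simp add: inner_cscale_vec)
qed measurable

context dirac_green
begin

lemma green_op_adjoint: "green_op f \<bullet> p = f \<bullet> dirac_green.green_op m (cnj z) (- cnj k) p"
proof -
  interpret adj: dirac_green m "cnj z" "- cnj k" by (rule dirac_green_cnj)
  have "green_op f \<bullet> p = (LINT x|lebesgue. green (rep_spinor f) x \<bullet> rep_spinor p x)"
    unfolding inner_spinor_def
    by (rule integral_cong_AE) (measurable, use rep_green_op[of f] in \<open>eventually_elim, simp\<close>)
  also have "\<dots> = (LINT x|lebesgue. rep_spinor f x \<bullet> green_adj (rep_spinor p) x)"
    by (rule green_adjoint[OF rep_spinor_L2 rep_spinor_L2])
  also have "\<dots> = f \<bullet> adj.green_op p"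
    unfolding inner_spinor_def
    by (rule integral_cong_AE) (measurable, use adj.rep_green_op[of p] in \<open>eventually_elim, simp\<close>)
  finally show ?thesis .
qed

context
  assumes rho: "z \<in> resolvent_set (free_dirac m)"
begin

text \<open>The kernel provides a solution, the resolvent assumed at z provides uniqueness; hence
  the two agree.\<close>

lemma free_dirac_iff_green_op: "(h, g + cscale z h) \<in> free_dirac m \<longleftrightarrow> h = green_op g"
proof -
  obtain R where R: "\<And>f g. (f, g + cscale z f) \<in> free_dirac m \<longleftrightarrow> f = R g"
    using rho by (auto simp: resolvent_set_iff)
  then have "green_op g = R g" using green_op_free_dirac[of g] by blast
  then show ?thesis using R by simp
qed

text \<open>h and the solution built from the kernel at \<open>cnj z\<close> differ by an
  eigenvector at \<open>cnj z\<close>, which is zero.\<close>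

lemma free_dirac_green_op_adj:
  assumes "(h, g) \<in> free_dirac m"
  shows "h = dirac_green.green_op m (cnj z) (- cnj k) (g - cscale (cnj z) h)"
proof -
  interpret adj: dirac_green m "cnj z" "- cnj k" by (rule dirac_green_cnj)
  define h2 where "h2 = adj.green_op (g - cscale (cnj z) h)"
  have "(h2, (g - cscale (cnj z) h) + cscale (cnj z) h2) \<in> free_dirac m"
    unfolding h2_def by (rule adj.green_op_free_dirac)
  from free_dirac_add[OF assms free_dirac_cscale[OF this, of "-1"]]
  have "(h - h2, cscale (cnj z) (h - h2)) \<in> free_dirac m"
    by (simp add: algebra_simps linear_diff[OF bounded_linear.linear[OF bounded_linear_cscale]])
  then have "h - h2 = 0" by (rule free_dirac_conj_eigen[OF _ rho])
  then show ?thesis by (simp add: h2_def)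
qed

lemma free_dirac_symmetric:
  assumes "(h, g) \<in> free_dirac m" "(h', g') \<in> free_dirac m"
  shows "g \<bullet> h' = h \<bullet> g'"
proof -
  have "h = green_op (g - cscale z h)"
    using free_dirac_iff_green_op[of h "g - cscale z h"] assms(1) by simp
  then have "h \<bullet> (g' - cscale (cnj z) h') = (g - cscale z h) \<bullet> h'"
    using green_op_adjoint[of "g - cscale z h" "g' - cscale (cnj z) h'"] free_dirac_green_op_adj[OF assms(2)] by simp
  then show ?thesis by (simp add: inner_diff_right inner_diff_left inner_cscale)
qed

lemma free_dirac_mass_gap:
  assumes "(h, g) \<in> free_dirac m"
  shows "m * norm h \<le> norm g"
proof -
  let ?s = "pointwise_op (\<lambda>v. sigma3 *v v)"
  have "g \<bullet> ?s h = h \<bullet> ((2 * m) *\<^sub>R h - ?s g)"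
    by (rule free_dirac_symmetric[OF assms free_dirac_sigma3[OF assms]])
  \<comment> \<open>As \<open>sigma3\<close> is Hermitian, the same pairing stands on both sides of
    the symmetry relation, which then determines it.\<close>
  moreover have "h \<bullet> ?s g = g \<bullet> ?s h"
    unfolding inner_spinor_def
  proof (rule integral_cong_AE)
    show "AE x in lebesgue. rep_spinor h x \<bullet> rep_spinor (?s g) x = rep_spinor g x \<bullet> rep_spinor (?s h) x"
      using rep_pointwise_op[OF bounded_linear_matrix_vector, of sigma3 g] rep_pointwise_op[OF bounded_linear_matrix_vector, of sigma3 h]
      by eventually_elim (simp add: inner_vec_def sum_2 mat2_vec_nth inner_commute)
  qed measurable
  ultimately have "g \<bullet> ?s h = m * (norm h)\<^sup>2"
    by (simp add: inner_diff_right power2_norm_eq_inner)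
  moreover have "norm (?s h) = norm h"
  proof -
    have "(norm (?s h))\<^sup>2 = (norm h)\<^sup>2"
      unfolding norm_spinor_square
    proof (rule integral_cong_AE)
      show "AE x in lebesgue. (norm (rep_spinor (?s h) x))\<^sup>2 = (norm (rep_spinor h x))\<^sup>2"
        using rep_pointwise_op[OF bounded_linear_matrix_vector, of sigma3 h]
        by eventually_elim (simp add: norm_vec2 mat2_vec_nth)
    qed measurable
    then show ?thesis by simp
  qed
  ultimately have "m * (norm h)\<^sup>2 \<le> norm g * norm h"
    using norm_cauchy_schwarz[of g "?s h"] by simp
  then show ?thesis
    by (cases "h = 0") (simp_all add: power2_eq_square flip: mult.assoc)
qed

text \<open>Pythagoras: symmetry, applied to h and i h, makes both g and h orthogonal to i h in the
  real inner product, so the real and imaginary shifts contribute separately.\<close>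

lemma norm_free_dirac_diff:
  assumes "(h, g) \<in> free_dirac m"
  shows "(norm (g - cscale w h))\<^sup>2 = (norm (g - Re w *\<^sub>R h))\<^sup>2 + (Im w)\<^sup>2 * (norm h)\<^sup>2"
proof -
  have neg: "cscale (- \<i>) f = - cscale \<i> f" for f
    using cscale_cscale[of "-1" \<i> f] by simp
  have i: "f \<bullet> cscale \<i> f = 0" for f
    using inner_cscale[of \<i> f f] inner_commute[of f "cscale \<i> f"] by (simp add: neg)
  have g: "g \<bullet> cscale \<i> h = 0"
    using free_dirac_symmetric[OF assms free_dirac_cscale[OF assms, of \<i>]]
      inner_cscale[of \<i> h g] inner_commute[of g "cscale \<i> h"] by (simp add: neg)
  have w: "cscale w h = Re w *\<^sub>R h + Im w *\<^sub>R cscale \<i> h"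
    unfolding spinor_eq_iff
    using rep_spinor_cscale[of w h] rep_spinor_cscale[of \<i> h] rep_spinor_scaleR[of "Re w" h]
      rep_spinor_scaleR[of "Im w" "cscale \<i> h"] rep_spinor_plus[of "Re w *\<^sub>R h" "Im w *\<^sub>R cscale \<i> h"]
  proof eventually_elim
    case (elim x)
    show ?case unfolding elim by (simp add: vec_eq_iff complex_eq_iff)
  qed
  define a where "a = g - Re w *\<^sub>R h"
  have "a \<bullet> cscale \<i> h = 0" by (simp add: a_def inner_diff_left g i)
  moreover have "g - cscale w h = a - Im w *\<^sub>R cscale \<i> h" by (simp add: a_def w)
  moreover have "cscale \<i> h \<bullet> cscale \<i> h = h \<bullet> h"
    using norm_cscale[of \<i> h] by (simp flip: power2_norm_eq_inner)
  ultimately show ?thesis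
    unfolding a_def[symmetric] power2_norm_eq_inner
    by (simp add: inner_diff_left inner_diff_right inner_commute[of "cscale \<i> h" a] power2_eq_square)
qed

text \<open>If |Re z| is at least m, the distance is at most |Im z|, and the imaginary shift alone
  suffices. Otherwise the nearer of m and -m bounds the distance, and the mass gap controls the real
  shift. In both cases it is enough to know points of the spectrum, i.e.
  \<open>free_dirac_spectrum\<close>.\<close>

lemma norm_green_op_infdist:
  assumes m: "m \<ge> 0"
  shows "infdist z (op_spectrum (free_dirac m)) > 0"
    and "norm (green_op g) \<le> norm g / infdist z (op_spectrum (free_dirac m))"
proof -
  let ?S = "op_spectrum (free_dirac m)"
  have S: "of_real l \<in> ?S" if "m \<le> \<bar>l\<bar>" for l
    using free_dirac_spectrum[of m l] that m by (simp add: op_spectrum_def)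
  have "closed ?S" unfolding op_spectrum_def using open_resolvent_set by (simp add: closed_Compl)
  moreover have "?S \<noteq> {}" using S[OF abs_ge_self] by auto
  moreover have "z \<notin> ?S" using rho by (simp add: op_spectrum_def)
  ultimately have pos: "infdist z ?S \<noteq> 0" using in_closed_iff_infdist_zero by blast
  then show pos: "infdist z ?S > 0" using infdist_nonneg[of z ?S] by linarith
  define h where "h = green_op g"
  have hg: "(h, g + cscale z h) \<in> free_dirac m" unfolding h_def by (rule green_op_free_dirac)
  define g' where "g' = g + cscale z h"
  have n: "(norm g)\<^sup>2 = (norm (g' - Re z *\<^sub>R h))\<^sup>2 + (Im z)\<^sup>2 * (norm h)\<^sup>2"
    using norm_free_dirac_diff[OF hg, of z] by (simp add: g'_def)
  have "(infdist z ?S * norm h)\<^sup>2 \<le> (norm g)\<^sup>2"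
  proof (cases "m \<le> \<bar>Re z\<bar>")
    case True
    have "infdist z ?S \<le> dist z (of_real (Re z))" by (rule infdist_le[OF S[OF True]])
    also have "\<dots> = \<bar>Im z\<bar>" by (simp add: dist_complex_def cmod_def)
    finally have "(infdist z ?S)\<^sup>2 \<le> \<bar>Im z\<bar>\<^sup>2" using infdist_nonneg by (rule power_mono)
    then have "(infdist z ?S)\<^sup>2 \<le> (Im z)\<^sup>2" unfolding power2_abs .
    then have "(infdist z ?S * norm h)\<^sup>2 \<le> (Im z)\<^sup>2 * (norm h)\<^sup>2"
      unfolding power_mult_distrib by (rule mult_right_mono) simp
    then show ?thesis unfolding n by (rule order_trans) simp
  next
    case False
    define l where "l = (if Re z \<ge> 0 then m else - m)"
    have "m \<le> \<bar>l\<bar>" using m by (simp add: l_def)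
    then have "infdist z ?S \<le> dist z (of_real l)" by (intro infdist_le S)
    then have "(infdist z ?S)\<^sup>2 \<le> (dist z (of_real l))\<^sup>2" using infdist_nonneg by (rule power_mono)
    also have "\<dots> = (m - \<bar>Re z\<bar>)\<^sup>2 + (Im z)\<^sup>2"
      unfolding dist_complex_def cmod_power2 by (simp add: l_def power2_commute[of m]) (simp add: power2_eq_square algebra_simps)
    finally have d: "(infdist z ?S)\<^sup>2 \<le> (m - \<bar>Re z\<bar>)\<^sup>2 + (Im z)\<^sup>2" .
    have "m * norm h \<le> norm g'" unfolding g'_def by (rule free_dirac_mass_gap[OF hg])
    then have "(m - \<bar>Re z\<bar>) * norm h \<le> norm (g' - Re z *\<^sub>R h)"
      using norm_triangle_ineq2[of g' "Re z *\<^sub>R h"] by (simp add: left_diff_distrib)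
    then have "((m - \<bar>Re z\<bar>) * norm h)\<^sup>2 \<le> (norm (g' - Re z *\<^sub>R h))\<^sup>2"
      using False by (intro power_mono) auto
    moreover have "(infdist z ?S * norm h)\<^sup>2 \<le> ((m - \<bar>Re z\<bar>)\<^sup>2 + (Im z)\<^sup>2) * (norm h)\<^sup>2"
      unfolding power_mult_distrib using d by (rule mult_right_mono) simp
    ultimately show ?thesis unfolding n distrib_right power_mult_distrib by linarith
  qed
  then have "infdist z ?S * norm h \<le> norm g" by (rule power2_le_imp_le) simp
  then show "norm (green_op g) \<le> norm g / infdist z ?S"
    using pos by (simp add: h_def field_simps)
qed

end

end

section \<open>The perturbed operator\<close>

lemma norm_mat_norm: "norm (M *v v) \<le> mat_norm M * norm v"
  unfolding mat_norm_def by (rule onorm[OF bounded_linear_matrix_vector])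

lemma mat_norm_nonneg: "0 \<le> mat_norm M"
  unfolding mat_norm_def by (rule onorm_pos_le[OF bounded_linear_matrix_vector])

lemma mat_norm_le_norm: "mat_norm M \<le> norm M"
  unfolding mat_norm_def by (rule onorm_le) (rule norm_matrix_vector_mult)

lemma norm_nth_le_mat_norm: "norm (M$i$j) \<le> mat_norm M"
proof -
  have "(M *v axis j 1)$i = M$i$j"
    using exhaust_2[of j] by (auto simp: mat2_vec_nth axis_def)
  then have "norm (M$i$j) \<le> norm (M *v axis j 1)"
    using Finite_Cartesian_Product.norm_nth_le[of "M *v axis j 1" i] by simp
  also have "\<dots> \<le> mat_norm M * norm (axis j 1 :: complex^2)" by (rule norm_mat_norm)
  also have "norm (axis j 1 :: complex^2) = 1"
    using exhaust_2[of j] by (auto simp: norm_vec2 axis_def)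
  finally show ?thesis by simp
qed

lemma norm_mat_le_sum: "norm M \<le> norm (M$1$1) + norm (M$1$2) + norm (M$2$1) + norm (M$2$2)"
  for M :: "complex^2^2"
  unfolding norm_mat2 by (rule real_le_lsqrt) (auto simp: power2_eq_square algebra_simps)

lemma norm_le_mat_norm: "norm M \<le> 4 * mat_norm M"
  using norm_mat_le_sum[of M] norm_nth_le_mat_norm[of M 1 1] norm_nth_le_mat_norm[of M 1 2]
    norm_nth_le_mat_norm[of M 2 1] norm_nth_le_mat_norm[of M 2 2] by linarith

lemma mat_norm_triangle: "mat_norm (M + N) \<le> mat_norm M + mat_norm N"
  unfolding mat_norm_def matrix_vector_mult_add_rdistrib
  by (rule onorm_triangle; rule bounded_linear_matrix_vector)

text \<open>By the triangle inequality the operator norm is 1-Lipschitz for the Frobenius norm,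
  hence continuous.\<close>

lemma borel_measurable_mat_norm [measurable]:
  assumes "f \<in> borel_measurable N"
  shows "(\<lambda>x. mat_norm (f x)) \<in> borel_measurable N"
proof -
  have "dist (mat_norm M) (mat_norm M') \<le> 1 * dist M M'" for M M'
    using mat_norm_triangle[of M' "M - M'"] mat_norm_triangle[of M "M' - M"]
      mat_norm_le_norm[of "M - M'"] mat_norm_le_norm[of "M' - M"]
    by (simp add: dist_norm norm_minus_commute abs_le_iff)
  then have "1-lipschitz_on UNIV mat_norm" by (intro lipschitz_onI) auto
  then have "continuous_on UNIV mat_norm" by (rule lipschitz_on_continuous_on)
  then show ?thesis by (intro measurable_compose[OF assms] borel_measurable_continuous_onI)
qed

lemma integrable_mat_norm:
  assumes W: "\<And>i j. integrable lebesgue (\<lambda>x. W x $ i $ j)"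
  shows "integrable lebesgue (\<lambda>x. mat_norm (W x))"
proof -
  have [measurable]: "W \<in> borel_measurable lebesgue"
    by (rule borel_measurable_matI) (use W in auto)
  have "integrable lebesgue (\<lambda>x. norm (W x$1$1) + norm (W x$1$2) + norm (W x$2$1) + norm (W x$2$2))"
    by (intro Bochner_Integration.integrable_add integrable_norm W)
  then show ?thesis
    by (rule Bochner_Integration.integrable_bound)
      (use mat_norm_nonneg order_trans[OF mat_norm_le_norm norm_mat_le_sum] in \<open>auto simp: abs_of_nonneg add_nonneg_nonneg\<close>)
qed

text \<open>A nonnegative 2x2 matrix with diagonal entries below 1 and \<open>det (1 - M) > 0\<close> has spectral
  radius below 1; the weight \<open>b\<close> provides a norm in which it is a contraction.\<close>

lemma contraction_weight:
  fixes a11 a12 a21 a22 :: real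
  assumes "0 \<le> a11" "a11 < 1" "0 \<le> a12" "0 \<le> a21" "0 \<le> a22" "a22 < 1" "a12 * a21 < (1 - a11) * (1 - a22)"
  obtains b q where "b > 0" "0 < q" "q < 1" "a11 + b * a21 \<le> q" "a12 + b * a22 \<le> q * b"
proof -
  \<comment> \<open>The two column conditions ask for b between \<open>a12 / (1 - a22)\<close> and
    \<open>(1 - a11) / a21\<close>; the determinant condition says that this interval is nonempty.
    For \<open>a21 = 0\<close> the upper end is absent.\<close>
  obtain b where b: "b > a12 / (1 - a22)" "b * a21 < 1 - a11"
  proof (cases "a21 = 0")
    case True
    then show ?thesis using assms by (intro that[of "a12 / (1 - a22) + 1"]) auto
  next
    case False
    then have "a12 / (1 - a22) < (1 - a11) / a21" using assms by (simp add: field_simps)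
    then obtain b where "a12 / (1 - a22) < b" "b < (1 - a11) / a21" using dense by blast
    then show ?thesis using False assms by (intro that[of b]) (auto simp: field_simps)
  qed
  have "0 \<le> a12 / (1 - a22)" using assms by simp
  then have "b > 0" using b(1) by linarith
  have "a12 < b * (1 - a22)" using b(1) assms by (simp add: field_simps)
  then have "(a12 + b * a22) / b < 1" using \<open>b > 0\<close> by (simp add: field_simps)
  \<comment> \<open>The value 1/2 only keeps q positive, because q will be divided by.\<close>
  define q where "q = max (1/2) (max (a11 + b * a21) ((a12 + b * a22) / b))"
  have "q < 1" "0 < q" "a11 + b * a21 \<le> q" "(a12 + b * a22) / b \<le> q"
    unfolding q_def using b(2) \<open>(a12 + b * a22) / b < 1\<close> by auto
  then show ?thesis using \<open>b > 0\<close> by (intro that[of b q]) (auto simp: field_simps)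
qed

text \<open>One decomposition is fixed, with X eliminated as V - W; the infimum over decompositions
  is treated in the final theorem.\<close>

locale dirac_perturbation = dirac_green +
  fixes V W :: "real \<Rightarrow> complex^2^2" and \<epsilon> :: real
  assumes m_nonneg: "m \<ge> 0" and rho: "z \<in> resolvent_set (free_dirac m)"
    and V_measurable [measurable]: "V \<in> borel_measurable lebesgue"
    and W_integrable: "\<And>i j. integrable lebesgue (\<lambda>x. W x $ i $ j)"
    and \<epsilon>_pos: "\<epsilon> > 0"
    and X_le: "AE x in lebesgue. mat_norm (V x - W x) \<le> \<epsilon>"
begin

definition "W_norm = (LINT x|lebesgue. mat_norm (W x))"
definition "gap = infdist z (op_spectrum (free_dirac m))"

lemma W_measurable [measurable]: "W \<in> borel_measurable lebesgue"
  by (rule borel_measurable_matI) (use W_integrable in auto)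

lemma W_norm_nonneg: "W_norm \<ge> 0"
  unfolding W_norm_def using mat_norm_nonneg by (simp add: integral_nonneg)

lemma gap_pos: "gap > 0"
  unfolding gap_def by (rule norm_green_op_infdist(1)[OF rho m_nonneg])

lemma norm_green_op_gap: "norm (green_op g) \<le> norm g / gap"
  unfolding gap_def by (rule norm_green_op_infdist(2)[OF rho m_nonneg])

lemma nn_integral_W: "(\<integral>\<^sup>+x. ennreal (mat_norm (W x)) \<partial>lebesgue) = ennreal W_norm"
  unfolding W_norm_def
  by (rule nn_integral_eq_integral[OF integrable_mat_norm[OF W_integrable]]) (simp add: mat_norm_nonneg)

lemma norm_V_le: "AE x in lebesgue. norm (V x) \<le> 4 * mat_norm (W x) + 4 * \<epsilon>"
  using X_le
proof eventually_elim
  case (elim x)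
  have "mat_norm (V x) \<le> mat_norm (W x) + mat_norm (V x - W x)"
    using mat_norm_triangle[of "W x" "V x - W x"] by simp
  with elim show ?case using norm_le_mat_norm[of "V x"] by linarith
qed

text \<open>The pair of bounds is the vector on which the 2x2 matrix of estimates acts. Functions
  are used instead of classes because \<open>green\<close> has a value at every point, which makes
  the supremum bound hold everywhere.\<close>

definition bounded_by :: "(real \<Rightarrow> complex^2) \<Rightarrow> real \<Rightarrow> real \<Rightarrow> bool" where
  "bounded_by h \<alpha> \<beta> \<longleftrightarrow> h \<in> L2_fun \<and> 0 \<le> \<alpha> \<and> 0 \<le> \<beta> \<and> (\<forall>x. norm (h x) \<le> \<alpha>) \<and> norm (abs_spinor h) \<le> \<beta>"

definition birman :: "(real \<Rightarrow> complex^2) \<Rightarrow> real \<Rightarrow> complex^2" where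
  "birman h = green (\<lambda>y. V y *v h y)"

lemma norm_abs_green_gap:
  assumes g: "g \<in> L2_fun" shows "norm (abs_spinor (green g)) \<le> norm (abs_spinor g) / gap"
proof -
  have [measurable]: "g \<in> borel_measurable lebesgue" using g by (simp add: L2_fun_def)
  have "green (rep_spinor (abs_spinor g)) = green g"
    by (rule ext, rule green_cong_AE[OF rep_abs_spinor[OF g]]) measurable
  then have "green_op (abs_spinor g) = abs_spinor (green g)" by (simp add: green_op_def)
  then show ?thesis using norm_green_op_gap[of "abs_spinor g"] by simp
qed

lemma abs_spinor_add:
  assumes "f \<in> L2_fun" "g \<in> L2_fun"
  shows "abs_spinor (\<lambda>x. f x + g x) = abs_spinor f + abs_spinor g"
  by (rule abs_spinor_eqI[OF L2_fun_add[OF assms], symmetric])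
    (use rep_spinor_plus[of "abs_spinor f" "abs_spinor g"] rep_abs_spinor[OF assms(1)] rep_abs_spinor[OF assms(2)]
      in \<open>eventually_elim, simp\<close>)

text \<open>W h has L^1 norm at most \<open>W_norm * \<alpha>\<close> and (V - W) h has L^2 norm at
  most \<open>\<epsilon> * \<beta>\<close>; each of the two target norms then receives one
  contribution from each part.\<close>

lemma bounded_by_birman:
  assumes "bounded_by h \<alpha> \<beta>"
  shows "bounded_by (birman h) (eta_z * W_norm * \<alpha> + eta_z / sqrt (Im k) * \<epsilon> * \<beta>)
    (eta_z / sqrt (Im k) * W_norm * \<alpha> + \<epsilon> / gap * \<beta>)"
proof -
  have h: "h \<in> L2_fun" "0 \<le> \<alpha>" "0 \<le> \<beta>" "\<And>x. norm (h x) \<le> \<alpha>" "norm (abs_spinor h) \<le> \<beta>"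
    using assms by (auto simp: bounded_by_def)
  have [measurable]: "h \<in> borel_measurable lebesgue" using h(1) by (simp add: L2_fun_def)
  define w where "w y = W y *v h y" for y
  define x where "x y = (V y - W y) *v h y" for y
  have [measurable]: "w \<in> borel_measurable lebesgue" unfolding w_def by measurable
  have [measurable]: "x \<in> borel_measurable lebesgue" unfolding x_def by measurable
  have le: "norm (w y) \<le> mat_norm (W y) * \<alpha>" for y
    unfolding w_def using h(4)[of y] mat_norm_nonneg[of "W y"]
    by (intro order_trans[OF norm_mat_norm] mult_left_mono)
  have i: "integrable lebesgue (\<lambda>y. mat_norm (W y) * \<alpha>)"
    using integrable_mat_norm[OF W_integrable] by simp
  have w: "integrable lebesgue w"
    by (rule Bochner_Integration.integrable_bound[OF i]) (use le h(2) mat_norm_nonneg in \<open>auto simp: abs_mult\<close>)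
  have "(LINT y|lebesgue. norm (w y)) \<le> (LINT y|lebesgue. mat_norm (W y) * \<alpha>)"
    by (rule integral_mono[OF integrable_norm[OF w] i le])
  then have W1: "(LINT y|lebesgue. norm (w y)) \<le> W_norm * \<alpha>" by (simp add: W_norm_def)
  have xle: "AE y in lebesgue. norm (x y) \<le> \<epsilon> * norm (h y)"
    using X_le
  proof eventually_elim
    case (elim y)
    have "norm (x y) \<le> mat_norm (V y - W y) * norm (h y)" unfolding x_def by (rule norm_mat_norm)
    also have "\<dots> \<le> \<epsilon> * norm (h y)" using elim by (rule mult_right_mono) simp
    finally show ?case .
  qed
  have xL2: "x \<in> L2_fun" and "norm (abs_spinor x) \<le> \<epsilon> * norm (abs_spinor h)"
    using L2_fun_dominated[OF h(1) _ xle] \<epsilon>_pos by auto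
  moreover have "\<epsilon> * norm (abs_spinor h) \<le> \<epsilon> * \<beta>" using h(5) \<epsilon>_pos by simp
  ultimately have X2: "norm (abs_spinor x) \<le> \<epsilon> * \<beta>" by linarith
  have eq: "birman h t = green w t + green x t" for t
  proof -
    have "birman h = green (\<lambda>y. w y + x y)"
      unfolding birman_def w_def x_def by (simp flip: matrix_vector_mult_add_rdistrib)
    then show ?thesis
      by (simp only:) (rule green_add; (rule norm_green_L1(1)[OF w] norm_green_L2(1)[OF xL2])?; measurable)
  qed
  note gw = green_L1_L2[OF w] and gx = green_L2(1)[OF xL2]
  have ek: "eta_z / sqrt (Im k) \<ge> 0" using eta_z_pos k_pos by simp
  have "norm (birman h t) \<le> eta_z * W_norm * \<alpha> + eta_z / sqrt (Im k) * \<epsilon> * \<beta>" for t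
  proof -
    have "norm (birman h t) \<le> norm (green w t) + norm (green x t)"
      unfolding eq by (rule norm_triangle_ineq)
    also have "\<dots> \<le> eta_z * (W_norm * \<alpha>) + eta_z / sqrt (Im k) * (\<epsilon> * \<beta>)"
      using W1 X2 eta_z_pos ek
      by (intro add_mono order_trans[OF norm_green_L1(2)[OF w]] order_trans[OF norm_green_L2(2)[OF xL2]] mult_left_mono) auto
    finally show ?thesis by (simp add: mult.assoc)
  qed
  moreover have "norm (abs_spinor (birman h)) \<le> eta_z / sqrt (Im k) * W_norm * \<alpha> + \<epsilon> / gap * \<beta>"
  proof -
    have "abs_spinor (birman h) = abs_spinor (green w) + abs_spinor (green x)"
      unfolding eq[abs_def] by (rule abs_spinor_add[OF gw(1) gx])
    then have "norm (abs_spinor (birman h)) \<le> norm (abs_spinor (green w)) + norm (abs_spinor (green x))"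
      by (simp add: norm_triangle_ineq)
    also have "\<dots> \<le> eta_z / sqrt (Im k) * (W_norm * \<alpha>) + (\<epsilon> * \<beta>) / gap"
      using W1 X2 ek gap_pos
      by (intro add_mono order_trans[OF gw(2)] order_trans[OF norm_abs_green_gap[OF xL2]] mult_left_mono divide_right_mono) auto
    finally show ?thesis by (simp add: mult.assoc)
  qed
  moreover have "birman h \<in> L2_fun" unfolding eq[abs_def] by (rule L2_fun_add[OF gw(1) gx])
  ultimately show ?thesis
    unfolding bounded_by_def using h(2,3) W_norm_nonneg eta_z_pos ek gap_pos \<epsilon>_pos k_pos by simp
qed

text \<open>Defined for every spinor f: B f need not be in L^2, but the integral against the kernel
  converges by \<open>green_B_bounds\<close>.\<close>

definition green_B :: "spinor \<Rightarrow> real \<Rightarrow> complex^2" where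
  "green_B f = green (\<lambda>y. mat_B (V y) *v rep_spinor f y)"

text \<open>A bound for the exponential convolution of 8 |V|: the factor 8 is that of
  \<open>norm_mat_B_vec\<close>, a further 4 is that of \<open>norm_V_le\<close>, and 2 /
  \<open>Im k\<close> is the integral of the exponential.\<close>

definition B_const :: real where "B_const = 32 * W_norm + 64 * \<epsilon> / Im k"

lemma B_const_nonneg: "B_const \<ge> 0"
  unfolding B_const_def using W_norm_nonneg \<epsilon>_pos k_pos by simp

lemma exp_conv_V: "exp_conv (Im k) (\<lambda>y. ennreal ((sqrt (8 * norm (V y)))\<^sup>2)) x \<le> ennreal B_const"
proof -
  have "exp_conv (Im k) (\<lambda>y. ennreal ((sqrt (8 * norm (V y)))\<^sup>2)) x
      \<le> (\<integral>\<^sup>+y. ennreal 32 * ennreal (mat_norm (W y)) + ennreal (32 * \<epsilon>) * ennreal (exp (- Im k * \<bar>x - y\<bar>)) \<partial>lebesgue)"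
    unfolding exp_conv_def
  proof (rule nn_integral_mono_AE)
    show "AE y in lebesgue. ennreal (exp (- Im k * \<bar>x - y\<bar>)) * ennreal ((sqrt (8 * norm (V y)))\<^sup>2)
        \<le> ennreal 32 * ennreal (mat_norm (W y)) + ennreal (32 * \<epsilon>) * ennreal (exp (- Im k * \<bar>x - y\<bar>))"
      using norm_V_le
    proof eventually_elim
      case (elim y)
      define e where "e = exp (- Im k * \<bar>x - y\<bar>)"
      have e: "0 \<le> e" "e \<le> 1" using k_pos by (simp_all add: e_def)
      have "e * (8 * norm (V y)) \<le> e * (32 * mat_norm (W y) + 32 * \<epsilon>)"
        using elim e by (intro mult_left_mono) auto
      also have "\<dots> = e * (32 * mat_norm (W y)) + 32 * \<epsilon> * e" by (simp add: algebra_simps)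
      also have "\<dots> \<le> 1 * (32 * mat_norm (W y)) + 32 * \<epsilon> * e"
        using e mat_norm_nonneg[of "W y"] by (intro add_right_mono mult_right_mono) auto
      finally have "e * (sqrt (8 * norm (V y)))\<^sup>2 \<le> 32 * mat_norm (W y) + 32 * \<epsilon> * e" by simp
      then have "ennreal (e * (sqrt (8 * norm (V y)))\<^sup>2) \<le> ennreal (32 * mat_norm (W y) + 32 * \<epsilon> * e)"
        by (rule ennreal_leI)
      then show ?case
        unfolding e_def[symmetric] using e(1) mat_norm_nonneg[of "W y"] \<epsilon>_pos
        by (simp only: ennreal_mult ennreal_plus mult_nonneg_nonneg zero_le_numeral less_imp_le zero_le_power2)
    qed
  qed
  also have "\<dots> = ennreal 32 * ennreal W_norm + ennreal (32 * \<epsilon>) * ennreal (2 / Im k)"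
  proof -
    have "(\<integral>\<^sup>+y. ennreal 32 * ennreal (mat_norm (W y)) \<partial>lebesgue) = ennreal 32 * ennreal W_norm"
      unfolding nn_integral_W[symmetric] by (rule nn_integral_cmult) measurable
    moreover have "(\<integral>\<^sup>+y. ennreal (32 * \<epsilon>) * ennreal (exp (- Im k * \<bar>x - y\<bar>)) \<partial>lebesgue) = ennreal (32 * \<epsilon>) * ennreal (2 / Im k)"
    proof -
      have "(\<integral>\<^sup>+y. ennreal (32 * \<epsilon>) * ennreal (exp (- Im k * \<bar>x - y\<bar>)) \<partial>lebesgue)
          = ennreal (32 * \<epsilon>) * (\<integral>\<^sup>+y. ennreal (exp (- Im k * \<bar>x - y\<bar>)) \<partial>lebesgue)"
        by (rule nn_integral_cmult) measurable
      then show ?thesis unfolding nn_integral_exp_abs(1)[OF k_pos] .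
    qed
    moreover have "(\<integral>\<^sup>+y. ennreal 32 * ennreal (mat_norm (W y)) + ennreal (32 * \<epsilon>) * ennreal (exp (- Im k * \<bar>x - y\<bar>)) \<partial>lebesgue)
        = (\<integral>\<^sup>+y. ennreal 32 * ennreal (mat_norm (W y)) \<partial>lebesgue)
        + (\<integral>\<^sup>+y. ennreal (32 * \<epsilon>) * ennreal (exp (- Im k * \<bar>x - y\<bar>)) \<partial>lebesgue)"
      by (rule nn_integral_add) measurable
    ultimately show ?thesis by (simp only:)
  qed
  also have "\<dots> = ennreal B_const"
  proof -
    have "B_const = 32 * W_norm + (32 * \<epsilon>) * (2 / Im k)" by (simp add: B_const_def)
    then show ?thesis
      using W_norm_nonneg \<epsilon>_pos k_pos
      by (simp only: ennreal_mult ennreal_plus mult_nonneg_nonneg zero_le_numeral less_imp_le divide_nonneg_nonneg)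
  qed
  finally show ?thesis .
qed

lemma mat_B_measurable [measurable]:
  "h \<in> borel_measurable lebesgue \<Longrightarrow> (\<lambda>y. mat_B (V y) *v h y) \<in> borel_measurable lebesgue"
  by measurable

lemma norm_mat_B_le: "norm (mat_B (V y) *v v) \<le> sqrt (8 * norm (V y)) * norm v"
  by (rule power2_le_imp_le) (simp_all add: power_mult_distrib norm_mat_B_vec)

lemma green_B_bounds:
  shows "exp_conv (Im k) (\<lambda>y. ennreal (norm (mat_B (V y) *v rep_spinor f y))) x < \<infinity>"
    and "bounded_by (green_B f) (eta_z * sqrt B_const * norm f) (eta_z * sqrt (B_const * (2 / Im k)) * norm f)"
proof -
  have m: "(\<lambda>y. mat_B (V y) *v rep_spinor f y) \<in> borel_measurable lebesgue" by measurable
  have m': "(\<lambda>y. sqrt (8 * norm (V y))) \<in> borel_measurable lebesgue" by measurable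
  note * = green_weighted[OF m rep_spinor_L2[of f] m' B_const_nonneg norm_mat_B_le _ exp_conv_V]
  show "exp_conv (Im k) (\<lambda>y. ennreal (norm (mat_B (V y) *v rep_spinor f y))) x < \<infinity>"
    by (rule *(1)) simp
  have "norm (green_B f x) \<le> eta_z * sqrt B_const * norm f" for x
    unfolding green_B_def using *(2)[of x] by (simp add: abs_rep_spinor mult.assoc)
  moreover have "green_B f \<in> L2_fun" unfolding green_B_def by (rule *(3)) simp
  moreover have "norm (abs_spinor (green_B f)) \<le> eta_z * sqrt (B_const * (2 / Im k)) * norm f"
    unfolding green_B_def using *(4) by (simp add: abs_rep_spinor mult.assoc)
  ultimately show "bounded_by (green_B f) (eta_z * sqrt B_const * norm f) (eta_z * sqrt (B_const * (2 / Im k)) * norm f)"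
    unfolding bounded_by_def using eta_z_pos k_pos B_const_nonneg by simp
qed

text \<open>A alone may leave L^2. Since |A h|^2 is at most 2 |V| |h|^2, the W part is integrated
  against the supremum bound and the rest against the L^2 bound; this is why both bounds are carried
  along.\<close>

lemma mat_A_bounds:
  assumes "bounded_by h \<alpha> \<beta>"
  shows "(\<lambda>x. mat_A (V x) *v h x) \<in> L2_fun"
    and "norm (abs_spinor (\<lambda>x. mat_A (V x) *v h x)) \<le> sqrt (8 * W_norm) * \<alpha> + sqrt (8 * \<epsilon>) * \<beta>"
proof -
  have h: "h \<in> L2_fun" "0 \<le> \<alpha>" "0 \<le> \<beta>" "\<And>x. norm (h x) \<le> \<alpha>" "norm (abs_spinor h) \<le> \<beta>"
    using assms by (auto simp: bounded_by_def)
  have [measurable]: "h \<in> borel_measurable lebesgue" using h(1) by (simp add: L2_fun_def)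
  let ?c = "sqrt (8 * W_norm) * \<alpha> + sqrt (8 * \<epsilon>) * \<beta>"
  have c: "?c \<ge> 0" using h W_norm_nonneg \<epsilon>_pos by simp
  have "(\<integral>\<^sup>+x. ennreal ((norm (mat_A (V x) *v h x))\<^sup>2) \<partial>lebesgue)
      \<le> (\<integral>\<^sup>+x. ennreal (8 * \<alpha>\<^sup>2) * ennreal (mat_norm (W x)) + ennreal (8 * \<epsilon>) * ennreal ((norm (h x))\<^sup>2) \<partial>lebesgue)"
  proof (rule nn_integral_mono_AE)
    show "AE x in lebesgue. ennreal ((norm (mat_A (V x) *v h x))\<^sup>2)
        \<le> ennreal (8 * \<alpha>\<^sup>2) * ennreal (mat_norm (W x)) + ennreal (8 * \<epsilon>) * ennreal ((norm (h x))\<^sup>2)"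
      using norm_V_le
    proof eventually_elim
      case (elim x)
      have "(norm (mat_A (V x) *v h x))\<^sup>2 \<le> 2 * norm (V x) * (norm (h x))\<^sup>2" by (rule norm_mat_A_vec)
      also have "\<dots> \<le> (8 * mat_norm (W x) + 8 * \<epsilon>) * (norm (h x))\<^sup>2"
        using elim by (intro mult_right_mono) auto
      also have "\<dots> = 8 * mat_norm (W x) * (norm (h x))\<^sup>2 + 8 * \<epsilon> * (norm (h x))\<^sup>2" by (simp add: algebra_simps)
      also have "\<dots> \<le> 8 * mat_norm (W x) * \<alpha>\<^sup>2 + 8 * \<epsilon> * (norm (h x))\<^sup>2"
        using h(4)[of x] mat_norm_nonneg[of "W x"] by (intro add_right_mono mult_left_mono power_mono) auto
      finally have "ennreal ((norm (mat_A (V x) *v h x))\<^sup>2) \<le> ennreal (8 * \<alpha>\<^sup>2 * mat_norm (W x) + 8 * \<epsilon> * (norm (h x))\<^sup>2)"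
        by (intro ennreal_leI) (simp add: mult_ac)
      then show ?case
        using mat_norm_nonneg[of "W x"] \<epsilon>_pos
        by (simp only: ennreal_mult ennreal_plus mult_nonneg_nonneg zero_le_numeral less_imp_le zero_le_power2)
    qed
  qed
  also have "\<dots> = (\<integral>\<^sup>+x. ennreal (8 * \<alpha>\<^sup>2) * ennreal (mat_norm (W x)) \<partial>lebesgue)
      + (\<integral>\<^sup>+x. ennreal (8 * \<epsilon>) * ennreal ((norm (h x))\<^sup>2) \<partial>lebesgue)"
    by (rule nn_integral_add) measurable
  also have "(\<integral>\<^sup>+x. ennreal (8 * \<alpha>\<^sup>2) * ennreal (mat_norm (W x)) \<partial>lebesgue) = ennreal (8 * \<alpha>\<^sup>2) * ennreal W_norm"
    unfolding nn_integral_W[symmetric] by (rule nn_integral_cmult) measurable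
  also have "(\<integral>\<^sup>+x. ennreal (8 * \<epsilon>) * ennreal ((norm (h x))\<^sup>2) \<partial>lebesgue) = ennreal (8 * \<epsilon>) * ennreal ((norm (abs_spinor h))\<^sup>2)"
    unfolding nn_integral_abs_spinor[OF h(1), symmetric] by (rule nn_integral_cmult) measurable
  also have "ennreal (8 * \<alpha>\<^sup>2) * ennreal W_norm + ennreal (8 * \<epsilon>) * ennreal ((norm (abs_spinor h))\<^sup>2)
      = ennreal (8 * \<alpha>\<^sup>2 * W_norm + 8 * \<epsilon> * (norm (abs_spinor h))\<^sup>2)"
    using W_norm_nonneg \<epsilon>_pos by (simp flip: ennreal_mult ennreal_plus)
  also have "\<dots> \<le> ennreal (?c\<^sup>2)"
  proof (rule ennreal_leI)
    have "8 * \<epsilon> * (norm (abs_spinor h))\<^sup>2 \<le> 8 * \<epsilon> * \<beta>\<^sup>2"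
      using h(5) \<epsilon>_pos by (intro mult_left_mono power_mono) auto
    then have "8 * \<alpha>\<^sup>2 * W_norm + 8 * \<epsilon> * (norm (abs_spinor h))\<^sup>2 \<le> (sqrt (8 * W_norm) * \<alpha>)\<^sup>2 + (sqrt (8 * \<epsilon>) * \<beta>)\<^sup>2"
      using W_norm_nonneg \<epsilon>_pos by (simp add: power_mult_distrib mult_ac)
    also have "\<dots> \<le> ?c\<^sup>2"
      using h W_norm_nonneg \<epsilon>_pos by (simp add: power2_sum)
    finally show "8 * \<alpha>\<^sup>2 * W_norm + 8 * \<epsilon> * (norm (abs_spinor h))\<^sup>2 \<le> ?c\<^sup>2" .
  qed
  finally have *: "(\<integral>\<^sup>+x. ennreal ((norm (mat_A (V x) *v h x))\<^sup>2) \<partial>lebesgue) \<le> ennreal (?c\<^sup>2)" .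
  have m: "(\<lambda>x. mat_A (V x) *v h x) \<in> borel_measurable lebesgue" by measurable
  show "(\<lambda>x. mat_A (V x) *v h x) \<in> L2_fun" "norm (abs_spinor (\<lambda>x. mat_A (V x) *v h x)) \<le> ?c"
    by (rule L2_funI[OF m * c])+
qed

text \<open>An explicit formula for \<open>Q(z)\<close> on all of L^2; it is shown below to be the
  closure used in \<open>bs_opr\<close>.\<close>

definition birman_op :: "spinor \<Rightarrow> spinor" where
  "birman_op f = abs_spinor (\<lambda>x. mat_A (V x) *v green_B f x)"

lemma rep_birman_op: "AE x in lebesgue. rep_spinor (birman_op f) x = mat_A (V x) *v green_B f x"
  unfolding birman_op_def by (rule rep_abs_spinor[OF mat_A_bounds(1)[OF green_B_bounds(2)]])

lemma bounded_linear_birman_op: "bounded_linear birman_op"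
proof (rule bounded_linear_intro[where K = "sqrt (8 * W_norm) * (eta_z * sqrt B_const) + sqrt (8 * \<epsilon>) * (eta_z * sqrt (B_const * (2 / Im k)))"])
  fix f g r
  have "green_B (f + g) x = green_B f x + green_B g x" for x
  proof -
    have "green_B (f + g) x = green (\<lambda>y. mat_B (V y) *v rep_spinor f y + mat_B (V y) *v rep_spinor g y) x"
      unfolding green_B_def
    proof (rule green_cong_AE)
      show "AE y in lebesgue. mat_B (V y) *v rep_spinor (f + g) y = mat_B (V y) *v rep_spinor f y + mat_B (V y) *v rep_spinor g y"
        using rep_spinor_plus[of f g] by eventually_elim (simp add: matrix_vector_right_distrib)
    qed measurable
    also have "\<dots> = green_B f x + green_B g x"
      unfolding green_B_def by (rule green_add; (rule green_B_bounds(1))?; measurable)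
    finally show ?thesis .
  qed
  then have "(\<lambda>x. mat_A (V x) *v green_B (f + g) x) = (\<lambda>x. mat_A (V x) *v green_B f x + mat_A (V x) *v green_B g x)"
    by (simp add: matrix_vector_right_distrib)
  then show "birman_op (f + g) = birman_op f + birman_op g"
    unfolding birman_op_def by (simp add: abs_spinor_add mat_A_bounds(1)[OF green_B_bounds(2)])
  have "green_B (r *\<^sub>R f) x = r *\<^sub>R green_B f x" for x
    unfolding green_B_def green_scaleR[symmetric]
  proof (rule green_cong_AE)
    show "AE y in lebesgue. mat_B (V y) *v rep_spinor (r *\<^sub>R f) y = r *\<^sub>R (mat_B (V y) *v rep_spinor f y)"
      using rep_spinor_scaleR[of r f] by eventually_elim (simp add: matrix_vector_mult_scaleR)
  qed measurable
  then show "birman_op (r *\<^sub>R f) = r *\<^sub>R birman_op f"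
    unfolding birman_op_def[of "r *\<^sub>R f"]
    by (intro abs_spinor_eqI[symmetric] mat_A_bounds(1)[OF green_B_bounds(2)])
      (use rep_spinor_scaleR[of r "birman_op f"] rep_birman_op[of f] in \<open>eventually_elim, simp add: matrix_vector_mult_scaleR\<close>)
  show "norm (birman_op f) \<le> norm f * (sqrt (8 * W_norm) * (eta_z * sqrt B_const) + sqrt (8 * \<epsilon>) * (eta_z * sqrt (B_const * (2 / Im k))))"
    using mat_A_bounds(2)[OF green_B_bounds(2), of f] unfolding birman_op_def[symmetric] by (simp add: algebra_simps)
qed

text \<open>The intertwining of \<open>Q(z) A\<close> with \<open>A G V\<close>, from
  \<open>B A = V\<close>. It moves the iteration from L^2 to the pairs of bounds.\<close>

lemma birman_op_mat_A:
  assumes "bounded_by h \<alpha> \<beta>"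
  shows "birman_op (abs_spinor (\<lambda>x. mat_A (V x) *v h x)) = abs_spinor (\<lambda>x. mat_A (V x) *v birman h x)"
proof -
  have h [measurable]: "h \<in> borel_measurable lebesgue" using assms by (auto simp: bounded_by_def L2_fun_def)
  have "green_B (abs_spinor (\<lambda>x. mat_A (V x) *v h x)) x = birman h x" for x
    unfolding green_B_def birman_def
  proof (rule green_cong_AE)
    show "AE y in lebesgue. mat_B (V y) *v rep_spinor (abs_spinor (\<lambda>x. mat_A (V x) *v h x)) y = V y *v h y"
      using rep_abs_spinor[OF mat_A_bounds(1)[OF assms]] by eventually_elim (simp add: mat_B_mat_A)
  qed measurable
  then show ?thesis by (simp add: birman_op_def)
qed

lemma birman_op_power:
  "(birman_op ^^ Suc n) f = abs_spinor (\<lambda>x. mat_A (V x) *v (birman ^^ n) (green_B f) x)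
    \<and> (\<exists>\<alpha> \<beta>. bounded_by ((birman ^^ n) (green_B f)) \<alpha> \<beta>)"
proof (induction n)
  case 0
  then show ?case using green_B_bounds(2) by (auto simp: birman_op_def)
next
  case (Suc n)
  then obtain \<alpha> \<beta> where b: "bounded_by ((birman ^^ n) (green_B f)) \<alpha> \<beta>" by auto
  have "(birman_op ^^ Suc (Suc n)) f = birman_op ((birman_op ^^ Suc n) f)" by simp
  also have "\<dots> = abs_spinor (\<lambda>x. mat_A (V x) *v (birman ^^ Suc n) (green_B f) x)"
    using Suc birman_op_mat_A[OF b] by (simp del: funpow.simps add: funpow.simps(2)[of n birman])
  finally show ?case using bounded_by_birman[OF b] by auto
qed

context
  assumes small: "eta_z * W_norm < 1"
    and det: "1 / gap + eta_z\<^sup>2 / Im k * (W_norm / (1 - eta_z * W_norm)) < 1 / \<epsilon>"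
begin

text \<open>Multiplying \<open>det\<close> by \<open>\<epsilon> * (1 - a11)\<close> gives
  \<open>a12 * a21 < (1 - a11) * (1 - a22)\<close>, the condition of
  \<open>contraction_weight\<close>. The combination \<open>\<alpha> + b * \<beta>\<close> then
  shrinks by q in each step, and A at the end converts it to an L^2 norm.\<close>

lemma birman_op_invertible:
  obtains S where "bounded_linear S" "\<And>f. S (f + birman_op f) = f" "\<And>f. S f + birman_op (S f) = f"
proof -
  define a11 a12 a21 a22 where "a11 = eta_z * W_norm" and "a12 = eta_z / sqrt (Im k) * \<epsilon>"
    and "a21 = eta_z / sqrt (Im k) * W_norm" and "a22 = \<epsilon> / gap"
  have nonneg: "0 \<le> a11" "0 \<le> a12" "0 \<le> a21" "0 \<le> a22"
    using eta_z_pos W_norm_nonneg \<epsilon>_pos gap_pos k_pos by (simp_all add: a11_def a12_def a21_def a22_def)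
  define r where "r = eta_z\<^sup>2 / Im k * W_norm"
  have r: "r \<ge> 0" using eta_z_pos W_norm_nonneg k_pos by (simp add: r_def)
  have 1: "1 / gap + r / (1 - a11) < 1 / \<epsilon>" using det by (simp add: r_def a11_def)
  have "a11 < 1" using small by (simp add: a11_def)
  have "\<epsilon> * (1 / gap + r / (1 - a11)) < 1"
    using mult_strict_left_mono[OF 1 \<epsilon>_pos] \<epsilon>_pos by simp
  then have 2: "a22 + \<epsilon> * r / (1 - a11) < 1" by (simp add: a22_def distrib_left)
  moreover have "0 \<le> \<epsilon> * r / (1 - a11)" using \<epsilon>_pos r \<open>a11 < 1\<close> by simp
  ultimately have "a22 < 1" by linarith
  have "\<epsilon> * r / (1 - a11) * (1 - a11) < (1 - a22) * (1 - a11)"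
    using 2 \<open>a11 < 1\<close> by (intro mult_strict_right_mono) auto
  then have "\<epsilon> * r < (1 - a11) * (1 - a22)" using \<open>a11 < 1\<close> by (simp add: mult.commute)
  moreover have "a12 * a21 = \<epsilon> * r"
  proof -
    have "a12 * a21 = eta_z * eta_z / (sqrt (Im k) * sqrt (Im k)) * (\<epsilon> * W_norm)"
      by (simp add: a12_def a21_def)
    also have "\<dots> = \<epsilon> * r"
      using k_pos by (simp add: r_def power2_eq_square)
    finally show ?thesis .
  qed
  ultimately have "a12 * a21 < (1 - a11) * (1 - a22)" by simp
  then obtain b q where bq: "b > 0" "0 < q" "q < 1" "a11 + b * a21 \<le> q" "a12 + b * a22 \<le> q * b"
    by (rule contraction_weight[OF nonneg(1) \<open>a11 < 1\<close> nonneg(2-4) \<open>a22 < 1\<close>])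
  define a0 b0 where "a0 = eta_z * sqrt B_const" and "b0 = eta_z * sqrt (B_const * (2 / Im k))"
  have ab0: "a0 \<ge> 0" "b0 \<ge> 0" using eta_z_pos B_const_nonneg k_pos by (simp_all add: a0_def b0_def)
  have iter: "\<exists>\<alpha> \<beta>. bounded_by ((birman ^^ n) (green_B f)) \<alpha> \<beta> \<and> \<alpha> + b * \<beta> \<le> q ^ n * ((a0 + b * b0) * norm f)" for n f
  proof (induction n)
    case 0
    show ?case
      using green_B_bounds(2)[of f] by (intro exI[of _ "a0 * norm f"] exI[of _ "b0 * norm f"]) (simp add: a0_def b0_def algebra_simps)
  next
    case (Suc n)
    then obtain \<alpha> \<beta> where ab: "bounded_by ((birman ^^ n) (green_B f)) \<alpha> \<beta>" "\<alpha> + b * \<beta> \<le> q ^ n * ((a0 + b * b0) * norm f)" by blast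
    then have ab': "\<alpha> \<ge> 0" "\<beta> \<ge> 0" by (auto simp: bounded_by_def)
    have "bounded_by ((birman ^^ Suc n) (green_B f)) (a11 * \<alpha> + a12 * \<beta>) (a21 * \<alpha> + a22 * \<beta>)"
      using bounded_by_birman[OF ab(1)] by (simp add: a11_def a12_def a21_def a22_def)
    moreover have "(a11 * \<alpha> + a12 * \<beta>) + b * (a21 * \<alpha> + a22 * \<beta>) \<le> q ^ Suc n * ((a0 + b * b0) * norm f)"
    proof -
      have "(a11 * \<alpha> + a12 * \<beta>) + b * (a21 * \<alpha> + a22 * \<beta>) = (a11 + b * a21) * \<alpha> + (a12 + b * a22) * \<beta>"
        by (simp add: algebra_simps)
      also have "\<dots> \<le> q * \<alpha> + q * b * \<beta>"
        using bq ab' by (intro add_mono mult_right_mono) auto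
      also have "\<dots> = q * (\<alpha> + b * \<beta>)" by (simp add: algebra_simps)
      also have "\<dots> \<le> q * (q ^ n * ((a0 + b * b0) * norm f))"
        using ab(2) bq(2) by (intro mult_left_mono) auto
      finally show ?thesis by (simp add: mult.assoc)
    qed
    ultimately show ?case by blast
  qed
  define K where "K = sqrt (8 * W_norm) + sqrt (8 * \<epsilon>) / b"
  have K: "K \<ge> 0" using W_norm_nonneg \<epsilon>_pos bq(1) by (simp add: K_def)
  \<comment> \<open>The n-th power contains only n - 1 factors \<open>G V\<close>, which costs the
    division by q. The maximum with 1 covers n = 0, where the operator is the identity.\<close>
  define c where "c = max 1 (K * (a0 + b * b0) / q)"
  have pow: "norm ((birman_op ^^ n) f) \<le> c * q ^ n * norm f" for n f
  proof (cases n)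
    case 0
    have "1 * norm f \<le> c * norm f" by (intro mult_right_mono) (auto simp: c_def)
    then show ?thesis using 0 by simp
  next
    case (Suc j)
    obtain \<alpha> \<beta> where ab: "bounded_by ((birman ^^ j) (green_B f)) \<alpha> \<beta>" "\<alpha> + b * \<beta> \<le> q ^ j * ((a0 + b * b0) * norm f)"
      using iter by blast
    then have ab': "\<alpha> \<ge> 0" "\<beta> \<ge> 0" by (auto simp: bounded_by_def)
    have "(birman_op ^^ n) f = abs_spinor (\<lambda>x. mat_A (V x) *v (birman ^^ j) (green_B f) x)"
      unfolding Suc using birman_op_power by blast
    then have "norm ((birman_op ^^ n) f) \<le> sqrt (8 * W_norm) * \<alpha> + sqrt (8 * \<epsilon>) * \<beta>"
      using mat_A_bounds(2)[OF ab(1)] by simp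
    also have "\<dots> \<le> K * (\<alpha> + b * \<beta>)"
    proof -
      have "K * (\<alpha> + b * \<beta>) = sqrt (8 * W_norm) * \<alpha> + sqrt (8 * \<epsilon>) * \<beta> + (sqrt (8 * W_norm) * (b * \<beta>) + sqrt (8 * \<epsilon>) / b * \<alpha>)"
        using bq(1) by (simp add: K_def distrib_left distrib_right)
      moreover have "0 \<le> sqrt (8 * W_norm) * (b * \<beta>) + sqrt (8 * \<epsilon>) / b * \<alpha>"
        using ab' bq(1) W_norm_nonneg \<epsilon>_pos by simp
      ultimately show ?thesis by linarith
    qed
    also have "\<dots> \<le> K * (q ^ j * ((a0 + b * b0) * norm f))"
      using ab(2) K by (rule mult_left_mono)
    also have "\<dots> = (K * (a0 + b * b0) / q) * (q ^ n * norm f)"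
      using bq(2) by (simp add: Suc)
    also have "\<dots> \<le> c * (q ^ n * norm f)"
      using bq(2) by (intro mult_right_mono) (auto simp: c_def)
    finally show ?thesis by (simp add: mult.assoc)
  qed
  show ?thesis
    by (rule Neumann_series[OF bounded_linear_birman_op less_imp_le[OF bq(2)] bq(3) pow that])
qed

lemma factor_A_iff: "(f, h) \<in> factor_A V \<longleftrightarrow> (AE x in lebesgue. rep_spinor h x = mat_A (V x) *v rep_spinor f x)"
  by (simp add: factor_A_def mult_opr_def mat_A_def)

lemma factor_B_iff: "(f, h) \<in> factor_B V \<longleftrightarrow> (AE x in lebesgue. rep_spinor h x = mat_B (V x) *v rep_spinor f x)"
  by (simp add: factor_B_def mult_opr_def mat_B_def)

lemma resolvent_free_dirac_iff: "(g, h) \<in> resolvent (free_dirac m) z \<longleftrightarrow> h = green_op g"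
  by (simp add: resolvent_def opr_diff_scalar_iff free_dirac_iff_green_op[OF rho])

text \<open>Once f is in the domain of B, the composition never leaves a domain: the resolvent is
  everywhere defined, and its value at B f agrees with \<open>green_B f\<close>, which A maps into
  L^2.\<close>

lemma unclosed_birman: "opr_mult (factor_A V) (opr_mult (resolvent (free_dirac m) z) (factor_B V))
    = {(f, birman_op f) | f. f \<in> Domain (factor_B V)}"
proof -
  have *: "(green_op u, h) \<in> factor_A V \<longleftrightarrow> h = birman_op f" if u: "(f, u) \<in> factor_B V" for f u h
  proof -
    have u: "AE x in lebesgue. rep_spinor u x = mat_B (V x) *v rep_spinor f x"
      using u by (simp add: factor_B_iff)
    have eq: "green (rep_spinor u) x = green_B f x" for x
      unfolding green_B_def by (rule green_cong_AE[OF u]) measurable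
    have gu: "AE x in lebesgue. rep_spinor (green_op u) x = green_B f x"
      using rep_green_op[of u] by (simp add: eq)
    show ?thesis
    proof
      assume "(green_op u, h) \<in> factor_A V"
      then have "AE x in lebesgue. rep_spinor h x = mat_A (V x) *v rep_spinor (green_op u) x"
        by (simp add: factor_A_iff)
      then show "h = birman_op f"
        unfolding spinor_eq_iff using gu rep_birman_op[of f] by eventually_elim simp
    next
      assume "h = birman_op f"
      then show "(green_op u, h) \<in> factor_A V"
        unfolding factor_A_iff using gu rep_birman_op[of f] by (auto elim!: eventually_elim2)
    qed
  qed
  show ?thesis
    unfolding opr_mult_def
    by (auto simp: relcomp_unfold resolvent_free_dirac_iff *)
qed

text \<open>Cutting f off where |V| exceeds n puts it into the domain of B, and dominated
  convergence restores f.\<close>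

lemma Domain_factor_B_dense: "closure (Domain (factor_B V)) = UNIV"
proof -
  have "f \<in> closure (Domain (factor_B V))" for f
    unfolding closure_sequential
  proof (intro exI conjI allI)
    define c where "c n x = (if norm (V x) \<le> real n then rep_spinor f x else 0)" for n :: nat and x
    have m [measurable]: "c n \<in> borel_measurable lebesgue" for n
      unfolding c_def by measurable
    have cL2: "c n \<in> L2_fun" for n
      by (rule L2_fun_dominated(1)[OF rep_spinor_L2[of f] m, where c = 1]) (auto simp: c_def)
    show "abs_spinor (c n) \<in> Domain (factor_B V)" for n
    proof
      have BL2: "(\<lambda>x. mat_B (V x) *v c n x) \<in> L2_fun"
      proof (rule L2_fun_dominated(1)[OF cL2[of n]])
        have "norm (mat_B (V x) *v c n x) \<le> sqrt (8 * real n) * norm (c n x)" for x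
        proof (cases "norm (V x) \<le> real n")
          case True
          have "norm (mat_B (V x) *v c n x) \<le> sqrt (8 * norm (V x)) * norm (c n x)" by (rule norm_mat_B_le)
          also have "\<dots> \<le> sqrt (8 * real n) * norm (c n x)" using True by (intro mult_right_mono) auto
          finally show ?thesis .
        qed (simp add: c_def)
        then show "AE x in lebesgue. norm (mat_B (V x) *v c n x) \<le> sqrt (8 * real n) * norm (c n x)" by simp
        show "(\<lambda>x. mat_B (V x) *v c n x) \<in> borel_measurable lebesgue" by (rule mat_B_measurable[OF m])
      qed simp
      show "(abs_spinor (c n), abs_spinor (\<lambda>x. mat_B (V x) *v c n x)) \<in> factor_B V"
        unfolding factor_B_iff using rep_abs_spinor[OF cL2[of n]] rep_abs_spinor[OF BL2] by eventually_elim simp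
    qed
    show "(\<lambda>n. abs_spinor (c n)) \<longlonglongrightarrow> f"
    proof -
      have norm2: "(norm (f - abs_spinor (c n)))\<^sup>2 = (LINT x|lebesgue. (norm (rep_spinor f x - c n x))\<^sup>2)" for n
        unfolding norm_spinor_square
      proof (rule integral_cong_AE)
        show "AE x in lebesgue. (norm (rep_spinor (f - abs_spinor (c n)) x))\<^sup>2 = (norm (rep_spinor f x - c n x))\<^sup>2"
          using rep_spinor_diff[of f "abs_spinor (c n)"] rep_abs_spinor[OF cL2[of n]] by eventually_elim simp
      qed measurable
      have "(\<lambda>n. LINT x|lebesgue. (norm (rep_spinor f x - c n x))\<^sup>2) \<longlonglongrightarrow> (LINT x|(lebesgue :: real measure). 0)"
      proof (rule integral_dominated_convergence[where w = "\<lambda>x. (norm (rep_spinor f x))\<^sup>2"])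
        show "integrable lebesgue (\<lambda>x. (norm (rep_spinor f x))\<^sup>2)" by (rule integrable_rep_spinor)
        have "(\<lambda>n. (norm (rep_spinor f x - c n x))\<^sup>2) \<longlonglongrightarrow> 0" for x
        proof -
          obtain N where N: "norm (V x) \<le> real N" using real_arch_simple by blast
          have "\<forall>\<^sub>F n in sequentially. (norm (rep_spinor f x - c n x))\<^sup>2 = 0"
            using eventually_ge_at_top[of N] by eventually_elim (use N in \<open>auto simp: c_def\<close>)
          then show ?thesis by (rule tendsto_eventually)
        qed
        then show "AE x in lebesgue. (\<lambda>n. (norm (rep_spinor f x - c n x))\<^sup>2) \<longlonglongrightarrow> 0" by simp
        show "AE x in lebesgue. norm ((norm (rep_spinor f x - c n x))\<^sup>2) \<le> (norm (rep_spinor f x))\<^sup>2" for n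
          by (auto simp: c_def)
      qed measurable
      then have "(\<lambda>n. (norm (f - abs_spinor (c n)))\<^sup>2) \<longlonglongrightarrow> 0" by (simp add: norm2)
      then have "(\<lambda>n. sqrt ((norm (f - abs_spinor (c n)))\<^sup>2)) \<longlonglongrightarrow> sqrt 0" by (rule tendsto_real_sqrt)
      then have "(\<lambda>n. dist (abs_spinor (c n)) f) \<longlonglongrightarrow> 0" by (simp add: dist_norm norm_minus_commute)
      then show ?thesis by (rule tendsto_dist_iff[THEN iffD2])
    qed
  qed
  then show ?thesis by auto
qed

lemma mem_bs_set: "z \<in> bs_set m V"
proof -
  have bs: "bs_opr m V z = {(f, birman_op f) | f. True}"
    unfolding bs_opr_def unclosed_birman
    by (rule closure_bounded_linear_graph[OF bounded_linear_birman_op Domain_factor_B_dense])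
  obtain S where S: "bounded_linear S" "\<And>f. S (f + birman_op f) = f" "\<And>f. S f + birman_op (S f) = f"
    using birman_op_invertible by blast
  have "(f, g + cscale (- 1) f) \<in> bs_opr m V z \<longleftrightarrow> f = S g" for f g
  proof -
    have "(f, g + cscale (- 1) f) \<in> bs_opr m V z \<longleftrightarrow> f + birman_op f = g"
      unfolding bs by (auto simp: algebra_simps)
    also have "\<dots> \<longleftrightarrow> f = S g" using S(2,3) by metis
    finally show ?thesis .
  qed
  then have "- 1 \<in> resolvent_set (bs_opr m V z)"
    unfolding resolvent_set_iff using S(1) by blast
  then show ?thesis using rho by (simp add: bs_set_def)
qed

end

end

text \<open>A real root would make \<open>z\<^sup>2\<close> real and at least
  \<open>m\<^sup>2\<close>, hence put z in the spectrum. Of two non-real opposite roots exactly one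
  lies in the upper half-plane, so the \<open>THE\<close> in \<open>momentum\<close> is well
  defined.\<close>

lemma momentum_properties:
  assumes "m \<ge> 0" "z \<in> resolvent_set (free_dirac m)"
  shows "(momentum m z)\<^sup>2 = z\<^sup>2 - (of_real m)\<^sup>2" "Im (momentum m z) > 0"
proof -
  define w where "w = z\<^sup>2 - (of_real m)\<^sup>2"
  obtain r where r: "r\<^sup>2 = w" using power2_csqrt by blast
  have "Im r \<noteq> 0"
  proof
    assume "Im r = 0"
    then have "r = of_real (Re r)" by (simp add: complex_eq_iff)
    then have "w = of_real ((Re r)\<^sup>2)" using r by (metis of_real_power)
    then have zz: "z\<^sup>2 = of_real ((Re r)\<^sup>2 + m\<^sup>2)" by (simp add: w_def algebra_simps)
    define l where "l = sqrt ((Re r)\<^sup>2 + m\<^sup>2)"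
    have "z\<^sup>2 = (of_real l)\<^sup>2" unfolding zz l_def by (simp flip: of_real_power)
    then have "z = of_real l \<or> z = of_real (- l)" by (auto simp: power2_eq_iff)
    moreover have "\<bar>m\<bar> \<le> \<bar>l\<bar>" "\<bar>m\<bar> \<le> \<bar>- l\<bar>"
      using real_sqrt_le_mono[of "m\<^sup>2" "(Re r)\<^sup>2 + m\<^sup>2"] by (simp_all add: l_def)
    ultimately show False using free_dirac_spectrum assms(2) by blast
  qed
  then obtain k where k: "k\<^sup>2 = w" "Im k > 0"
  proof (cases "Im r > 0")
    case False
    with \<open>Im r \<noteq> 0\<close> r show ?thesis by (intro that[of "- r"]) auto
  qed (use r in blast)
  have "\<exists>!k. k\<^sup>2 = z\<^sup>2 - (of_real m)\<^sup>2 \<and> Im k > 0"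
  proof (rule ex1I[of _ k])
    show "k\<^sup>2 = z\<^sup>2 - (of_real m)\<^sup>2 \<and> Im k > 0" using k by (simp add: w_def)
    fix k' assume "k'\<^sup>2 = z\<^sup>2 - (of_real m)\<^sup>2 \<and> Im k' > 0"
    then have "k'\<^sup>2 = k\<^sup>2" "Im k' > 0" using k by (simp_all add: w_def)
    then show "k' = k" using k(2) by (auto simp: power2_eq_iff)
  qed
  from theI'[OF this] show "(momentum m z)\<^sup>2 = z\<^sup>2 - (of_real m)\<^sup>2" "Im (momentum m z) > 0"
    by (simp_all add: momentum_def)
qed

section \<open>From the infimum to a single decomposition\<close>

definition decomposition_values :: "(real \<Rightarrow> complex^2^2) \<Rightarrow> real \<Rightarrow> real set" where
  "decomposition_values V \<epsilon> = {LINT x|lebesgue. mat_norm (W x) | W X.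
     (AE x in lebesgue. V x = W x + X x) \<and>
     (\<forall>i j. integrable lebesgue (\<lambda>x. W x $ i $ j)) \<and>
     esssup lebesgue (\<lambda>x. ereal (mat_norm (X x))) \<le> ereal \<epsilon>}"

lemma decomposition_values_nonneg: "s \<in> decomposition_values V \<epsilon> \<Longrightarrow> 0 \<le> s"
  unfolding decomposition_values_def using mat_norm_nonneg by (auto intro!: integral_nonneg)

text \<open>Each vanishing bounded entry is cut off at a radius beyond which it is at most
  \<open>\<epsilon> / 4\<close>. The bounded inner part is integrable and joins W, and the four
  tails add up to at most \<open>\<epsilon>\<close>. Without a member the \<open>Inf\<close> in
  \<open>C_eps\<close> would carry no information.\<close>

lemma decomposition_values_nonempty:
  assumes V: "\<forall>i j. \<exists>w x. integrable lebesgue w \<and> x \<in> L_infinity_0 \<and> (\<forall>t. V t $ i $ j = w t + x t)"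
    and "\<epsilon> > 0"
  shows "decomposition_values V \<epsilon> \<noteq> {}"
proof -
  obtain w x where wx: "\<And>i j. integrable lebesgue (w i j)" "\<And>i j. x i j \<in> L_infinity_0" "\<And>i j t. V t $ i $ j = w i j t + x i j t"
    using V by metis
  have [measurable]: "x i j \<in> borel_measurable lebesgue" for i j
    using wx(2)[of i j] by (simp add: L_infinity_0_def)
  have "\<exists>R. AE t in lebesgue. \<bar>t\<bar> > R \<longrightarrow> norm (x i j t) \<le> \<epsilon> / 4" for i j
  proof -
    have "\<forall>e>0. \<exists>R. AE t in lebesgue. \<bar>t\<bar> > R \<longrightarrow> norm (x i j t) \<le> e"
      using wx(2)[of i j] by (simp add: L_infinity_0_def)
    from this[rule_format, of "\<epsilon> / 4"] \<open>\<epsilon> > 0\<close> show ?thesis by simp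
  qed
  then obtain R where R: "\<And>i j. AE t in lebesgue. \<bar>t\<bar> > R i j \<longrightarrow> norm (x i j t) \<le> \<epsilon> / 4" by metis
  have "\<exists>C. AE t in lebesgue. norm (x i j t) \<le> C" for i j
    using wx(2)[of i j] by (simp add: L_infinity_0_def)
  then obtain C where C: "\<And>i j. AE t in lebesgue. norm (x i j t) \<le> C i j" by metis
  define y where "y i j t = indicator {- R i j..R i j} t *\<^sub>R x i j t" for i j t
  have y: "integrable lebesgue (y i j)" for i j
  proof (rule Bochner_Integration.integrable_bound)
    have "integrable lebesgue (indicator {- R i j..R i j} :: real \<Rightarrow> real)"
      by (rule integrable_real_indicator) (auto simp: emeasure_lborel_Icc_eq)
    then show "integrable lebesgue (\<lambda>t. C i j * indicator {- R i j..R i j} t)" by simp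
    show "AE t in lebesgue. norm (y i j t) \<le> norm (C i j * indicator {- R i j..R i j} t)"
      using C[of i j] by eventually_elim (auto simp: y_def indicator_def)
    show "y i j \<in> borel_measurable lebesgue"
      unfolding y_def[abs_def] by (intro borel_measurable_scaleR borel_measurable_indicator) auto
  qed
  define W where "W t = (\<chi> i j. w i j t + y i j t)" for t
  define X where "X t = (\<chi> i j. x i j t - y i j t)" for t
  have [measurable]: "X \<in> borel_measurable lebesgue"
    by (rule borel_measurable_matI) (use y in \<open>simp add: X_def\<close>)
  have Xle: "AE t in lebesgue. norm (X t $ i $ j) \<le> \<epsilon> / 4" for i j
    using R[of i j] by eventually_elim (use \<open>\<epsilon> > 0\<close> in \<open>auto simp: X_def y_def indicator_def abs_le_iff not_le\<close>)
  have "AE t in lebesgue. mat_norm (X t) \<le> \<epsilon>"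
    using Xle[of 1 1] Xle[of 1 2] Xle[of 2 1] Xle[of 2 2]
  proof eventually_elim
    case (elim t)
    then show ?case using mat_norm_le_norm[of "X t"] norm_mat_le_sum[of "X t"] by linarith
  qed
  moreover have "(\<lambda>x. ereal (mat_norm (X x))) \<in> borel_measurable lebesgue" by measurable
  ultimately have "esssup lebesgue (\<lambda>x. ereal (mat_norm (X x))) \<le> ereal \<epsilon>"
    by (intro esssup_I) simp_all
  moreover have "\<forall>i j. integrable lebesgue (\<lambda>x. W x $ i $ j)" using wx(1) y by (simp add: W_def)
  moreover have "V t = W t + X t" for t by (simp add: vec_eq_iff W_def X_def wx(3))
  ultimately show ?thesis unfolding decomposition_values_def by blast
qed

theorem theorem4p1:
  fixes m \<epsilon> :: real
    and V :: "real \<Rightarrow> complex^2^2"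
    and H :: opr
    and z :: complex
  assumes "m \<ge> 0"
    and "\<forall>i j. \<exists>w x. integrable lebesgue w \<and> x \<in> L_infinity_0 \<and> (\<forall>t. V t $ i $ j = w t + x t)"
    and "is_dirac_opr m V H"
    and "z \<in> resolvent_set (free_dirac m)"
    and "\<epsilon> > 0"
    and "C_eps V \<epsilon> < inverse (eta (norm (Phi m z)))"
    and "1 / infdist z (op_spectrum (free_dirac m))
         + (eta (norm (Phi m z)))\<^sup>2 / Im (momentum m z)
           * (C_eps V \<epsilon> / (1 - eta (norm (Phi m z)) * C_eps V \<epsilon>))
         < 1 / \<epsilon>"
  shows "z \<notin> op_spectrum H"
proof -
  interpret dirac_green m z "momentum m z"
    by unfold_locales (rule momentum_properties[OF assms(1,4)])+
  define k where "k = momentum m z"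
  define C where "C = C_eps V \<epsilon>"
  have C: "C = Inf (decomposition_values V \<epsilon>)"
    by (simp add: C_def C_eps_def decomposition_values_def)
  note ne = decomposition_values_nonempty[OF assms(2,5)]
  have "C \<ge> 0" unfolding C by (rule cInf_greatest[OF ne decomposition_values_nonneg])
  have small: "eta_z * C < 1"
    using assms(6) eta_z_pos by (simp add: C_def field_simps)
  \<comment> \<open>The left side of the second hypothesis as a function of the constant.
    Right-continuity at C leaves room for some c > C that satisfies both strict inequalities, and
    then for a decomposition with value s below c.\<close>
  define F where "F c = 1 / infdist z (op_spectrum (free_dirac m)) + eta_z\<^sup>2 / Im k * (c / (1 - eta_z * c))" for c
  have "F C < 1 / \<epsilon>" using assms(7) by (simp add: F_def C_def k_def)
  moreover have "(F \<longlongrightarrow> F C) (at_right C)"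
    unfolding F_def using small by (intro tendsto_intros) auto
  ultimately have "\<forall>\<^sub>F c in at_right C. F c < 1 / \<epsilon>" by (intro order_tendstoD(2))
  moreover have "\<forall>\<^sub>F c in at_right C. eta_z * c < 1"
    using small
    by (intro order_tendstoD(2)[where y = "eta_z * C"] tendsto_intros)
  moreover have "\<forall>\<^sub>F c in at_right C. C < c" by (simp add: eventually_at_right_less)
  ultimately have "\<forall>\<^sub>F c in at_right C. F c < 1 / \<epsilon> \<and> eta_z * c < 1 \<and> C < c"
    by eventually_elim simp
  then obtain c where c: "F c < 1 / \<epsilon>" "eta_z * c < 1" "C < c"
    using eventually_happens[of _ "at_right C"] by auto
  obtain s where s: "s \<in> decomposition_values V \<epsilon>" "s < c"
    using cInf_lessD[OF ne, of c] c(3) unfolding C by blast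
  then obtain W X where W: "AE x in lebesgue. V x = W x + X x" "\<And>i j. integrable lebesgue (\<lambda>x. W x $ i $ j)"
    "esssup lebesgue (\<lambda>x. ereal (mat_norm (X x))) \<le> ereal \<epsilon>" "s = (LINT x|lebesgue. mat_norm (W x))"
    unfolding decomposition_values_def by blast
  have "AE x in lebesgue. mat_norm (V x - W x) \<le> \<epsilon>"
    using W(1) esssup_AE[where M = lebesgue and f = "\<lambda>x. ereal (mat_norm (X x))"]
  proof eventually_elim
    case (elim x)
    from order_trans[OF elim(2) W(3)] show ?case using elim(1) by simp
  qed
  moreover have "V \<in> borel_measurable lebesgue"
  proof (rule borel_measurable_matI)
    fix i j
    obtain w x where wx: "integrable lebesgue w" "x \<in> L_infinity_0" "\<And>t. V t $ i $ j = w t + x t"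
      using assms(2) by blast
    then have "(\<lambda>t. w t + x t) \<in> borel_measurable lebesgue"
      by (intro borel_measurable_add) (auto simp: L_infinity_0_def)
    then show "(\<lambda>t. V t $ i $ j) \<in> borel_measurable lebesgue" by (simp add: wx(3))
  qed
  ultimately interpret dirac_perturbation m z "momentum m z" V W \<epsilon>
    using assms(1,4,5) W(2) by unfold_locales auto
  have s_eq: "W_norm = s" by (simp add: W_norm_def W(4))
  have "eta_z * s \<le> eta_z * c" using s(2) eta_z_pos by simp
  then have "eta_z * W_norm < 1" using c(2) s_eq by simp
  moreover have "1 / gap + eta_z\<^sup>2 / Im (momentum m z) * (W_norm / (1 - eta_z * W_norm)) < 1 / \<epsilon>"
  proof -
    \<comment> \<open>The left side is increasing in the constant, so the inequality passes from c
      down to s.\<close>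
    have "s / (1 - eta_z * s) \<le> c / (1 - eta_z * c)"
      using s(2) c(2) \<open>eta_z * s \<le> eta_z * c\<close> decomposition_values_nonneg[OF s(1)]
      by (intro frac_le) auto
    then have "eta_z\<^sup>2 / Im k * (s / (1 - eta_z * s)) \<le> eta_z\<^sup>2 / Im k * (c / (1 - eta_z * c))"
      using k_pos by (intro mult_left_mono) (auto simp: k_def)
    then show ?thesis using c(1) by (simp add: F_def gap_def s_eq k_def)
  qed
  ultimately have "z \<in> bs_set m V" by (rule mem_bs_set)
  \<comment> \<open>By \<open>is_dirac_opr\<close>, the set \<open>bs_set m V\<close> is the part of
    the resolvent set of H that lies in that of the free operator.\<close>
  then have "z \<in> resolvent_set H" using assms(3) unfolding is_dirac_opr_def by blast
  then show ?thesis by (simp add: op_spectrum_def)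
qed

end
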